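(* Let $E$ be a Banach space and let $A\colon\mathbb{R}\to\mathcal{L}(E)$ be an asymptotically hyperbolic path such that $A(t)$ is essentially hyperbolic for every $t\in\mathbb{R}$. Then $A$ is essentially splitting if and only if the set $\{P^+(A(t)):t\in\mathbb{R}\}$ is contained in a single class of compact perturbation, i.e. $P^+(A(t))-P^+(A(s))$ is compact for all $s,t\in\mathbb{R}$.
   Context: A path $A\colon\mathbb{R}\to\mathcal{L}(E)$ is asymptotically hyperbolic if it is norm-continuous and has norm limits $A(\pm\infty)$ as $t\to\pm\infty$, both with spectrum disjoint from $i\mathbb{R}$ (for real $E$, spectra are those of the complexification). $E^+(A(\pm\infty))$ and $E^-(A(\pm\infty))$ are the ranges of the spectral projectors of $A(\pm\infty)$ associated with the parts of the spectrum with positive and negative real part. An operator $T\in\mathcal{L}(E)$ is essentially hyperbolic if $T-\lambda I$ is Fredholm for all $\lambda\in i\mathbb{R}$. For such $T$, $\sigma(T)\cap i\mathbb{R}$ is a finite set of isolated points of $\sigma(T)$, and $P^+(T)$ denotes the spectral projector of $T$ associated with $\sigma(T)\cap\{\operatorname{Re}z>0\}$. Two closed complemented subspaces $X,Y\subset E$ are compact perturbation of each other if, for projectors $P,Q$ with ranges $X,Y$, the operators $(I-P)Q$ and $(I-Q)P$ are compact (independent of the choice of projectors). A splitting $E=E_1\oplus E_2$ into closed subspaces is essential for $T\in\mathcal{L}(E)$ if there is $T_0\in\mathcal{L}(E)$ with $T-T_0$ compact and $T_0(E_i)\subset E_i$, $i=1,2$. An asymptotically hyperbolic path $A$ is essentially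 splitting if: (i) the splitting $E=E^+(A(+\infty))\oplus E^-(A(+\infty))$ is essential for $A(t)$ for all $t>0$, and the splitting $E=E^+(A(-\infty))\oplus E^-(A(-\infty))$ is essential for $A(t)$ for all $t\le 0$; (ii) $E^-(A(-\infty))$ is a compact perturbation of $E^-(A(+\infty))$. *)

theory Defs
  imports "HOL-Complex_Analysis.Complex_Analysis"
begin

section \<open>Banach spaces over the reals or the complex numbers\<close>

text \<open>
  The carrier is always a type of class \<open>banach\<close>, i.e. a real Banach space. A complex Banach
  space is such a type together with the operator "multiplication by i"; the homogeneity of the
  norm over the complex numbers is part of the structure. The type parameter \<open>'j\<close> is always
  instantiated by \<open>'a \<Rightarrow>\<^sub>L 'a\<close>.
\<close>

datatype 'j scalars = Real_Scalars | Complex_Scalars 'j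

fun banach_over :: "('a::banach \<Rightarrow>\<^sub>L 'a) scalars \<Rightarrow> bool" where
  "banach_over Real_Scalars \<longleftrightarrow> True"
| "banach_over (Complex_Scalars J) \<longleftrightarrow>
     (\<forall>x. J (J x) = - x) \<and>
     (\<forall>z x. norm (Re z *\<^sub>R x + Im z *\<^sub>R J x) = cmod z * norm x)"

fun operators :: "('a::banach \<Rightarrow>\<^sub>L 'a) scalars \<Rightarrow> ('a \<Rightarrow>\<^sub>L 'a) set" where
  "operators Real_Scalars = UNIV"
| "operators (Complex_Scalars J) = {T :: 'a \<Rightarrow>\<^sub>L 'a. \<forall>x. T (J x) = J (T x)}"

fun subspace_over :: "('a::banach \<Rightarrow>\<^sub>L 'a) scalars \<Rightarrow> 'a set \<Rightarrow> bool" where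
  "subspace_over Real_Scalars V \<longleftrightarrow> subspace V"
| "subspace_over (Complex_Scalars J) V \<longleftrightarrow> subspace V \<and> (\<forall>x\<in>V. J x \<in> V)"

text \<open>
  The complexification of a real space \<open>'a\<close> is \<open>'a \<times> 'a\<close>, with \<open>(x, y)\<close> standing for \<open>x + i y\<close>.
  The product norm is not homogeneous over the complex numbers, but it is equivalent to a norm
  that is, so invertibility, Fredholmness and convergence of operators are not affected.
\<close>

lift_definition complexify :: "('a::real_normed_vector \<Rightarrow>\<^sub>L 'a) \<Rightarrow> ('a \<times> 'a) \<Rightarrow>\<^sub>L ('a \<times> 'a)"
  is "\<lambda>T p. (T (fst p), T (snd p))"
  by (intro bounded_linear_Pair bounded_linear_compose[OF _ bounded_linear_fst]
      bounded_linear_compose[OF _ bounded_linear_snd])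

lift_definition complexification_unit :: "('a::real_normed_vector \<times> 'a) \<Rightarrow>\<^sub>L ('a \<times> 'a)"
  is "\<lambda>p. (- snd p, fst p)"
  by (intro bounded_linear_Pair bounded_linear_minus bounded_linear_fst bounded_linear_snd)


section \<open>Spectrum, Fredholm operators, spectral projectors\<close>

text \<open>In the definitions with a parameter \<open>J\<close>, this is the multiplication by i on the space.\<close>

definition scalar_op :: "('a::real_normed_vector \<Rightarrow>\<^sub>L 'a) \<Rightarrow> complex \<Rightarrow> 'a \<Rightarrow>\<^sub>L 'a" where
  "scalar_op J z = Re z *\<^sub>R id_blinfun + Im z *\<^sub>R J"

definition is_inverse_op :: "('a::real_normed_vector \<Rightarrow>\<^sub>L 'a) \<Rightarrow> ('a \<Rightarrow>\<^sub>L 'a) \<Rightarrow> bool" where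
  "is_inverse_op T R \<longleftrightarrow> T o\<^sub>L R = id_blinfun \<and> R o\<^sub>L T = id_blinfun"

definition spectrum_wrt :: "('a::real_normed_vector \<Rightarrow>\<^sub>L 'a) \<Rightarrow> ('a \<Rightarrow>\<^sub>L 'a) \<Rightarrow> complex set" where
  "spectrum_wrt J T = {z. \<nexists>R. is_inverse_op (scalar_op J z - T) R}"

definition resolvent_wrt ::
    "('a::real_normed_vector \<Rightarrow>\<^sub>L 'a) \<Rightarrow> ('a \<Rightarrow>\<^sub>L 'a) \<Rightarrow> complex \<Rightarrow> 'a \<Rightarrow>\<^sub>L 'a" where
  "resolvent_wrt J T z = (THE R. is_inverse_op (scalar_op J z - T) R)"

text \<open>Operator-valued analogue of \<^const>\<open>contour_integral\<close>.\<close>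

definition op_contour_integral ::
    "('a::banach \<Rightarrow>\<^sub>L 'a) \<Rightarrow> (real \<Rightarrow> complex) \<Rightarrow> (complex \<Rightarrow> 'a \<Rightarrow>\<^sub>L 'a) \<Rightarrow> 'a \<Rightarrow>\<^sub>L 'a" where
  "op_contour_integral J \<gamma> F =
     integral {0..1} (\<lambda>t. scalar_op J (vector_derivative \<gamma> (at t within {0..1})) o\<^sub>L F (\<gamma> t))"

text \<open>
  The Riesz projector of \<open>T\<close> for a part \<open>S\<close> of its spectrum. The contour is a circle in the
  resolvent set with \<open>S\<close> inside and the rest of the spectrum outside; the result does not depend
  on the circle. Circles suffice here: below, \<open>S\<close> is always a compact set that is the part of the
  spectrum in an open half-plane bounded by the imaginary axis, and every compact subset of an
  open half-plane lies in an open disc whose closure is contained in that half-plane.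
\<close>

definition spectral_projector_wrt ::
    "('a::banach \<Rightarrow>\<^sub>L 'a) \<Rightarrow> ('a \<Rightarrow>\<^sub>L 'a) \<Rightarrow> complex set \<Rightarrow> 'a \<Rightarrow>\<^sub>L 'a" where
  "spectral_projector_wrt J T S =
     (THE P. \<exists>c r. 0 < r \<and> spectrum_wrt J T \<inter> sphere c r = {} \<and> spectrum_wrt J T \<inter> ball c r = S \<and>
        P = scalar_op J (1 / (2 * of_real pi * \<i>)) o\<^sub>L
              op_contour_integral J (circlepath c r) (resolvent_wrt J T))"

definition fredholm :: "('a::real_normed_vector \<Rightarrow>\<^sub>L 'a) \<Rightarrow> bool" where
  "fredholm T \<longleftrightarrow>
     (\<exists>B. finite B \<and> {x. T x = 0} \<subseteq> span B) \<and>
     closed (range T) \<and>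
     (\<exists>B. finite B \<and> (\<forall>y. \<exists>x. y - T x \<in> span B))"

definition compact_operator ::
    "('a::real_normed_vector \<Rightarrow>\<^sub>L 'b::real_normed_vector) \<Rightarrow> bool" where
  "compact_operator T \<longleftrightarrow> compact (closure (T ` cball 0 1))"

fun spectrum :: "('a::banach \<Rightarrow>\<^sub>L 'a) scalars \<Rightarrow> ('a \<Rightarrow>\<^sub>L 'a) \<Rightarrow> complex set" where
  "spectrum Real_Scalars T = spectrum_wrt complexification_unit (complexify T)"
| "spectrum (Complex_Scalars J) T = spectrum_wrt J T"

text \<open>
  Over the reals, the spectral projector of the complexification for a part of the spectrum that
  is symmetric under conjugation is the complexification of an operator on the real space.
\<close>

fun spectral_projector ::
    "('a::banach \<Rightarrow>\<^sub>L 'a) scalars \<Rightarrow> ('a \<Rightarrow>\<^sub>L 'a) \<Rightarrow> complex set \<Rightarrow> 'a \<Rightarrow>\<^sub>L 'a" where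
  "spectral_projector Real_Scalars T S =
     (THE P. complexify P = spectral_projector_wrt complexification_unit (complexify T) S)"
| "spectral_projector (Complex_Scalars J) T S = spectral_projector_wrt J T S"

definition pos_projector :: "('a::banach \<Rightarrow>\<^sub>L 'a) scalars \<Rightarrow> ('a \<Rightarrow>\<^sub>L 'a) \<Rightarrow> 'a \<Rightarrow>\<^sub>L 'a" where
  "pos_projector K T = spectral_projector K T (spectrum K T \<inter> {z. Re z > 0})"

definition neg_projector :: "('a::banach \<Rightarrow>\<^sub>L 'a) scalars \<Rightarrow> ('a \<Rightarrow>\<^sub>L 'a) \<Rightarrow> 'a \<Rightarrow>\<^sub>L 'a" where
  "neg_projector K T = spectral_projector K T (spectrum K T \<inter> {z. Re z < 0})"

definition pos_space :: "('a::banach \<Rightarrow>\<^sub>L 'a) scalars \<Rightarrow> ('a \<Rightarrow>\<^sub>L 'a) \<Rightarrow> 'a set" where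
  "pos_space K T = range (pos_projector K T)"

definition neg_space :: "('a::banach \<Rightarrow>\<^sub>L 'a) scalars \<Rightarrow> ('a \<Rightarrow>\<^sub>L 'a) \<Rightarrow> 'a set" where
  "neg_space K T = range (neg_projector K T)"

fun essentially_hyperbolic :: "('a::banach \<Rightarrow>\<^sub>L 'a) scalars \<Rightarrow> ('a \<Rightarrow>\<^sub>L 'a) \<Rightarrow> bool" where
  "essentially_hyperbolic Real_Scalars T \<longleftrightarrow>
     (\<forall>z. Re z = 0 \<longrightarrow> fredholm (complexify T - scalar_op complexification_unit z))"
| "essentially_hyperbolic (Complex_Scalars J) T \<longleftrightarrow>
     (\<forall>z. Re z = 0 \<longrightarrow> fredholm (T - scalar_op J z))"


section \<open>Compact perturbations and essential splittings\<close>

definition projector_onto :: "('a::banach \<Rightarrow>\<^sub>L 'a) scalars \<Rightarrow> 'a set \<Rightarrow> ('a \<Rightarrow>\<^sub>L 'a) \<Rightarrow> bool" where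
  "projector_onto K X P \<longleftrightarrow> P \<in> operators K \<and> P o\<^sub>L P = P \<and> range P = X"

text \<open>
  The existence of \<open>P\<close> and \<open>Q\<close> says that \<open>X\<close> and \<open>Y\<close> are closed and complemented; the
  compactness condition does not depend on the choice of \<open>P\<close> and \<open>Q\<close>.
\<close>

definition compact_perturbation :: "('a::banach \<Rightarrow>\<^sub>L 'a) scalars \<Rightarrow> 'a set \<Rightarrow> 'a set \<Rightarrow> bool" where
  "compact_perturbation K X Y \<longleftrightarrow>
     (\<exists>P Q. projector_onto K X P \<and> projector_onto K Y Q \<and>
        compact_operator ((id_blinfun - P) o\<^sub>L Q) \<and> compact_operator ((id_blinfun - Q) o\<^sub>L P))"

definition splitting :: "('a::banach \<Rightarrow>\<^sub>L 'a) scalars \<Rightarrow> 'a set \<Rightarrow> 'a set \<Rightarrow> bool" where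
  "splitting K E1 E2 \<longleftrightarrow>
     subspace_over K E1 \<and> closed E1 \<and> subspace_over K E2 \<and> closed E2 \<and>
     E1 \<inter> E2 = {0} \<and> (\<forall>x. \<exists>u\<in>E1. \<exists>v\<in>E2. x = u + v)"

definition essential_splitting ::
    "('a::banach \<Rightarrow>\<^sub>L 'a) scalars \<Rightarrow> ('a \<Rightarrow>\<^sub>L 'a) \<Rightarrow> 'a set \<Rightarrow> 'a set \<Rightarrow> bool" where
  "essential_splitting K T E1 E2 \<longleftrightarrow>
     splitting K E1 E2 \<and>
     (\<exists>T0\<in>operators K. compact_operator (T - T0) \<and> T0 ` E1 \<subseteq> E1 \<and> T0 ` E2 \<subseteq> E2)"

definition asymptotically_hyperbolic ::
    "('a::banach \<Rightarrow>\<^sub>L 'a) scalars \<Rightarrow> (real \<Rightarrow> 'a \<Rightarrow>\<^sub>L 'a) \<Rightarrow> bool" where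
  "asymptotically_hyperbolic K A \<longleftrightarrow>
     range A \<subseteq> operators K \<and> continuous_on UNIV A \<and>
     (\<exists>L. (A \<longlongrightarrow> L) at_top \<and> (\<forall>z\<in>spectrum K L. Re z \<noteq> 0)) \<and>
     (\<exists>L. (A \<longlongrightarrow> L) at_bot \<and> (\<forall>z\<in>spectrum K L. Re z \<noteq> 0))"

definition essentially_splitting ::
    "('a::banach \<Rightarrow>\<^sub>L 'a) scalars \<Rightarrow> (real \<Rightarrow> 'a \<Rightarrow>\<^sub>L 'a) \<Rightarrow> bool" where
  "essentially_splitting K A \<longleftrightarrow>
     asymptotically_hyperbolic K A \<and>
     (\<forall>t>0. essential_splitting K (A t) (pos_space K (Lim at_top A)) (neg_space K (Lim at_top A))) \<and>
     (\<forall>t\<le>0. essential_splitting K (A t) (pos_space K (Lim at_bot A)) (neg_space K (Lim at_bot A))) \<and>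
     compact_perturbation K (neg_space K (Lim at_bot A)) (neg_space K (Lim at_top A))"

end

theory Submission
  imports Defs "Jordan_Normal_Form.Determinant"
begin

text \<open>
  Let \<open>p(t)\<close> be the class of \<open>P\<^sup>+(A(t))\<close> modulo compact operators. It depends continuously on \<open>t\<close>:
  a circle around the positive spectrum of \<open>A(t)\<close> encloses the positive essential spectrum of nearby
  operators, and modulo compact operators a Riesz projector only depends on the enclosed essential
  spectrum. (Such a circle exists because the spectrum is discrete near the imaginary axis: there
  \<open>z - A(t)\<close> is a finite-rank perturbation of an invertible operator, so its invertibility is decided by
  a holomorphic determinant that does not vanish far out.)
  If \<open>A(t)\<close> commutes modulo compact operators with \<open>p = P\<^sup>+(A(+\<infinity>))\<close> for \<open>t > 0\<close>, then so does \<open>p(t)\<close>,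
  and two commuting projectors whose difference has essential norm less than \<open>1\<close> agree modulo
  compact operators. Hence the set of \<open>t \<ge> 0\<close> with \<open>p(t) = p\<close> is open, closed and nonempty. The same
  holds for \<open>t \<le> 0\<close>, and \<open>t = 0\<close> links the two sides; condition (ii) follows from condition (i).
  Conversely, if all \<open>p(t)\<close> agree, they agree with both limits, and \<open>A(t)\<close> commutes with its own projector.

  Instead of the Calkin algebra we use the bounded functionals on the operators that vanish on a
  closed ideal. By Hahn--Banach they detect membership in the ideal, and they turn resolvents into
  scalar holomorphic functions, to which Cauchy's theorem applies. The ideals are \<open>{0}\<close> and the
  compact operators.
\<close>

text \<open>The library operator \<open>o\<^sub>L\<close> binds weaker than addition and subtraction; \<open>\<circ>\<^sub>L\<close> binds stronger.\<close>

notation blinfun_compose (infixl "\<circ>\<^sub>L" 70)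

section \<open>The Hahn--Banach theorem\<close>

text \<open>Two obstacles shape the argument. The projector \<open>P+(A(t))\<close> itself need not
  depend continuously on \<open>t\<close>: isolated points of the spectrum may cross the imaginary
  axis, and then it jumps. The jump is compact, so continuity is stated up to a compact correction.
  Secondly, Fredholmness at the points of the axis leaves the index open, whereas the determinant
  exists only for index zero. The index is pinned down by moving along the axis: it is locally
  constant there, and far out the operator is invertible. No index is defined for this; index zero
  is encoded as invertibility after a finite-rank correction, and this property is shown to be open
  and closed along the axis.

  The limits of the path are treated together with its values: both kinds of operator have positive
  spectrum that a circle separates from the rest, and no essential spectrum on the axis. Real spaces
  are reached through their complexification; all circles have real centres, which makes the complex
  Riesz projectors invariant under conjugation.\<close>

definition sublinear :: "('a::real_vector \<Rightarrow> real) \<Rightarrow> bool" where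
  "sublinear q \<longleftrightarrow> (\<forall>x y. q (x + y) \<le> q x + q y) \<and> (\<forall>t x. 0 \<le> t \<longrightarrow> q (t *\<^sub>R x) = t * q x)"

lemma sublinear_zero: "sublinear q \<Longrightarrow> q 0 = 0"
  unfolding sublinear_def by (metis mult_zero_left order_refl scale_zero_left)

lemma sublinear_neg_le: "sublinear q \<Longrightarrow> - q (- x) \<le> q x"
  using sublinear_zero[of q] unfolding sublinear_def
  by (metis add.right_inverse add_le_cancel_left add.commute le_minus_iff neg_le_iff_le add_uminus_conv_diff diff_le_eq diff_0)

text \<open>Directedness is what makes the infimum subadditive: a member nearly optimal at
  \<open>x\<close> and one nearly optimal at \<open>y\<close> have a common minorant in
  \<open>C\<close>, which is nearly optimal at both points. Applied to chains, this supplies the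
  bounds for Zorn's lemma.\<close>

lemma sublinear_INF:
  assumes "C \<noteq> {}" and sub: "\<And>q. q \<in> C \<Longrightarrow> sublinear q"
    and bdd: "\<And>x. bdd_below ((\<lambda>q. q x) ` C)"
    and dir: "\<And>q r. q \<in> C \<Longrightarrow> r \<in> C \<Longrightarrow> \<exists>s\<in>C. s \<le> q \<and> s \<le> r"
  shows "sublinear (\<lambda>x. INF q\<in>C. q x)"
  unfolding sublinear_def
proof (intro conjI allI impI)
  fix x y
  show "(INF q\<in>C. q (x + y)) \<le> (INF q\<in>C. q x) + (INF q\<in>C. q y)"
  proof (rule ccontr)
    assume "\<not> ?thesis"
    then have "(INF q\<in>C. q x) < (INF q\<in>C. q (x + y)) - (INF q\<in>C. q y)" by simp
    then obtain q where q: "q \<in> C" "q x < (INF q\<in>C. q (x + y)) - (INF q\<in>C. q y)"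
      using cINF_less_iff[OF assms(1) bdd] by blast
    then have "(INF q\<in>C. q y) < (INF q\<in>C. q (x + y)) - q x" by simp
    then obtain r where r: "r \<in> C" "r y < (INF q\<in>C. q (x + y)) - q x"
      using cINF_less_iff[OF assms(1) bdd] by blast
    obtain s where s: "s \<in> C" "s \<le> q" "s \<le> r" using dir q r by blast
    have "(INF q\<in>C. q (x + y)) \<le> s (x + y)" using s bdd by (intro cINF_lower) auto
    also have "\<dots> \<le> s x + s y" using sub[OF s(1)] unfolding sublinear_def by blast
    also have "\<dots> \<le> q x + r y" using s by (intro add_mono) (auto simp: le_fun_def)
    finally show False using r by simp
  qed
next
  fix t :: real and x assume t: "0 \<le> t"
  have eq: "(INF q\<in>C. q (t *\<^sub>R x)) = (INF q\<in>C. t * q x)"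
    using sub t by (intro INF_cong) (auto simp: sublinear_def)
  show "(INF q\<in>C. q (t *\<^sub>R x)) = t * (INF q\<in>C. q x)"
  proof (cases "t = 0")
    case True then show ?thesis using assms(1) eq by simp
  next
    case False
    with t have t: "t > 0" by simp
    show ?thesis unfolding eq
    proof (rule antisym)
      have "(INF q\<in>C. t * q x) / t \<le> (INF q\<in>C. q x)"
      proof (rule cINF_greatest[OF assms(1)])
        fix q assume "q \<in> C"
        have "bdd_below ((\<lambda>q. t * q x) ` C)"
          using bdd[of "t *\<^sub>R x"] sub t by (auto simp: bdd_below_def sublinear_def)
        then have "(INF q\<in>C. t * q x) \<le> t * q x" using \<open>q \<in> C\<close> by (intro cINF_lower) auto
        then show "(INF q\<in>C. t * q x) / t \<le> q x" using t by (simp add: divide_simps mult.commute)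
      qed
      then show "(INF q\<in>C. t * q x) \<le> t * (INF q\<in>C. q x)" using t by (simp add: divide_simps mult.commute)
      show "t * (INF q\<in>C. q x) \<le> (INF q\<in>C. t * q x)"
        using t by (intro cINF_greatest[OF assms(1)] mult_left_mono cINF_lower bdd) auto
    qed
  qed
qed

text \<open>The infimum lowers \<open>q\<close> as far as the direction \<open>y\<close> permits: at
  \<open>- y\<close> the term \<open>t = 1\<close> gives a value of at most \<open>- q y\<close>.
  The lowered functional serves twice, to show that minimal functionals are additive and to force a
  nonzero value in the separation theorem.\<close>

lemma sublinear_lower:
  assumes q: "sublinear q"
  shows "sublinear (\<lambda>x. INF t\<in>{0..}. q (x + t *\<^sub>R y) - t * q y)"
    and "\<And>t x. 0 \<le> t \<Longrightarrow> (INF t\<in>{0..}. q (x + t *\<^sub>R y) - t * q y) \<le> q (x + t *\<^sub>R y) - t * q y"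
proof -
  have lb: "- q (- x) \<le> q (x + t *\<^sub>R y) - t * q y" if "0 \<le> t" for t x
  proof -
    have "t * q y = q ((x + t *\<^sub>R y) + (- x))" using q that by (simp add: sublinear_def)
    also have "\<dots> \<le> q (x + t *\<^sub>R y) + q (- x)" using q unfolding sublinear_def by blast
    finally show ?thesis by simp
  qed
  have bdd: "bdd_below ((\<lambda>t. q (x + t *\<^sub>R y) - t * q y) ` {0..})" for x
    using lb by (auto simp: bdd_below_def)
  then show lower: "(INF t\<in>{0..}. q (x + t *\<^sub>R y) - t * q y) \<le> q (x + t *\<^sub>R y) - t * q y" if "0 \<le> t" for t x
    using that by (intro cINF_lower) auto
  show "sublinear (\<lambda>x. INF t\<in>{0..}. q (x + t *\<^sub>R y) - t * q y)" (is "sublinear ?r")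
    unfolding sublinear_def
  proof (intro conjI allI impI)
    fix u v
    have ne: "{0::real..} \<noteq> {}" by auto
    have "?r (u + v) - (q (u + t *\<^sub>R y) - t * q y) \<le> ?r v" if t: "0 \<le> t" for t
    proof (rule cINF_greatest[OF ne])
      fix s :: real assume s: "s \<in> {0..}"
      have "?r (u + v) \<le> q (u + v + (t + s) *\<^sub>R y) - (t + s) * q y" using t s by (intro lower) auto
      also have "u + v + (t + s) *\<^sub>R y = (u + t *\<^sub>R y) + (v + s *\<^sub>R y)" by (simp add: algebra_simps)
      also have "q \<dots> \<le> q (u + t *\<^sub>R y) + q (v + s *\<^sub>R y)" using q unfolding sublinear_def by blast
      finally show "?r (u + v) - (q (u + t *\<^sub>R y) - t * q y) \<le> q (v + s *\<^sub>R y) - s * q y"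
        by (simp add: algebra_simps)
    qed
    then have "?r (u + v) - ?r v \<le> ?r u" by (intro cINF_greatest[OF ne]) (auto simp: algebra_simps)
    then show "?r (u + v) \<le> ?r u + ?r v" by simp
  next
    fix s :: real and x assume s: "0 \<le> s"
    show "?r (s *\<^sub>R x) = s * ?r x"
    proof (cases "s = 0")
      case True
      have "?r 0 = 0"
      proof (rule antisym)
        show "?r 0 \<le> 0" using lower[of 0 0] sublinear_zero[OF q] by simp
        show "0 \<le> ?r 0" using lb[of _ 0] sublinear_zero[OF q] by (intro cINF_greatest) auto
      qed
      then show ?thesis using True by simp
    next
      case False
      with s have s: "s > 0" by simp
      have eq: "q (s *\<^sub>R x + t *\<^sub>R y) - t * q y = s * (q (x + (t / s) *\<^sub>R y) - (t / s) * q y)" for t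
      proof -
        have "q (s *\<^sub>R x + t *\<^sub>R y) = q (s *\<^sub>R (x + (t / s) *\<^sub>R y))" using s by (simp add: algebra_simps)
        also have "\<dots> = s * q (x + (t / s) *\<^sub>R y)" using q s unfolding sublinear_def by simp
        finally show ?thesis using s by (simp add: algebra_simps)
      qed
      show ?thesis
      proof (rule antisym)
        have "?r (s *\<^sub>R x) / s \<le> ?r x"
        proof (rule cINF_greatest)
          fix t :: real assume "t \<in> {0..}"
          then have "?r (s *\<^sub>R x) \<le> q (s *\<^sub>R x + (s * t) *\<^sub>R y) - (s * t) * q y" using s by (intro lower) auto
          also have "\<dots> = s * (q (x + t *\<^sub>R y) - t * q y)" using s by (subst eq) simp
          finally show "?r (s *\<^sub>R x) / s \<le> q (x + t *\<^sub>R y) - t * q y"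
            using s by (simp add: divide_simps mult.commute)
        qed auto
        then show "?r (s *\<^sub>R x) \<le> s * ?r x" using s by (simp add: divide_simps mult.commute)
        show "s * ?r x \<le> ?r (s *\<^sub>R x)"
          unfolding eq using s by (intro cINF_greatest mult_left_mono lower) auto
      qed
    qed
  qed
qed

text \<open>By minimality the lowered functional of \<open>sublinear_lower\<close> is
  \<open>q\<close> itself; its term at \<open>t = 1\<close> then reads as superadditivity, the
  missing half of additivity.\<close>

lemma sublinear_minimal_linear:
  assumes q: "sublinear q" and min: "\<And>r. sublinear r \<Longrightarrow> r \<le> q \<Longrightarrow> r = q"
  shows "linear q"
proof -
  have sup: "q x + q y \<le> q (x + y)" for x y
  proof -
    let ?r = "\<lambda>x. INF t\<in>{0..}. q (x + t *\<^sub>R y) - t * q y"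
    have "?r = q" using sublinear_lower(1)[OF q, of y] sublinear_lower(2)[OF q, where t=0 and y=y]
      by (intro min) (auto simp: le_fun_def)
    then have "q x = ?r x" by (rule fun_cong[OF sym])
    also have "\<dots> \<le> q (x + 1 *\<^sub>R y) - 1 * q y" by (rule sublinear_lower(2)[OF q]) simp
    finally show ?thesis by simp
  qed
  have add: "q (x + y) = q x + q y" for x y
    using sup[of x y] q unfolding sublinear_def by (simp add: order_antisym)
  have neg: "q (- x) = - q x" for x
    using add[of x "- x"] sublinear_zero[OF q] by simp
  have scale: "q (t *\<^sub>R x) = t * q x" for t x
  proof (cases "0 \<le> t")
    case True then show ?thesis using q by (simp add: sublinear_def)
  next
    case False
    then have "q ((- t) *\<^sub>R x) = (- t) * q x" using q unfolding sublinear_def by (metis le_cases neg_0_le_iff_le)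
    then show ?thesis using neg[of "t *\<^sub>R x"] by simp
  qed
  show ?thesis by (rule linearI) (simp_all add: add scale)
qed

text \<open>Minimal sublinear functionals are linear, so Zorn's lemma below \<open>p\<close> gives Hahn--Banach
  without partially defined functionals.\<close>

lemma sublinear_dominates_linear:
  assumes p: "sublinear p"
  obtains f where "linear f" "\<And>x. f x \<le> p x"
proof -
  let ?A = "{q. sublinear q \<and> q \<le> p}"
  \<comment> \<open>Zorn's lemma yields maximal elements; the reversed order turns them into minimal
    functionals.\<close>
  let ?P = "\<lambda>q r. r \<le> (q :: 'a \<Rightarrow> real)"
  have "\<exists>m\<in>?A. \<forall>a\<in>?A. ?P m a \<longrightarrow> a = m"
  proof (rule predicate_Zorn)
    show "partial_order_on ?A (relation_of ?P ?A)"
      by (auto simp: partial_order_on_def preorder_on_def refl_on_def trans_def antisym_def relation_of_def)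
  next
    fix C assume C: "C \<in> Chains (relation_of ?P ?A)"
    then have CA: "C \<subseteq> ?A" and ch: "\<And>q r. q \<in> C \<Longrightarrow> r \<in> C \<Longrightarrow> q \<le> r \<or> r \<le> q"
      by (auto simp: Chains_def relation_of_def)
    show "\<exists>u\<in>?A. \<forall>a\<in>C. ?P a u"
    proof (cases "C = {}")
      case True then show ?thesis using p by auto
    next
      case False
      \<comment> \<open>The bound must be uniform in the chain: \<open>- q (- x) \<le> q x\<close>
        and \<open>q \<le> p\<close> provide \<open>- p (- x)\<close>.\<close>
      have bdd: "bdd_below ((\<lambda>q. q x) ` C)" for x
      proof (rule bdd_belowI2[where m="- p (- x)"])
        fix q assume "q \<in> C"
        then have "sublinear q" "q (- x) \<le> p (- x)" using CA by (auto simp: le_fun_def)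
        then show "- p (- x) \<le> q x" using sublinear_neg_le[of q x] by simp
      qed
      let ?u = "\<lambda>x. INF q\<in>C. q x"
      have lower: "?u \<le> q" if "q \<in> C" for q
        using bdd that by (auto simp: le_fun_def intro: cINF_lower)
      have "sublinear ?u"
      proof (rule sublinear_INF[OF False _ bdd])
        show "sublinear q" if "q \<in> C" for q using that CA by blast
        show "\<exists>s\<in>C. s \<le> q \<and> s \<le> r" if "q \<in> C" "r \<in> C" for q r
          using ch[OF that] that by blast
      qed
      moreover have "?u \<le> p" using False lower CA by (metis (mono_tags, lifting) all_not_in_conv mem_Collect_eq order_trans subset_iff)
      ultimately show ?thesis using lower by blast
    qed
  qed
  then obtain m where m: "sublinear m" "m \<le> p" "\<And>a. sublinear a \<Longrightarrow> a \<le> m \<Longrightarrow> a = m"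
    by (smt (verit, best) dual_order.trans mem_Collect_eq)
  then show thesis using that sublinear_minimal_linear by (auto simp: le_fun_def)
qed

text \<open>The distance to \<open>M\<close> is sublinear, so a linear functional below it is
  bounded and vanishes on \<open>M\<close>. Such a functional could be zero; lowering the distance
  in the direction \<open>x0\<close> beforehand forces
  \<open>f (- x0) \<le> - p x0 < 0\<close>.\<close>

lemma hahn_banach_separation:
  fixes M :: "'a::real_normed_vector set"
  assumes M: "subspace M" "closed M" and x0: "x0 \<notin> M"
  obtains f :: "'a \<Rightarrow> real" where "bounded_linear f" "\<And>x. x \<in> M \<Longrightarrow> f x = 0" "f x0 \<noteq> 0"
proof -
  define p where "p = (\<lambda>x. infdist x M)"
  have ne: "M \<noteq> {}" using M(1) subspace_0 by auto
  have p0: "0 \<le> p x" for x by (simp add: p_def infdist_nonneg)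
  have pM: "p x = 0" if "x \<in> M" for x using that by (simp add: p_def)
  have pn: "p x \<le> norm x" for x
    using infdist_le[OF subspace_0[OF M(1)], of x] by (simp add: p_def)
  have near: "\<exists>m\<in>M. norm (x - m) < p x + e" if "e > 0" for x e
    using that ne cInf_lessD[of "(dist x) ` M" "p x + e"] by (auto simp: p_def infdist_def dist_norm)
  have sub: "sublinear p"
    unfolding sublinear_def
  proof (intro conjI allI impI)
    fix x y
    show "p (x + y) \<le> p x + p y"
    proof (rule field_le_epsilon)
      fix e :: real assume e: "e > 0"
      obtain m n where "m \<in> M" "norm (x - m) < p x + e/2" "n \<in> M" "norm (y - n) < p y + e/2"
        using near[of "e/2"] e by (meson half_gt_zero)
      moreover have "p (x + y) \<le> norm ((x + y) - (m + n))"
        using M(1) calculation by (auto simp: p_def dist_norm[symmetric] intro!: infdist_le subspace_add)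
      moreover have "norm ((x + y) - (m + n)) \<le> norm (x - m) + norm (y - n)"
        by (metis add_diff_add norm_triangle_ineq)
      ultimately show "p (x + y) \<le> p x + p y + e" by linarith
    qed
  next
    have le: "p (t *\<^sub>R x) \<le> t * p x" if t: "t > 0" for t x
    proof (rule field_le_epsilon)
      fix e :: real assume e: "e > 0"
      obtain m where m: "m \<in> M" "norm (x - m) < p x + e/t" using near[of "e/t" x] e t by auto
      have "p (t *\<^sub>R x) \<le> norm (t *\<^sub>R x - t *\<^sub>R m)"
        using M(1) m by (auto simp: p_def dist_norm[symmetric] intro!: infdist_le subspace_scale)
      also have "\<dots> = t * norm (x - m)" using t by (simp flip: scaleR_diff_right)
      also have "\<dots> \<le> t * (p x + e/t)" using t m by (intro mult_left_mono) auto
      finally show "p (t *\<^sub>R x) \<le> t * p x + e" using t by (simp add: algebra_simps)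
    qed
    fix t :: real and x assume t: "0 \<le> t"
    show "p (t *\<^sub>R x) = t * p x"
    proof (cases "t = 0")
      case True then show ?thesis using pM[OF subspace_0[OF M(1)]] by simp
    next
      case False
      with t have t: "t > 0" by simp
      have "p x \<le> (1/t) * p (t *\<^sub>R x)" using le[of "1/t" "t *\<^sub>R x"] t by simp
      then have "t * p x \<le> p (t *\<^sub>R x)" using t by (simp add: divide_simps mult.commute)
      then show ?thesis using le[OF t] by (simp add: antisym)
    qed
  qed
  have px0: "p x0 > 0"
    using M(2) x0 ne p0[of x0] in_closed_iff_infdist_zero[of M x0] by (force simp: p_def)
  define r where "r = (\<lambda>x. INF t\<in>{0..}. p (x + t *\<^sub>R x0) - t * p x0)"
  have r: "sublinear r" and rle: "\<And>t x. 0 \<le> t \<Longrightarrow> r x \<le> p (x + t *\<^sub>R x0) - t * p x0"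
    unfolding r_def using sublinear_lower[OF sub] by blast+
  obtain f where f: "linear f" "\<And>x. f x \<le> r x" by (rule sublinear_dominates_linear[OF r]) blast
  have fp: "f x \<le> p x" for x using f(2)[of x] rle[of 0 x] by simp
  have fneg: "f (- x) = - f x" for x by (rule linear_neg[OF f(1)])
  have "bounded_linear f"
  proof (rule bounded_linear.intro[OF f(1)], unfold_locales, rule exI[of _ 1], rule allI)
    fix x show "norm (f x) \<le> norm x * 1"
      using fp[of x] fp[of "- x"] pn[of x] pn[of "- x"] fneg[of x] by (simp add: abs_le_iff)
  qed
  moreover have "f x = 0" if "x \<in> M" for x
    using fp[of x] fp[of "- x"] fneg[of x] pM[OF that] pM[of "- x"] subspace_neg[OF M(1) that] by simp
  moreover have "f x0 \<noteq> 0"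
  proof -
    have "f (- x0) \<le> p (- x0 + 1 *\<^sub>R x0) - 1 * p x0" using f(2)[of "- x0"] rle[of 1 "- x0"] by linarith
    then show ?thesis using px0 fneg[of x0] pM[OF subspace_0[OF M(1)]] by simp
  qed
  ultimately show thesis using that by blast
qed

section \<open>Open mapping theorem and Neumann series\<close>

named_theorems op_simps

lemmas [op_simps] = blinfun.bilinear_simps blinfun_apply_blinfun_compose blinfun_apply_id_blinfun

text \<open>Iterated correction: the residuals halve at each step, so the corrections form a
  geometric series with sum of norm at most \<open>2 * C * norm y\<close>. The set \<open>S\<close>
  keeps the residuals where approximation is possible; it is the range of an operator in one
  application and the whole space in another.\<close>

lemma approximate_preimages_exact:
  fixes f :: "'a::banach \<Rightarrow>\<^sub>L 'b::real_normed_vector"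
  assumes C: "C \<ge> 0"
    and approx: "\<And>y. y \<in> S \<Longrightarrow> \<exists>x. norm x \<le> C * norm y \<and> norm (y - f x) \<le> norm y / 2 \<and> y - f x \<in> S"
    and y: "y \<in> S"
  shows "\<exists>x. f x = y \<and> norm x \<le> 2 * C * norm y"
proof -
  obtain g where g: "\<And>y. y \<in> S \<Longrightarrow> norm (g y) \<le> C * norm y \<and> norm (y - f (g y)) \<le> norm y / 2 \<and> y - f (g y) \<in> S"
    using approx by metis
  define r where "r = (\<lambda>n. ((\<lambda>y. y - f (g y)) ^^ n) y)"
  have r0: "r 0 = y" and rS: "r (Suc n) = r n - f (g (r n))" for n by (simp_all add: r_def)
  have rin: "r n \<in> S" for n by (induction n) (use y g r0 rS in auto)
  have rn: "norm (r n) \<le> norm y * (1/2) ^ n" for n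
  proof (induction n)
    case (Suc n)
    have "norm (r (Suc n)) \<le> norm (r n) / 2" using g[OF rin[of n]] rS by simp
    with Suc show ?case by simp
  qed (simp add: r0)
  have gn: "norm (g (r n)) \<le> (C * norm y) * (1/2) ^ n" for n
  proof -
    have "norm (g (r n)) \<le> C * norm (r n)" using g[OF rin] by blast
    also have "\<dots> \<le> C * (norm y * (1/2) ^ n)" using rn C by (intro mult_left_mono) auto
    finally show ?thesis by (simp add: mult.assoc)
  qed
  have sg: "summable (\<lambda>n. (C * norm y) * (1/2::real) ^ n)" by (intro summable_mult summable_geometric) simp
  have sn: "summable (\<lambda>n. norm (g (r n)))"
    by (rule summable_comparison_test'[OF sg, of 0]) (use gn in auto)
  then have sm: "summable (\<lambda>n. g (r n))" by (rule summable_norm_cancel)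
  define x where "x = (\<Sum>n. g (r n))"
  have "norm x \<le> (\<Sum>n. norm (g (r n)))" unfolding x_def by (rule summable_norm[OF sn])
  also have "\<dots> \<le> (\<Sum>n. (C * norm y) * (1/2) ^ n)" by (rule suminf_le[OF gn sn sg])
  also have "\<dots> = 2 * C * norm y" by (simp add: suminf_mult suminf_geometric summable_geometric)
  finally have nx: "norm x \<le> 2 * C * norm y" .
  have "(\<lambda>n. f (g (r n))) sums f x"
    unfolding x_def by (rule bounded_linear.sums[OF blinfun.bounded_linear_right summable_sums[OF sm]])
  moreover have "(\<lambda>n. f (g (r n))) sums y"
  proof -
    have "r \<longlonglongrightarrow> 0"
    proof (rule tendsto_norm_zero_cancel, rule tendsto_sandwich[OF _ _ tendsto_const])
      show "\<forall>\<^sub>F n in sequentially. norm (r n) \<le> norm y * (1/2) ^ n" using rn by simp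
      show "(\<lambda>n. norm y * (1/2) ^ n) \<longlonglongrightarrow> 0" by (rule tendsto_mult_right_zero[OF LIMSEQ_realpow_zero]) auto
    qed simp
    then have "(\<lambda>n. r n - r (Suc n)) sums (r 0 - 0)" by (rule telescope_sums')
    then show ?thesis by (simp add: rS r0)
  qed
  ultimately have "f x = y" by (rule sums_unique2)
  with nx show ?thesis by blast
qed

text \<open>The open mapping theorem for the operator onto its range, which is complete because it
  is closed. Baire's theorem puts a relative ball into the closure of the image of some ball, and
  differences of approximate preimages move this ball to the origin.\<close>

lemma closed_range_bounded_preimages:
  fixes f :: "'a::banach \<Rightarrow>\<^sub>L 'b::banach"
  assumes cl: "closed (range f)"
  obtains C where "C > 0" "\<And>y. y \<in> range f \<Longrightarrow> \<exists>x. f x = y \<and> norm x \<le> C * norm y"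
proof -
  let ?S = "range f"
  have sub: "subspace ?S" by (rule linear_subspace_image[OF blinfun.bounded_linear_right[THEN bounded_linear.linear] subspace_UNIV, of f])
  define T where "T = (\<lambda>n::nat. closure (f ` cball 0 (real n)))"
  have TS: "T n \<subseteq> ?S" for n unfolding T_def using cl by (intro closure_minimal) auto
  have cover: "?S \<subseteq> \<Union>(range T)"
  proof
    fix y assume "y \<in> ?S"
    then obtain x where x: "y = f x" by auto
    obtain n :: nat where "norm x \<le> real n" using real_arch_simple by blast
    then have "y \<in> T n" unfolding T_def using x closure_subset[of "f ` cball 0 (real n)"] by auto
    then show "y \<in> \<Union>(range T)" by auto
  qed
  have "\<exists>n. top_of_set ?S interior_of T n \<noteq> {}"
  proof (rule ccontr)
    assume "\<not> ?thesis"
    moreover have "closedin (top_of_set ?S) (T n)" for n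
      using TS[of n] by (intro closed_subset) (auto simp: T_def)
    moreover have "completely_metrizable_space (top_of_set ?S)"
      using cl by (intro completely_metrizable_space_closedin[OF completely_metrizable_space_euclidean]) simp
    ultimately have "top_of_set ?S interior_of \<Union>(range T) = {}"
      by (intro Baire_category_alt) auto
    moreover have "\<Union>(range T) = ?S" using TS cover by auto
    ultimately show False 
      using interior_of_topspace[of "top_of_set ?S"] by auto
  qed
  then obtain n y0 where "y0 \<in> top_of_set ?S interior_of T n" by blast
  then obtain U where U: "openin (top_of_set ?S) U" "y0 \<in> U" "U \<subseteq> T n" by (auto simp: interior_of_def)
  then obtain e where e: "e > 0" "\<And>y. y \<in> ?S \<Longrightarrow> dist y y0 < e \<Longrightarrow> y \<in> T n" and y0: "y0 \<in> ?S"
    unfolding openin_euclidean_subtopology_iff by blast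
  \<comment> \<open>Two preimages of norm at most \<open>n\<close>, rescaled by
    \<open>1 / s = 2 * norm y / e\<close>, give the factor \<open>4 * n / e\<close>; the summand
    \<open>1\<close> keeps \<open>C\<close> positive.\<close>
  define C where "C = 4 * (real n + 1) / e"
  have C: "C > 0" using e by (simp add: C_def)
  have approx: "\<exists>x. norm x \<le> C * norm y \<and> norm (y - f x) \<le> norm y / 2 \<and> y - f x \<in> ?S" if y: "y \<in> ?S" for y
  proof (cases "y = 0")
    case True then show ?thesis using y by (intro exI[of _ 0]) (auto simp: op_simps)
  next
    case False
    \<comment> \<open>The vector \<open>s *\<^sub>R y\<close> has norm \<open>e / 2\<close>, so
      adding it to \<open>y0\<close> stays within distance \<open>e\<close>. The tolerance
      \<open>d\<close> is a quarter of \<open>s * norm y\<close>, so two approximation errors leave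
      half of \<open>y\<close>.\<close>
    define s where "s = e / (2 * norm y)"
    have s: "s > 0" using e False by (simp add: s_def)
    define d where "d = s * norm y / 4"
    have d: "d > 0" using s False by (simp add: d_def)
    have "y0 + s *\<^sub>R y \<in> T n"
      using e False s subspace_add[OF sub y0 subspace_scale[OF sub y, of s]] by (intro e(2)) (auto simp: dist_norm s_def)
    then obtain u1 where u1: "norm u1 \<le> real n" "dist (f u1) (y0 + s *\<^sub>R y) < d"
      unfolding T_def closure_approachable using d by fastforce
    have "y0 \<in> T n" using e y0 by auto
    then obtain u2 where u2: "norm u2 \<le> real n" "dist (f u2) y0 < d"
      unfolding T_def closure_approachable using d by fastforce
    define x where "x = (1/s) *\<^sub>R (u1 - u2)"
    have "norm x \<le> (1/s) * (2 * real n)" unfolding x_def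
      using norm_triangle_ineq4[of u1 u2] u1 u2 s by (simp add: divide_right_mono)
    also have "\<dots> \<le> C * norm y" using e False by (simp add: s_def C_def field_simps)
    finally have nx: "norm x \<le> C * norm y" .
    have "s *\<^sub>R (y - f x) = (y0 + s *\<^sub>R y - f u1) - (y0 - f u2)"
      using s by (simp add: x_def op_simps algebra_simps)
    then have "norm (s *\<^sub>R (y - f x)) \<le> norm (y0 + s *\<^sub>R y - f u1) + norm (y0 - f u2)"
      by (metis norm_triangle_ineq4)
    also have "\<dots> \<le> d + d" using u1 u2 by (intro add_mono) (auto simp: dist_norm norm_minus_commute)
    finally have "s * norm (y - f x) \<le> s * (norm y / 2)" using s by (simp add: d_def)
    then have "norm (y - f x) \<le> norm y / 2" using s by simp
    moreover have "y - f x \<in> ?S" using y by (intro subspace_diff[OF sub]) auto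
    ultimately show ?thesis using nx by blast
  qed
  have "\<exists>x. f x = y \<and> norm x \<le> 2 * C * norm y" if "y \<in> ?S" for y
    using approximate_preimages_exact[OF _ approx that] C by simp
  then show thesis using that[of "2 * C"] C by simp
qed

section \<open>Invertibility criteria\<close>

lemma is_inverse_op_apply:
  fixes T R :: "'a::real_normed_vector \<Rightarrow>\<^sub>L 'a"
  assumes "is_inverse_op T R"
  shows "T (R x) = x" "R (T x) = x"
  using assms unfolding is_inverse_op_def
  by (metis blinfun_apply_blinfun_compose blinfun_apply_id_blinfun)+

lemma is_inverse_op_unique:
  assumes "is_inverse_op T R" "is_inverse_op T R'"
  shows "R = R'"
proof (rule blinfun_eqI)
  fix x
  have "R x = R' (T (R x))" by (rule is_inverse_op_apply(2)[OF assms(2), symmetric])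
  also have "\<dots> = R' x" by (simp only: is_inverse_op_apply(1)[OF assms(1)])
  finally show "R x = R' x" .
qed

lemma is_inverse_opI:
  fixes T R :: "'a::real_normed_vector \<Rightarrow>\<^sub>L 'a"
  assumes "\<And>x. T (R x) = x" "\<And>x. R (T x) = x"
  shows "is_inverse_op T R"
  unfolding is_inverse_op_def by (auto intro!: blinfun_eqI simp: assms)

lemma bounded_below_surj_inverse_op:
  fixes T :: "'a::real_normed_vector \<Rightarrow>\<^sub>L 'a"
  assumes C: "C \<ge> 0" and bb: "\<And>x. norm x \<le> C * norm (T x)" and surj: "surj T"
  obtains R where "is_inverse_op T R" "norm R \<le> C"
proof -
  have inj: "inj T"
  proof (rule injI)
    fix x y assume "T x = T y"
    then have *: "T (x - y) = 0" by (simp add: blinfun.diff_right)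
    show "x = y" using bb[of "x - y"] unfolding * by simp
  qed
  have eq: "T (inv_into UNIV T y) = y" for y by (simp add: surj_f_inv_f[OF surj])
  have "bounded_linear (inv_into UNIV T)"
  proof (rule bounded_linear_intro)
    fix x y show "inv_into UNIV T (x + y) = inv_into UNIV T x + inv_into UNIV T y"
      by (rule injD[OF inj]) (simp add: eq op_simps)
    fix r show "inv_into UNIV T (r *\<^sub>R x) = r *\<^sub>R inv_into UNIV T x"
      by (rule injD[OF inj]) (simp add: eq op_simps)
    show "norm (inv_into UNIV T x) \<le> norm x * C" using bb[of "inv_into UNIV T x"] by (simp add: eq mult.commute)
  qed
  then have ap: "blinfun_apply (Blinfun (inv_into UNIV T)) = inv_into UNIV T" by (rule bounded_linear_Blinfun_apply)
  show thesis
  proof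
    show "is_inverse_op T (Blinfun (inv_into UNIV T))" using inj by (intro is_inverse_opI) (auto simp: ap eq)
    show "norm (Blinfun (inv_into UNIV T)) \<le> C" using bb[of "inv_into UNIV T _"] C by (intro norm_blinfun_bound) (auto simp: ap eq)
  qed
qed

lemma bij_inverse_op:
  fixes T :: "'a::banach \<Rightarrow>\<^sub>L 'a"
  assumes inj: "\<And>x. T x = 0 \<Longrightarrow> x = 0" and surj: "surj T"
  obtains R where "is_inverse_op T R"
proof -
  obtain C where C: "C > 0" "\<And>y. y \<in> range T \<Longrightarrow> \<exists>x. T x = y \<and> norm x \<le> C * norm y"
    using closed_range_bounded_preimages[of T] surj by auto
  have "norm x \<le> C * norm (T x)" for x
  proof -
    obtain x' where x': "T x' = T x" "norm x' \<le> C * norm (T x)" using C(2)[of "T x"] by auto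
    have "x' - x = 0" by (rule inj) (simp add: blinfun.diff_right x'(1))
    then have "x' = x" by simp
    then show ?thesis using x'(2) by blast
  qed
  then show thesis using bounded_below_surj_inverse_op[of C T] C(1) surj that less_imp_le by metis
qed

text \<open>The lower bound comes from the triangle inequality; surjectivity is Banach's fixed point
  theorem for the contraction \<open>x \<mapsto> X x + y\<close>, so no operator series has to be
  summed.\<close>

lemma neumann_inverse:
  fixes X :: "'a::banach \<Rightarrow>\<^sub>L 'a"
  assumes X: "norm X < 1"
  obtains R where "is_inverse_op (id_blinfun - X) R" "norm R \<le> 1 / (1 - norm X)"
proof (rule bounded_below_surj_inverse_op[of "1 / (1 - norm X)" "id_blinfun - X"])
  show "norm x \<le> 1 / (1 - norm X) * norm ((id_blinfun - X) x)" for x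
  proof -
    have "norm x - norm X * norm x \<le> norm x - norm (X x)" by (simp add: norm_blinfun)
    also have "\<dots> \<le> norm ((id_blinfun - X) x)" by (simp add: op_simps norm_triangle_ineq2)
    finally have "norm x * (1 - norm X) \<le> norm ((id_blinfun - X) x)" by (simp add: algebra_simps)
    then have "norm x \<le> norm ((id_blinfun - X) x) / (1 - norm X)" using X by (simp add: pos_le_divide_eq)
    then show ?thesis by simp
  qed
  have "\<exists>x. (id_blinfun - X) x = y" for y
  proof -
    have "\<exists>!x. X x + y = x"
    proof (rule banach_fix_type[of "norm X"])
      show "\<forall>u v. dist (X u + y) (X v + y) \<le> norm X * dist u v"
      proof (intro allI)
        fix u v
        have "dist (X u + y) (X v + y) = norm (X (u - v))"
          unfolding dist_norm blinfun.diff_right by (rule arg_cong[of _ _ norm]) simp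
        then show "dist (X u + y) (X v + y) \<le> norm X * dist u v"
          using norm_blinfun[of X "u - v"] by (simp add: dist_norm)
      qed
    qed (use X in auto)
    then obtain x where "X x + y = x" by blast
    then have "x - X x = y" using add_diff_cancel_left'[of "X x" y] by argo
    then have "(id_blinfun - X) x = y" by (simp add: blinfun.diff_left)
    then show ?thesis ..
  qed
  then have "\<exists>x. y = (id_blinfun - X) x" for y by (metis (no_types))
  then show "surj (id_blinfun - X)" unfolding surj_def by blast
  show "0 \<le> 1 / (1 - norm X)" using X by simp
qed (rule that)

lemma is_inverse_op_compose:
  assumes "is_inverse_op S R" "is_inverse_op S' R'"
  shows "is_inverse_op (S \<circ>\<^sub>L S') (R' \<circ>\<^sub>L R)"
  by (intro is_inverse_opI) (simp_all add: is_inverse_op_apply[OF assms(1)] is_inverse_op_apply[OF assms(2)])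

text \<open>\<open>S'\<close> factors as \<open>S\<close> followed on the right by
  \<open>id_blinfun + R (S' - S)\<close>, a small perturbation of the identity.\<close>

lemma inverse_op_perturb:
  fixes S :: "'a::banach \<Rightarrow>\<^sub>L 'a"
  assumes R: "is_inverse_op S R" and small: "norm (S' - S) * norm R < 1"
  obtains R' where "is_inverse_op S' R'" "norm R' \<le> norm R / (1 - norm (S' - S) * norm R)"
proof -
  let ?X = "- (R \<circ>\<^sub>L (S' - S))"
  have nX: "norm ?X \<le> norm (S' - S) * norm R"
    unfolding norm_minus_cancel mult.commute[of _ "norm R"] by (rule norm_blinfun_compose)
  with small have "norm ?X < 1" by linarith
  then obtain Y where Y: "is_inverse_op (id_blinfun - ?X) Y" "norm Y \<le> 1 / (1 - norm ?X)"
    by (rule neumann_inverse)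
  have "S \<circ>\<^sub>L (id_blinfun - ?X) = S'"
    by (rule blinfun_eqI) (simp add: op_simps is_inverse_op_apply[OF R])
  then have inv: "is_inverse_op S' (Y \<circ>\<^sub>L R)" using is_inverse_op_compose[OF R Y(1)] by simp
  have "norm (Y \<circ>\<^sub>L R) \<le> norm Y * norm R" by (rule norm_blinfun_compose)
  also have "\<dots> \<le> 1 / (1 - norm (S' - S) * norm R) * norm R"
    using Y(2) nX small by (intro mult_right_mono order_trans[OF Y(2)] divide_left_mono mult_pos_pos) auto
  finally show thesis using that inv by simp
qed

section \<open>Compact operators and complex structures\<close>

text \<open>A compact superset of the image suffices, which spares the computation of closures in
  the closure properties that follow.\<close>

lemma compact_operator_iff:
  "compact_operator T \<longleftrightarrow> (\<exists>K. compact K \<and> T ` cball 0 1 \<subseteq> K)"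
proof
  assume "\<exists>K. compact K \<and> T ` cball 0 1 \<subseteq> K"
  then obtain K where "compact K" "T ` cball 0 1 \<subseteq> K" by blast
  then have "compact (K \<inter> closure (T ` cball 0 1))" "closure (T ` cball 0 1) \<subseteq> K"
    using closure_minimal[of "T ` cball 0 1" K] by (auto intro: compact_imp_closed)
  then show "compact_operator T" by (simp add: compact_operator_def Int_absorb1)
qed (auto simp: compact_operator_def intro: closure_subset[THEN subsetD])

lemma compact_operator_zero: "compact_operator 0"
  unfolding compact_operator_iff by (rule exI[of _ "{0}"]) auto

lemma compact_operator_add:
  assumes "compact_operator S" "compact_operator T"
  shows "compact_operator (S + T)"
proof -
  obtain K L where "compact K" "S ` cball 0 1 \<subseteq> K" "compact L" "T ` cball 0 1 \<subseteq> L"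
    using assms unfolding compact_operator_iff by blast
  then show ?thesis unfolding compact_operator_iff
    by (intro exI[of _ "{x + y | x y. x \<in> K \<and> y \<in> L}"] conjI compact_sums)
      (auto simp: op_simps image_subset_iff)
qed

lemma compact_operator_compose_left:
  assumes "compact_operator T" shows "compact_operator (S \<circ>\<^sub>L T)"
proof -
  obtain K where "compact K" "T ` cball 0 1 \<subseteq> K"
    using assms unfolding compact_operator_iff by blast
  then show ?thesis unfolding compact_operator_iff
    by (intro exI[of _ "S ` K"] conjI compact_continuous_image linear_continuous_on blinfun.bounded_linear_right)
      auto
qed

lemma compact_operator_compose_right:
  assumes "compact_operator T" shows "compact_operator (T \<circ>\<^sub>L S)"
proof -
  obtain K where K: "compact K" "T ` cball 0 1 \<subseteq> K"
    using assms unfolding compact_operator_iff by blast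
  define r where "r = norm S + 1"
  have r: "r > 0" by (simp add: r_def add_nonneg_pos)
  have "(T \<circ>\<^sub>L S) ` cball 0 1 \<subseteq> (\<lambda>y. r *\<^sub>R y) ` K"
  proof clarify
    fix x :: 'c assume "x \<in> cball 0 1"
    then have "norm (S x) \<le> norm S * 1" using norm_blinfun[of S x]
      by (meson dual_order.trans mem_cball_0 mult_left_mono norm_ge_zero)
    then have "norm ((1/r) *\<^sub>R S x) \<le> 1" using r by (simp add: r_def divide_simps)
    then have "T ((1/r) *\<^sub>R S x) \<in> K" using K(2) by auto
    moreover have "(T \<circ>\<^sub>L S) x = r *\<^sub>R T ((1/r) *\<^sub>R S x)" using r by (simp add: op_simps)
    ultimately show "(T \<circ>\<^sub>L S) x \<in> (\<lambda>y. r *\<^sub>R y) ` K" by blast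
  qed
  moreover have "compact ((\<lambda>y. r *\<^sub>R y) ` K)" using K(1) by (intro compact_scaling)
  ultimately show ?thesis unfolding compact_operator_iff by blast
qed

lemma compact_operator_scaleR:
  assumes "compact_operator T" shows "compact_operator (r *\<^sub>R T)"
proof -
  have "r *\<^sub>R T = (r *\<^sub>R id_blinfun) \<circ>\<^sub>L T" by (rule blinfun_eqI) (simp add: op_simps)
  then show ?thesis using compact_operator_compose_left[OF assms] by metis
qed

lemma compact_operator_uminus: "compact_operator T \<Longrightarrow> compact_operator (- T)"
  using compact_operator_scaleR[of T "-1"] by simp

lemma compact_operator_diff:
  "compact_operator S \<Longrightarrow> compact_operator T \<Longrightarrow> compact_operator (S - T)"
  using compact_operator_add[of S "- T"] compact_operator_uminus[of T] by simp

lemma compact_operator_minus_commute: "compact_operator (S - T) \<longleftrightarrow> compact_operator (T - S)"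
  using compact_operator_uminus[of "S - T"] compact_operator_uminus[of "T - S"] by auto

text \<open>In a complete space a closed set is compact when it is totally bounded, and a finite net
  for the image under a nearby compact operator is a coarser net for the image under
  \<open>T\<close>.\<close>

lemma compact_operator_approx:
  fixes T :: "'a::real_normed_vector \<Rightarrow>\<^sub>L 'b::banach"
  assumes approx: "\<And>e. e > 0 \<Longrightarrow> \<exists>S. compact_operator S \<and> norm (T - S) \<le> e"
  shows "compact_operator T"
proof -
  have "\<exists>k. finite k \<and> closure (T ` cball 0 1) \<subseteq> (\<Union>x\<in>k. ball x e)" if e: "e > 0" for e
  proof -
    obtain S where S: "compact_operator S" "norm (T - S) \<le> e/4" using approx[of "e/4"] e by auto
    have "compact (closure (S ` cball 0 1))" using S(1) by (simp add: compact_operator_def)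
    moreover have "e/4 > 0" using e by simp
    ultimately obtain k where k: "finite k" "closure (S ` cball 0 1) \<subseteq> (\<Union>x\<in>k. ball x (e/4))"
      unfolding compact_eq_totally_bounded by blast
    \<comment> \<open>Closed balls are used because their finite union also contains the closure of
      the image; radius \<open>e / 2\<close> leaves room to pass to open balls of radius
      \<open>e\<close>.\<close>
    have "T ` cball 0 1 \<subseteq> (\<Union>x\<in>k. cball x (e/2))"
    proof clarify
      fix x :: 'a assume x: "x \<in> cball 0 1"
      then have "S x \<in> (\<Union>x\<in>k. ball x (e/4))" using k(2) closure_subset[of "S ` cball 0 1"] by blast
      then obtain y where y: "y \<in> k" "dist y (S x) < e/4" by auto
      have "dist (S x) (T x) = norm ((T - S) x)" by (simp add: dist_norm norm_minus_commute blinfun.diff_left)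
      also have "\<dots> \<le> norm (T - S) * norm x" by (rule norm_blinfun)
      also have "\<dots> \<le> e/4 * 1" using S(2) x e by (intro mult_mono) auto
      finally have "dist y (T x) \<le> e/2" using y(2) dist_triangle[of y "T x" "S x"] by simp
      then show "T x \<in> (\<Union>x\<in>k. cball x (e/2))" using y(1) by auto
    qed
    moreover have "closed (\<Union>x\<in>k. cball x (e/2))" using k(1) by (intro closed_UN) auto
    ultimately have "closure (T ` cball 0 1) \<subseteq> (\<Union>x\<in>k. cball x (e/2))" by (rule closure_minimal)
    also have "\<dots> \<subseteq> (\<Union>x\<in>k. ball x e)" using e by (intro UN_mono) auto
    finally show ?thesis using k(1) by blast
  qed
  moreover have "complete (closure (T ` cball 0 1))" by (simp add: complete_eq_closed)
  ultimately show ?thesis unfolding compact_operator_def compact_eq_totally_bounded by blast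
qed

text \<open>The ideal absorbs all real-linear operators, in particular multiplication by the
  imaginary unit. Hence a real functional that vanishes on it still does so after being made
  complex-linear.\<close>

definition operator_ideal :: "('a::real_normed_vector \<Rightarrow>\<^sub>L 'a) set \<Rightarrow> bool" where
  "operator_ideal I \<longleftrightarrow> subspace I \<and> closed I \<and> (\<forall>X\<in>I. \<forall>Y. X \<circ>\<^sub>L Y \<in> I \<and> Y \<circ>\<^sub>L X \<in> I)"

lemma operator_ideal_zero: "operator_ideal {0}"
  by (auto simp: operator_ideal_def)

lemma operator_ideal_compact: "operator_ideal {T :: 'a::banach \<Rightarrow>\<^sub>L 'a. compact_operator T}"
  unfolding operator_ideal_def
proof (intro conjI)
  show "subspace {T :: 'a \<Rightarrow>\<^sub>L 'a. compact_operator T}"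
    by (auto simp: subspace_def compact_operator_zero compact_operator_add compact_operator_scaleR)
  show "closed {T :: 'a \<Rightarrow>\<^sub>L 'a. compact_operator T}"
  proof -
    have "T \<in> {T. compact_operator T}" if "T \<in> closure {T :: 'a \<Rightarrow>\<^sub>L 'a. compact_operator T}" for T
    proof -
      have "\<exists>S. compact_operator S \<and> norm (T - S) \<le> e" if "e > 0" for e
        using \<open>T \<in> closure _\<close> that unfolding closure_approachable
        by (metis dist_norm less_imp_le mem_Collect_eq norm_minus_commute)
      then show ?thesis using compact_operator_approx by blast
    qed
    then show ?thesis by (metis closure_subset closure_eq subsetI subset_antisym)
  qed
qed (auto intro: compact_operator_compose_left compact_operator_compose_right)

section \<open>Complex structures and complex-linear operators\<close>

locale complex_structure =
  fixes J :: "'a::banach \<Rightarrow>\<^sub>L 'a"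
  assumes JJ: "J (J x) = - x"
begin

abbreviation sc :: "complex \<Rightarrow> 'a \<Rightarrow>\<^sub>L 'a" where "sc \<equiv> scalar_op J"

lemma sc_apply: "sc z x = Re z *\<^sub>R x + Im z *\<^sub>R J x"
  by (simp add: scalar_op_def op_simps)

lemma sc_add: "sc (z + w) = sc z + sc w"
  by (rule blinfun_eqI) (simp add: sc_apply op_simps algebra_simps)

lemma sc_diff: "sc (z - w) = sc z - sc w"
  by (rule blinfun_eqI) (simp add: sc_apply op_simps algebra_simps)

lemma sc_mult: "sc (z * w) = sc z \<circ>\<^sub>L sc w"
  by (rule blinfun_eqI) (simp add: sc_apply op_simps JJ algebra_simps)

lemma sc_mult_apply: "sc (z * w) x = sc z (sc w x)"
  by (simp add: sc_mult)

lemma sc_zero: "sc 0 = 0" and sc_one: "sc 1 = id_blinfun" and sc_i: "sc \<i> = J"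
  by (rule blinfun_eqI; simp add: sc_apply op_simps)+

lemma sc_scaleR: "sc (r *\<^sub>R z) = r *\<^sub>R sc z"
  by (rule blinfun_eqI) (simp add: sc_apply op_simps algebra_simps)

lemma sc_minus: "sc (- z) = - sc z"
  using sc_diff[of 0 z] by (simp add: sc_zero)

lemma norm_sc: "norm (sc z) \<le> (1 + norm J) * cmod z"
proof -
  have "norm (sc z) \<le> \<bar>Re z\<bar> * norm (id_blinfun :: 'a \<Rightarrow>\<^sub>L 'a) + \<bar>Im z\<bar> * norm J"
    unfolding scalar_op_def using norm_triangle_ineq[of "Re z *\<^sub>R id_blinfun" "Im z *\<^sub>R J"] by simp
  also have "\<dots> \<le> cmod z * 1 + cmod z * norm J"
    by (intro add_mono mult_mono abs_Re_le_cmod abs_Im_le_cmod norm_blinfun_id_le) auto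
  finally show ?thesis by (simp add: algebra_simps)
qed

lemma bounded_linear_sc: "bounded_linear sc"
  by (rule bounded_linear_intro[where K="1 + norm J"])
    (use norm_sc in \<open>auto simp: sc_add sc_scaleR mult.commute\<close>)

lemmas continuous_sc [continuous_intros] = bounded_linear.continuous_on[OF bounded_linear_sc]

definition clinear_op :: "('a \<Rightarrow>\<^sub>L 'a) \<Rightarrow> bool" where
  "clinear_op T \<longleftrightarrow> (\<forall>x. T (J x) = J (T x))"

lemma clinear_op_sc: "clinear_op T \<Longrightarrow> T (sc z x) = sc z (T x)"
  by (simp add: clinear_op_def sc_apply op_simps)

lemma clinear_op_add: "clinear_op S \<Longrightarrow> clinear_op T \<Longrightarrow> clinear_op (S + T)"
  and clinear_op_diff: "clinear_op S \<Longrightarrow> clinear_op T \<Longrightarrow> clinear_op (S - T)"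
  and clinear_op_uminus: "clinear_op S \<Longrightarrow> clinear_op (- S)"
  and clinear_op_compose: "clinear_op S \<Longrightarrow> clinear_op T \<Longrightarrow> clinear_op (S \<circ>\<^sub>L T)"
  and clinear_op_id: "clinear_op id_blinfun"
  and clinear_op_zero: "clinear_op 0"
  and clinear_op_scalar: "clinear_op (sc z)"
  by (auto simp: clinear_op_def op_simps sc_apply algebra_simps)

lemmas clinear_op_intros =
  clinear_op_add clinear_op_diff clinear_op_uminus clinear_op_compose clinear_op_id clinear_op_zero clinear_op_scalar

lemma clinear_op_inverse:
  assumes "clinear_op T" "is_inverse_op T R" shows "clinear_op R"
  unfolding clinear_op_def
proof
  fix x
  have "R (J x) = R (J (T (R x)))" by (simp add: is_inverse_op_apply[OF assms(2)])
  also have "\<dots> = R (T (J (R x)))" using assms(1) by (simp add: clinear_op_def)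
  finally show "R (J x) = J (R x)" by (simp add: is_inverse_op_apply[OF assms(2)])
qed

section \<open>Complex-linear functionals on operators and on vectors\<close>

definition functional :: "(('a \<Rightarrow>\<^sub>L 'a) \<Rightarrow> complex) \<Rightarrow> bool" where
  "functional \<psi> \<longleftrightarrow> bounded_linear \<psi> \<and> (\<forall>X. \<psi> (J \<circ>\<^sub>L X) = \<i> * \<psi> X)"

lemma functional_sc: "functional \<psi> \<Longrightarrow> \<psi> (sc z \<circ>\<^sub>L X) = z * \<psi> X"
proof -
  assume \<psi>: "functional \<psi>"
  then have l: "linear \<psi>" by (simp add: functional_def bounded_linear.linear)
  have "sc z \<circ>\<^sub>L X = Re z *\<^sub>R X + Im z *\<^sub>R (J \<circ>\<^sub>L X)"
    by (rule blinfun_eqI) (simp add: sc_apply op_simps)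
  then have "\<psi> (sc z \<circ>\<^sub>L X) = of_real (Re z) * \<psi> X + of_real (Im z) * (\<i> * \<psi> X)"
    using \<psi> by (simp add: linear_add[OF l] linear_scale[OF l] functional_def scaleR_conv_of_real)
  then show ?thesis by (simp add: algebra_simps complex_eq_iff)
qed

lemma functional_diff: "functional \<psi> \<Longrightarrow> \<psi> (X - Y) = \<psi> X - \<psi> Y"
  and functional_add: "functional \<psi> \<Longrightarrow> \<psi> (X + Y) = \<psi> X + \<psi> Y"
  and functional_uminus: "functional \<psi> \<Longrightarrow> \<psi> (- X) = - \<psi> X"
  and functional_zero: "functional \<psi> \<Longrightarrow> \<psi> 0 = 0"
  by (auto simp: functional_def bounded_linear.linear linear_diff linear_add linear_neg linear_0)

text \<open>A separating real functional \<open>f\<close> is made complex-linear as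
  \<open>f Y - \<i> * f (J Y)\<close>; its real part is still \<open>f\<close>, so it does not
  vanish at \<open>X\<close>.\<close>

lemma functional_separates:
  assumes I: "operator_ideal I" and X: "X \<notin> I"
  obtains \<psi> where "functional \<psi>" "\<And>Y. Y \<in> I \<Longrightarrow> \<psi> Y = 0" "\<psi> X \<noteq> 0"
proof -
  obtain f where f: "bounded_linear f" "\<And>Y. Y \<in> I \<Longrightarrow> f Y = (0::real)" "f X \<noteq> 0"
    using hahn_banach_separation[OF _ _ X] I unfolding operator_ideal_def by metis
  interpret f: bounded_linear f by fact
  have b1: "bounded_linear (\<lambda>x. complex_of_real (f x))"
    by (rule bounded_linear_compose[OF bounded_linear_of_real f(1)])
  define \<psi> where "\<psi> = (\<lambda>Y. Complex (f Y) (- f (J \<circ>\<^sub>L Y)))"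
  have JJY: "J \<circ>\<^sub>L (J \<circ>\<^sub>L Y) = - Y" for Y by (rule blinfun_eqI) (simp add: op_simps JJ)
  have "\<psi> = (\<lambda>Y. of_real (f Y) + of_real (f (J \<circ>\<^sub>L Y)) * (- \<i>))"
    by (auto simp: \<psi>_def complex_eq_iff)
  moreover have "bounded_linear \<dots>"
    by (rule bounded_linear_add[OF b1 bounded_linear_compose[OF bounded_linear_mult_left
          bounded_linear_compose[OF b1 bounded_bilinear.bounded_linear_right[OF bounded_bilinear_blinfun_compose]]]])
  ultimately have "bounded_linear \<psi>" by simp
  then have "functional \<psi>" by (auto simp: functional_def \<psi>_def JJY f.neg complex_eq_iff)
  moreover have "\<psi> Y = 0" if "Y \<in> I" for Y
    using that I f(2) by (auto simp: \<psi>_def operator_ideal_def complex_eq_iff)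
  moreover have "\<psi> X \<noteq> 0" using f(3) by (auto simp: \<psi>_def complex_eq_iff)
  ultimately show thesis using that by blast
qed

definition vfunctional :: "('a \<Rightarrow> complex) \<Rightarrow> bool" where
  "vfunctional \<phi> \<longleftrightarrow> bounded_linear \<phi> \<and> (\<forall>x. \<phi> (J x) = \<i> * \<phi> x)"

lemma vfunctional_sc: "vfunctional \<phi> \<Longrightarrow> \<phi> (sc z x) = z * \<phi> x"
proof -
  assume \<phi>: "vfunctional \<phi>"
  then have l: "linear \<phi>" by (simp add: vfunctional_def bounded_linear.linear)
  have "\<phi> (sc z x) = of_real (Re z) * \<phi> x + of_real (Im z) * (\<i> * \<phi> x)"
    using \<phi> by (simp add: sc_apply linear_add[OF l] linear_scale[OF l] vfunctional_def scaleR_conv_of_real)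
  then show ?thesis by (simp add: algebra_simps complex_eq_iff)
qed

lemma vfunctional_add: "vfunctional \<phi> \<Longrightarrow> \<phi> (x + y) = \<phi> x + \<phi> y"
  and vfunctional_diff: "vfunctional \<phi> \<Longrightarrow> \<phi> (x - y) = \<phi> x - \<phi> y"
  and vfunctional_uminus: "vfunctional \<phi> \<Longrightarrow> \<phi> (- x) = - \<phi> x"
  and vfunctional_zero: "vfunctional \<phi> \<Longrightarrow> \<phi> 0 = 0"
  and vfunctional_sum: "vfunctional \<phi> \<Longrightarrow> \<phi> (sum g A) = (\<Sum>i\<in>A. \<phi> (g i))"
  by (auto simp: vfunctional_def bounded_linear.linear linear_add linear_diff linear_0 linear_sum linear_neg)

text \<open>The same construction on vectors, normalised at \<open>x0\<close> so that it can serve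
  as a coordinate along \<open>x0\<close>.\<close>

lemma vfunctional_separates:
  assumes M: "subspace M" "closed M" "\<And>x. x \<in> M \<Longrightarrow> J x \<in> M" and x0: "x0 \<notin> M"
  obtains \<phi> where "vfunctional \<phi>" "\<And>x. x \<in> M \<Longrightarrow> \<phi> x = 0" "\<phi> x0 = 1"
proof -
  obtain f where f: "bounded_linear f" "\<And>x. x \<in> M \<Longrightarrow> f x = (0::real)" "f x0 \<noteq> 0"
    using hahn_banach_separation[OF M(1,2) x0] by blast
  interpret f: bounded_linear f by fact
  have b1: "bounded_linear (\<lambda>x. complex_of_real (f x))"
    by (rule bounded_linear_compose[OF bounded_linear_of_real f(1)])
  define \<psi> where "\<psi> = (\<lambda>x. Complex (f x) (- f (J x)))"
  have "\<psi> = (\<lambda>x. of_real (f x) + of_real (f (J x)) * (- \<i>))"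
    by (auto simp: \<psi>_def complex_eq_iff)
  moreover have "bounded_linear \<dots>"
    by (rule bounded_linear_add[OF b1 bounded_linear_compose[OF bounded_linear_mult_left
          bounded_linear_compose[OF b1 blinfun.bounded_linear_right]]])
  ultimately have bl: "bounded_linear \<psi>" by simp
  have hom: "\<psi> (J x) = \<i> * \<psi> x" for x by (auto simp: \<psi>_def JJ f.neg complex_eq_iff)
  have n0: "\<psi> x0 \<noteq> 0" using f(3) by (auto simp: \<psi>_def complex_eq_iff)
  have "vfunctional (\<lambda>x. \<psi> x * (1 / \<psi> x0))"
    unfolding vfunctional_def
    by (intro conjI allI, rule bounded_linear_compose[OF bounded_linear_mult_left bl]) (simp only: hom mult.assoc)
  moreover have "\<psi> x = 0" if "x \<in> M" for x
    using that M(3) f(2) by (auto simp: \<psi>_def complex_eq_iff)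
  ultimately show thesis using that[of "\<lambda>x. \<psi> x * (1 / \<psi> x0)"] n0 by simp
qed

definition rank_one :: "('a \<Rightarrow> complex) \<Rightarrow> 'a \<Rightarrow> 'a \<Rightarrow>\<^sub>L 'a" where
  "rank_one \<phi> f = Blinfun (\<lambda>x. sc (\<phi> x) f)"

lemma rank_one_apply:
  assumes "vfunctional \<phi>" shows "rank_one \<phi> f x = sc (\<phi> x) f"
proof -
  have "bounded_linear (\<lambda>x. sc (\<phi> x) f)"
    using assms unfolding vfunctional_def
    by (blast intro: bounded_linear_compose[OF bounded_linear_compose[OF blinfun.bounded_linear_left bounded_linear_sc]])
  then show ?thesis by (simp add: rank_one_def bounded_linear_Blinfun_apply)
qed

lemma clinear_op_rank_one: "vfunctional \<phi> \<Longrightarrow> clinear_op (rank_one \<phi> f)"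
  by (simp add: clinear_op_def rank_one_apply)
    (simp add: vfunctional_def sc_mult_apply sc_i)

lemma compact_operator_rank_one:
  assumes "vfunctional \<phi>" shows "compact_operator (rank_one \<phi> f)"
proof -
  obtain B where B: "\<And>x. norm (\<phi> x) \<le> norm x * B" "B \<ge> 0"
    using assms bounded_linear.nonneg_bounded unfolding vfunctional_def by blast
  have "compact ((\<lambda>z. sc z f) ` cball 0 B)"
    by (rule compact_continuous_image[OF linear_continuous_on compact_cball])
      (rule bounded_linear_compose[OF blinfun.bounded_linear_left bounded_linear_sc])
  moreover have "rank_one \<phi> f ` cball 0 1 \<subseteq> (\<lambda>z. sc z f) ` cball 0 B"
  proof clarify
    fix x :: 'a assume "x \<in> cball 0 1"
    then have "norm (\<phi> x) \<le> 1 * B" using B mult_right_mono[of "norm x" 1 B] order_trans by fastforce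
    then show "rank_one \<phi> f x \<in> (\<lambda>z. sc z f) ` cball 0 B" using assms by (auto simp: rank_one_apply)
  qed
  ultimately show ?thesis unfolding compact_operator_iff by blast
qed

end

section \<open>Finite-rank perturbations of invertible operators\<close>

text \<open>Index functions on \<open>nat\<close> in place of the carrier-based matrices, so that
  coefficients of vectors in the Banach space can be inserted directly.\<close>

definition sq_det :: "nat \<Rightarrow> (nat \<Rightarrow> nat \<Rightarrow> complex) \<Rightarrow> complex" where
  "sq_det n M = Determinant.det (Matrix.mat n n (\<lambda>(i, j). M i j))"

lemma sq_det_zeroD:
  assumes "sq_det n M = 0"
  obtains v where "\<exists>i<n. v i \<noteq> 0" "\<And>i. i < n \<Longrightarrow> (\<Sum>j<n. M i j * v j) = 0"
proof -
  let ?A = "Matrix.mat n n (\<lambda>(i, j). M i j)"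
  obtain v where v: "v \<in> carrier_vec n" "v \<noteq> 0\<^sub>v n" "?A *\<^sub>v v = 0\<^sub>v n"
    using assms det_0_iff_vec_prod_zero[of ?A n] unfolding sq_det_def by auto
  show thesis
  proof (rule that[of "\<lambda>i. vec_index v i"])
    show "\<exists>i<n. vec_index v i \<noteq> 0" using v(1,2) by (auto simp: vec_eq_iff)
    fix i assume i: "i < n"
    have "vec_index (?A *\<^sub>v v) i = 0" using v(3) i by simp
    then show "(\<Sum>j<n. M i j * vec_index v j) = 0"
      using v(1) i by (simp add: scalar_prod_def lessThan_atLeast0)
  qed
qed

lemma sq_det_transpose: "sq_det n (\<lambda>i j. M j i) = sq_det n M"
proof -
  have "Matrix.mat n n (\<lambda>(i, j). M j i) = transpose_mat (Matrix.mat n n (\<lambda>(i, j). M i j))" by auto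
  then show ?thesis unfolding sq_det_def by (simp add: det_transpose[where n=n])
qed

lemma sq_det_nonzero_solve:
  assumes "sq_det n M \<noteq> 0"
  obtains a where "\<And>i. i < n \<Longrightarrow> (\<Sum>j<n. M i j * a j) = b i"
proof -
  let ?A = "Matrix.mat n n (\<lambda>(i, j). M i j)"
  let ?b = "Matrix.vec n b"
  have A: "?A \<in> carrier_mat n n" by simp
  \<comment> \<open>Cramer's rule: the adjugate inverts the matrix up to the determinant.\<close>
  define a where "a = adj_mat ?A *\<^sub>v ((1 / Determinant.det ?A) \<cdot>\<^sub>v ?b)"
  have adj: "adj_mat ?A \<in> carrier_mat n n" using adj_mat(1)[OF A] .
  have a: "a \<in> carrier_vec n" using adj by (simp add: a_def)
  have "?A *\<^sub>v a = (?A * adj_mat ?A) *\<^sub>v ((1 / Determinant.det ?A) \<cdot>\<^sub>v ?b)"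
    unfolding a_def using A adj by (subst assoc_mult_mat_vec[of _ n n _ n]) auto
  also have "\<dots> = (Determinant.det ?A \<cdot>\<^sub>m 1\<^sub>m n) *\<^sub>v ((1 / Determinant.det ?A) \<cdot>\<^sub>v ?b)"
    using adj_mat(2)[OF A] by simp
  also have "\<dots> = ?b"
    using assms by (auto simp: sq_det_def scalar_prod_def if_distrib[of "\<lambda>x. x * _"] cong: if_cong intro!: eq_vecI)
  finally have eq: "?A *\<^sub>v a = ?b" .
  show thesis
  proof (rule that[of "\<lambda>i. vec_index a i"])
    fix i assume i: "i < n"
    have "vec_index (?A *\<^sub>v a) i = b i" unfolding eq using i by simp
    then show "(\<Sum>j<n. M i j * vec_index a j) = b i"
      using a i by (simp add: scalar_prod_def lessThan_atLeast0)
  qed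
qed

lemma sq_det_nonzero_inj:
  assumes "sq_det n M \<noteq> 0" "\<And>i. i < n \<Longrightarrow> (\<Sum>j<n. M i j * v j) = 0" "i < n"
  shows "v i = 0"
proof (rule ccontr)
  assume ne: "v i \<noteq> 0"
  let ?A = "Matrix.mat n n (\<lambda>(i, j). M i j)"
  have "?A *\<^sub>v Matrix.vec n v = 0\<^sub>v n"
    using assms(2) by (auto simp: scalar_prod_def lessThan_atLeast0 intro!: eq_vecI)
  moreover have "Matrix.vec n v \<noteq> 0\<^sub>v n" using ne assms(3) by (auto simp: vec_eq_iff)
  ultimately have "Determinant.det ?A = 0"
    using det_0_iff_vec_prod_zero[of ?A n] by (metis mat_carrier vec_carrier)
  then show False using assms(1) by (simp add: sq_det_def)
qed

text \<open>By the Leibniz formula the determinant is a polynomial in the entries.\<close>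

lemma holomorphic_on_sq_det:
  assumes "\<And>i j. i < n \<Longrightarrow> j < n \<Longrightarrow> (\<lambda>z. M z i j) holomorphic_on S"
  shows "(\<lambda>z. sq_det n (M z)) holomorphic_on S"
proof -
  have "(\<lambda>z. \<Sum>p\<in>{p. p permutes {0..<n}}. signof p * (\<Prod>i = 0..<n. M z i (p i))) holomorphic_on S"
  proof (intro holomorphic_on_sum holomorphic_on_mult holomorphic_on_const holomorphic_on_prod assms)
    fix p i assume "p \<in> {p. p permutes {0..<n}}" "i \<in> {0..<n}"
    then show "i < n" "p i < n" using permutes_in_image[of p "{0..<n}" i] by auto
  qed
  moreover have "sq_det n (M z) = (\<Sum>p\<in>{p. p permutes {0..<n}}. signof p * (\<Prod>i = 0..<n. M z i (p i)))" for z
    unfolding sq_det_def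
  proof (subst det_def'[where n=n], simp, intro sum.cong refl arg_cong2[of _ _ _ _ "(*)"] prod.cong)
    fix p i assume "p \<in> {p. p permutes {0..<n}}" "i \<in> {0..<n}"
    then show "Matrix.mat n n (\<lambda>(i, j). M z i j) $$ (i, p i) = M z i (p i)"
      using permutes_in_image[of p "{0..<n}" i] by auto
  qed
  ultimately show ?thesis by simp
qed

context complex_structure
begin

definition finite_rank :: "nat \<Rightarrow> (nat \<Rightarrow> 'a \<Rightarrow> complex) \<Rightarrow> (nat \<Rightarrow> 'a) \<Rightarrow> 'a \<Rightarrow>\<^sub>L 'a" where
  "finite_rank n \<phi> f = (\<Sum>i<n. rank_one (\<phi> i) (f i))"

lemma finite_rank_apply:
  "(\<And>i. i < n \<Longrightarrow> vfunctional (\<phi> i)) \<Longrightarrow> finite_rank n \<phi> f x = (\<Sum>i<n. sc (\<phi> i x) (f i))"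
  by (simp add: finite_rank_def blinfun.sum_left rank_one_apply)

lemma clinear_op_finite_rank:
  "(\<And>i. i < n \<Longrightarrow> vfunctional (\<phi> i)) \<Longrightarrow> clinear_op (finite_rank n \<phi> f)"
  by (induction n) (simp_all add: finite_rank_def clinear_op_zero clinear_op_add clinear_op_rank_one)

lemma compact_operator_finite_rank:
  "(\<And>i. i < n \<Longrightarrow> vfunctional (\<phi> i)) \<Longrightarrow> compact_operator (finite_rank n \<phi> f)"
  by (induction n) (simp_all add: finite_rank_def compact_operator_zero compact_operator_add compact_operator_rank_one)

text \<open>The perturbation \<open>U + \<Sum>\<^sub>i \<phi>\<^sub>i \<otimes> f\<^sub>i\<close> of an invertible \<open>U\<close> with inverse \<open>G\<close> is governed
  by the determinant of \<open>\<delta>\<^sub>i\<^sub>j + \<phi>\<^sub>i (G f\<^sub>j)\<close>.\<close>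

definition perturbation_matrix ::
    "('a \<Rightarrow>\<^sub>L 'a) \<Rightarrow> (nat \<Rightarrow> 'a \<Rightarrow> complex) \<Rightarrow> (nat \<Rightarrow> 'a) \<Rightarrow> nat \<Rightarrow> nat \<Rightarrow> complex" where
  "perturbation_matrix G \<phi> f i j = (if i = j then 1 else 0) + \<phi> i (G (f j))"

context
  fixes n :: nat and \<phi> :: "nat \<Rightarrow> 'a \<Rightarrow> complex" and f :: "nat \<Rightarrow> 'a" and U G :: "'a \<Rightarrow>\<^sub>L 'a"
  assumes \<phi>: "\<forall>i<n. vfunctional (\<phi> i)"
    and G: "is_inverse_op U G" and U: "clinear_op U"
begin

lemma \<phi>_vfunctional: "i < n \<Longrightarrow> vfunctional (\<phi> i)"
  using \<phi> by blast

lemma clinear_op_inverse_G: "clinear_op G"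
  by (rule clinear_op_inverse[OF U G])

text \<open>On coefficient vectors the matrix acts as the identity plus \<open>\<phi>\<close>
  applied to \<open>G\<close> of the combination of the \<open>f j\<close>. This identity transfers
  equations between coefficients and vectors.\<close>

lemma perturbation_matrix_row:
  assumes "i < n"
  shows "(\<Sum>j<n. perturbation_matrix G \<phi> f i j * a j) = a i + \<phi> i (G (\<Sum>j<n. sc (a j) (f j)))"
proof -
  have "(\<Sum>j<n. perturbation_matrix G \<phi> f i j * a j)
      = (\<Sum>j<n. (if i = j then a j else 0)) + (\<Sum>j<n. \<phi> i (G (f j)) * a j)"
  proof -
    have "perturbation_matrix G \<phi> f i j * a j = (if i = j then a j else 0) + \<phi> i (G (f j)) * a j" for j
      by (simp add: perturbation_matrix_def distrib_right)
    then show ?thesis by (simp only: sum.distrib)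
  qed
  also have "(\<Sum>j<n. \<phi> i (G (f j)) * a j) = \<phi> i (\<Sum>j<n. sc (a j) (G (f j)))"
    using \<phi>_vfunctional[OF assms] by (simp add: vfunctional_sum vfunctional_sc mult.commute)
  also have "(\<Sum>j<n. sc (a j) (G (f j))) = G (\<Sum>j<n. sc (a j) (f j))"
    by (simp add: blinfun.sum_right clinear_op_sc[OF clinear_op_inverse_G])
  also have "(\<Sum>j<n. (if i = j then a j else 0)) = a i" using assms by simp
  finally show ?thesis .
qed

text \<open>Solving the equation for \<open>x\<close> by means of \<open>G\<close> leaves only the
  finitely many numbers \<open>\<phi> i x\<close> unknown, and applying the \<open>\<phi> i\<close>
  yields a linear system for them whose matrix is the perturbation matrix.\<close>

lemma perturbation_invertible:
  assumes det: "sq_det n (perturbation_matrix G \<phi> f) \<noteq> 0"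
  obtains R where "is_inverse_op (U + finite_rank n \<phi> f) R"
proof (rule bij_inverse_op[of "U + finite_rank n \<phi> f"])
  fix x assume x: "(U + finite_rank n \<phi> f) x = 0"
  then have Ux: "U x = - (\<Sum>j<n. sc (\<phi> j x) (f j))"
    by (simp add: op_simps finite_rank_apply[OF \<phi>_vfunctional] eq_neg_iff_add_eq_0)
  have "x = G (U x)" by (simp add: is_inverse_op_apply[OF G])
  then have xG: "x = - G (\<Sum>j<n. sc (\<phi> j x) (f j))" by (simp add: Ux blinfun.minus_right)
  have "(\<Sum>j<n. perturbation_matrix G \<phi> f i j * \<phi> j x) = 0" if i: "i < n" for i
  proof -
    have "\<phi> i x = - \<phi> i (G (\<Sum>j<n. sc (\<phi> j x) (f j)))"
      using arg_cong[OF xG, of "\<phi> i"] vfunctional_uminus[OF \<phi>_vfunctional[OF i]] by simp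
    then show ?thesis unfolding perturbation_matrix_row[OF i] by simp
  qed
  then have "\<phi> j x = 0" if "j < n" for j using sq_det_nonzero_inj[OF det _ that, of "\<lambda>j. \<phi> j x"] by blast
  then have "U x = 0" using Ux by (simp add: sc_zero)
  then show "x = 0" using is_inverse_op_apply(2)[OF G, of x] by (simp add: blinfun.zero_right)
next
  have "\<exists>x. y = (U + finite_rank n \<phi> f) x" for y
  proof -
    obtain a where a: "\<And>i. i < n \<Longrightarrow> (\<Sum>j<n. perturbation_matrix G \<phi> f i j * a j) = \<phi> i (G y)"
      using sq_det_nonzero_solve[OF det, of "\<lambda>i. \<phi> i (G y)"] by blast
    define x where "x = G (y - (\<Sum>j<n. sc (a j) (f j)))"
    have "\<phi> i x = a i" if i: "i < n" for i
    proof -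
      have "\<phi> i x = \<phi> i (G y) - \<phi> i (G (\<Sum>j<n. sc (a j) (f j)))"
        by (simp add: x_def blinfun.diff_right vfunctional_diff[OF \<phi>_vfunctional[OF i]])
      then show ?thesis using a[OF i] unfolding perturbation_matrix_row[OF i] by (metis add_diff_cancel_right')
    qed
    then have "finite_rank n \<phi> f x = (\<Sum>j<n. sc (a j) (f j))" by (simp add: finite_rank_apply[OF \<phi>_vfunctional])
    moreover have "U x = y - (\<Sum>j<n. sc (a j) (f j))" by (simp add: x_def is_inverse_op_apply[OF G])
    ultimately show ?thesis by (intro exI[of _ x]) (simp add: op_simps)
  qed
  then show "surj (U + finite_rank n \<phi> f)" unfolding surj_def by blast
qed (rule that)

text \<open>A null vector \<open>v\<close> of the matrix gives the kernel element
  \<open>x = G (\<Sum>j<n. sc (v j) (f j))\<close>; it is nonzero because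
  \<open>\<phi> i x = - v i\<close>.\<close>

lemma perturbation_not_injective:
  assumes det: "sq_det n (perturbation_matrix G \<phi> f) = 0"
  obtains x where "x \<noteq> 0" "(U + finite_rank n \<phi> f) x = 0"
proof -
  obtain v where v: "\<exists>i<n. v i \<noteq> 0" "\<And>i. i < n \<Longrightarrow> (\<Sum>j<n. perturbation_matrix G \<phi> f i j * v j) = 0"
    using sq_det_zeroD[OF det] by blast
  define x where "x = G (\<Sum>j<n. sc (v j) (f j))"
  have \<phi>x: "\<phi> i x = - v i" if "i < n" for i
    using v(2)[OF that] unfolding perturbation_matrix_row[OF that] x_def by (simp add: eq_neg_iff_add_eq_0 add.commute)
  have "x \<noteq> 0"
  proof
    assume "x = 0"
    then have "v i = 0" if "i < n" for i using \<phi>x[OF that] vfunctional_zero[OF \<phi>_vfunctional[OF that]] by simp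
    then show False using v(1) by blast
  qed
  moreover have "U x = (\<Sum>j<n. sc (v j) (f j))" by (simp add: x_def is_inverse_op_apply[OF G])
  then have "(U + finite_rank n \<phi> f) x = 0"
    by (simp add: blinfun.add_left finite_rank_apply[OF \<phi>_vfunctional] \<phi>x sc_minus blinfun.minus_left sum_negf)
  ultimately show thesis using that by blast
qed

text \<open>A left null vector \<open>w\<close> defines the functional \<open>\<theta>\<close>,
  which annihilates the range of the perturbed operator. On a full range it would be zero, contrary
  to \<open>\<theta> (f j) = - w j\<close>.\<close>

lemma perturbation_not_surjective:
  assumes det: "sq_det n (perturbation_matrix G \<phi> f) = 0"
  shows "\<not> surj (U + finite_rank n \<phi> f)"
proof
  assume surj: "surj (U + finite_rank n \<phi> f)"
  obtain w where w: "\<exists>i<n. w i \<noteq> 0" "\<And>j. j < n \<Longrightarrow> (\<Sum>i<n. perturbation_matrix G \<phi> f i j * w i) = 0"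
    using sq_det_zeroD[of n "\<lambda>i j. perturbation_matrix G \<phi> f j i"] det by (metis sq_det_transpose)
  define \<theta> where "\<theta> = (\<lambda>y. \<Sum>i<n. w i * \<phi> i (G y))"
  have \<theta>f: "\<theta> (f j) = - w j" if j: "j < n" for j
  proof -
    have "(\<Sum>i<n. perturbation_matrix G \<phi> f i j * w i) = (\<Sum>i<n. (if i = j then w i else 0)) + \<theta> (f j)"
    proof -
      have "perturbation_matrix G \<phi> f i j * w i = (if i = j then w i else 0) + w i * \<phi> i (G (f j))" for i
        by (simp add: perturbation_matrix_def distrib_right)
      then show ?thesis unfolding \<theta>_def by (simp only: sum.distrib)
    qed
    also have "\<dots> = w j + \<theta> (f j)" using j by simp
    finally show ?thesis using w(2)[OF j] by (simp add: eq_neg_iff_add_eq_0 add.commute)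
  qed
  have \<theta>0: "\<theta> y = 0" for y
  proof -
    obtain x where "(U + finite_rank n \<phi> f) x = y" using surj unfolding surj_def by metis
    then have y: "y = U x + (\<Sum>j<n. sc (\<phi> j x) (f j))" by (simp add: op_simps finite_rank_apply[OF \<phi>_vfunctional])
    have "\<phi> i (G y) = \<phi> i x + (\<Sum>j<n. \<phi> j x * \<phi> i (G (f j)))" if i: "i < n" for i
      unfolding y by (simp add: blinfun.add_right blinfun.sum_right clinear_op_sc[OF clinear_op_inverse_G]
          is_inverse_op_apply[OF G] vfunctional_add[OF \<phi>_vfunctional[OF i]] vfunctional_sum[OF \<phi>_vfunctional[OF i]] vfunctional_sc[OF \<phi>_vfunctional[OF i]])
    then have "\<theta> y = (\<Sum>i<n. w i * \<phi> i x) + (\<Sum>i<n. \<Sum>j<n. \<phi> j x * (w i * \<phi> i (G (f j))))"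
      unfolding \<theta>_def by (simp add: algebra_simps sum.distrib sum_distrib_left)
    also have "(\<Sum>i<n. \<Sum>j<n. \<phi> j x * (w i * \<phi> i (G (f j)))) = (\<Sum>j<n. \<phi> j x * \<theta> (f j))"
      unfolding \<theta>_def by (subst sum.swap) (simp add: sum_distrib_left)
    also have "\<dots> = - (\<Sum>i<n. w i * \<phi> i x)" by (simp add: \<theta>f sum_negf mult.commute)
    finally show ?thesis by simp
  qed
  then show False using w(1) \<theta>f by (metis neg_equal_0_iff_equal)
qed

end

end

section \<open>Resolvents modulo an operator ideal\<close>

text \<open>The classes of \<open>S\<close> and \<open>B\<close> are inverse to each other in the
  quotient by \<open>I\<close>; for the compact operators, \<open>B\<close> is a parametrix of
  \<open>S\<close>.\<close>

definition inverse_mod ::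
    "('a::real_normed_vector \<Rightarrow>\<^sub>L 'a) set \<Rightarrow> ('a \<Rightarrow>\<^sub>L 'a) \<Rightarrow> ('a \<Rightarrow>\<^sub>L 'a) \<Rightarrow> bool" where
  "inverse_mod I S B \<longleftrightarrow> S \<circ>\<^sub>L B - id_blinfun \<in> I \<and> B \<circ>\<^sub>L S - id_blinfun \<in> I"

lemma inverse_mod_zero_iff: "inverse_mod {0} S B \<longleftrightarrow> is_inverse_op S B"
  by (simp add: inverse_mod_def is_inverse_op_def)

lemma operator_ideal_diff: "operator_ideal I \<Longrightarrow> X \<in> I \<Longrightarrow> Y \<in> I \<Longrightarrow> X - Y \<in> I"
  and operator_ideal_add: "operator_ideal I \<Longrightarrow> X \<in> I \<Longrightarrow> Y \<in> I \<Longrightarrow> X + Y \<in> I"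
  and operator_ideal_0: "operator_ideal I \<Longrightarrow> 0 \<in> I"
  and operator_ideal_left: "operator_ideal I \<Longrightarrow> X \<in> I \<Longrightarrow> Y \<circ>\<^sub>L X \<in> I"
  and operator_ideal_right: "operator_ideal I \<Longrightarrow> X \<in> I \<Longrightarrow> X \<circ>\<^sub>L Y \<in> I"
  by (auto simp: operator_ideal_def subspace_diff subspace_add subspace_0)

lemma inverse_op_inverse_mod: "operator_ideal I \<Longrightarrow> is_inverse_op S B \<Longrightarrow> inverse_mod I S B"
  by (simp add: inverse_mod_def is_inverse_op_def operator_ideal_0)

lemma inverse_mod_unique:
  assumes I: "operator_ideal I" and B: "inverse_mod I S B" and B': "inverse_mod I S B'"
  shows "B - B' \<in> I"
proof -
  have "B' \<circ>\<^sub>L (S \<circ>\<^sub>L B - id_blinfun) - (B' \<circ>\<^sub>L S - id_blinfun) \<circ>\<^sub>L B \<in> I"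
    by (rule operator_ideal_diff[OF I operator_ideal_left[OF I] operator_ideal_right[OF I]])
      (use B B' in \<open>auto simp: inverse_mod_def\<close>)
  moreover have "B' \<circ>\<^sub>L (S \<circ>\<^sub>L B - id_blinfun) - (B' \<circ>\<^sub>L S - id_blinfun) \<circ>\<^sub>L B = B - B'"
    by (rule blinfun_eqI) (simp add: op_simps)
  ultimately show ?thesis by simp
qed

text \<open>With \<open>D = S' - S\<close>, the operator \<open>(id + B D)\<inverse> B\<close> is a
  left inverse of \<open>S'\<close> modulo \<open>I\<close>, and
  \<open>B (id + D B)\<inverse>\<close> is a right inverse. The two coincide, and the Neumann
  inverses in them are genuine ones. The estimate comes from \<open>Y B - B = - Y B D B\<close> with
  \<open>norm Y \<le> 2\<close>.\<close>

lemma inverse_mod_perturb: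
  fixes S :: "'a::banach \<Rightarrow>\<^sub>L 'a"
  assumes I: "operator_ideal I" and B: "inverse_mod I S B" and small: "norm (S' - S) * norm B \<le> 1/2"
  obtains B' where "inverse_mod I S' B'" "norm (B' - B) \<le> 2 * (norm B)\<^sup>2 * norm (S' - S)"
proof -
  let ?D = "S' - S"
  have "norm (B \<circ>\<^sub>L ?D) < 1" "norm (?D \<circ>\<^sub>L B) < 1"
    using norm_blinfun_compose[of B ?D] norm_blinfun_compose[of ?D B] small by (auto simp: mult.commute)
  then have n1: "norm (- (B \<circ>\<^sub>L ?D)) < 1" and n2: "norm (- (?D \<circ>\<^sub>L B)) < 1" by simp_all
  obtain Y where Y: "is_inverse_op (id_blinfun - (- (B \<circ>\<^sub>L ?D))) Y" "norm Y \<le> 1 / (1 - norm (- (B \<circ>\<^sub>L ?D)))"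
    by (rule neumann_inverse[OF n1])
  obtain Y2 where Y2: "is_inverse_op (id_blinfun - (- (?D \<circ>\<^sub>L B))) Y2"
    by (rule neumann_inverse[OF n2])
  have Ya: "Y x + Y (B (?D x)) = x" and Yb: "Y x + B (?D (Y x)) = x" for x
    using is_inverse_op_apply[OF Y(1), of x] by (simp_all add: blinfun.bilinear_simps algebra_simps)
  have Y2a: "Y2 x + Y2 (?D (B x)) = x" and Y2b: "Y2 x + ?D (B (Y2 x)) = x" for x
    using is_inverse_op_apply[OF Y2, of x] by (simp_all add: blinfun.bilinear_simps algebra_simps)
  have eq: "Y (B x) = B (Y2 x)" for x
  proof -
    have "B (Y2 x) = Y (B (Y2 x)) + Y (B (?D (B (Y2 x))))" by (rule Ya[symmetric])
    also have "\<dots> = Y (B (Y2 x + ?D (B (Y2 x))))" by (simp add: blinfun.add_right)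
    finally show ?thesis by (simp only: Y2b)
  qed
  have "inverse_mod I S' (Y \<circ>\<^sub>L B)"
    unfolding inverse_mod_def
  proof
    have "Y \<circ>\<^sub>L (B \<circ>\<^sub>L S - id_blinfun) \<in> I"
      using B operator_ideal_left[OF I] by (auto simp: inverse_mod_def)
    moreover have "Y \<circ>\<^sub>L (B \<circ>\<^sub>L S - id_blinfun) = (Y \<circ>\<^sub>L B) \<circ>\<^sub>L S' - id_blinfun"
    proof (rule blinfun_eqI)
      fix x
      have "Y (B (S x)) - Y x = Y (B (S x)) - Y x + (Y x + Y (B (?D x)) - x)" by (simp only: Ya) simp
      also have "\<dots> = Y (B (S' x)) - x" by (simp add: op_simps)
      finally show "(Y \<circ>\<^sub>L (B \<circ>\<^sub>L S - id_blinfun)) x = ((Y \<circ>\<^sub>L B) \<circ>\<^sub>L S' - id_blinfun) x" by (simp add: op_simps)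
    qed
    ultimately show "(Y \<circ>\<^sub>L B) \<circ>\<^sub>L S' - id_blinfun \<in> I" by simp
    have "(S \<circ>\<^sub>L B - id_blinfun) \<circ>\<^sub>L Y2 \<in> I"
      using B operator_ideal_right[OF I] by (auto simp: inverse_mod_def)
    moreover have "(S \<circ>\<^sub>L B - id_blinfun) \<circ>\<^sub>L Y2 = S' \<circ>\<^sub>L (Y \<circ>\<^sub>L B) - id_blinfun"
    proof (rule blinfun_eqI)
      fix x
      have "S (B (Y2 x)) - Y2 x = S (B (Y2 x)) - Y2 x + (Y2 x + ?D (B (Y2 x)) - x)" by (simp only: Y2b) simp
      also have "\<dots> = S' (Y (B x)) - x" unfolding eq by (simp add: op_simps)
      finally show "((S \<circ>\<^sub>L B - id_blinfun) \<circ>\<^sub>L Y2) x = (S' \<circ>\<^sub>L (Y \<circ>\<^sub>L B) - id_blinfun) x" by (simp add: op_simps)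
    qed
    ultimately show "S' \<circ>\<^sub>L (Y \<circ>\<^sub>L B) - id_blinfun \<in> I" by simp
  qed
  moreover have "norm (Y \<circ>\<^sub>L B - B) \<le> 2 * (norm B)\<^sup>2 * norm ?D"
  proof -
    have "Y \<circ>\<^sub>L B - B = - (Y \<circ>\<^sub>L ((B \<circ>\<^sub>L ?D) \<circ>\<^sub>L B))"
    proof (rule blinfun_eqI)
      fix x show "(Y \<circ>\<^sub>L B - B) x = (- (Y \<circ>\<^sub>L ((B \<circ>\<^sub>L ?D) \<circ>\<^sub>L B))) x"
        using Ya[of "B x"] by (simp add: op_simps algebra_simps)
    qed
    then have "norm (Y \<circ>\<^sub>L B - B) \<le> norm Y * norm ((B \<circ>\<^sub>L ?D) \<circ>\<^sub>L B)"
      by (metis norm_blinfun_compose norm_minus_cancel)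
    also have "\<dots> \<le> 2 * ((norm B * norm ?D) * norm B)"
    proof (intro mult_mono)
      have "norm (- (B \<circ>\<^sub>L ?D)) \<le> 1/2"
        using norm_blinfun_compose[of B ?D] small by (simp add: mult.commute)
      then have "1 / (1 - norm (- (B \<circ>\<^sub>L ?D))) \<le> 2" by (simp add: divide_simps)
      then show "norm Y \<le> 2" using Y(2) by linarith
      show "norm ((B \<circ>\<^sub>L ?D) \<circ>\<^sub>L B) \<le> (norm B * norm ?D) * norm B"
        by (rule order_trans[OF norm_blinfun_compose]) (intro mult_right_mono norm_blinfun_compose norm_ge_zero)
    qed auto
    finally show ?thesis by (simp add: power2_eq_square mult_ac)
  qed
  ultimately show thesis using that by blast
qed

context complex_structure
begin

definition resolvent_set_mod :: "('a \<Rightarrow>\<^sub>L 'a) set \<Rightarrow> ('a \<Rightarrow>\<^sub>L 'a) \<Rightarrow> complex set" where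
  "resolvent_set_mod I T = {z. \<exists>B. inverse_mod I (sc z - T) B}"

text \<open>A representative chosen separately at each point, with no regularity in
  \<open>z\<close>. Only its class modulo \<open>I\<close> is determined, which is why it is studied
  through functionals that vanish on \<open>I\<close>.\<close>

definition resolvent_mod :: "('a \<Rightarrow>\<^sub>L 'a) set \<Rightarrow> ('a \<Rightarrow>\<^sub>L 'a) \<Rightarrow> complex \<Rightarrow> 'a \<Rightarrow>\<^sub>L 'a" where
  "resolvent_mod I T z = (SOME B. inverse_mod I (sc z - T) B)"

lemma resolvent_mod: "z \<in> resolvent_set_mod I T \<Longrightarrow> inverse_mod I (sc z - T) (resolvent_mod I T z)"
  unfolding resolvent_set_mod_def resolvent_mod_def by (simp add: someI_ex)

lemma resolvent_set_mod_zero: "resolvent_set_mod {0} T = - spectrum_wrt J T"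
  by (auto simp: resolvent_set_mod_def spectrum_wrt_def inverse_mod_zero_iff)

lemma resolvent_wrt_eqI: "is_inverse_op (sc z - T) R \<Longrightarrow> resolvent_wrt J T z = R"
  unfolding resolvent_wrt_def by (rule the_equality) (auto intro: is_inverse_op_unique)

lemma resolvent_inverse: "z \<notin> spectrum_wrt J T \<Longrightarrow> is_inverse_op (sc z - T) (resolvent_wrt J T z)"
  unfolding spectrum_wrt_def using resolvent_wrt_eqI by force

text \<open>Point and operator are moved at once, so that a single estimate gives openness of the
  resolvent set, continuity of the resolvent, and stability under changes of
  \<open>T\<close>.\<close>

lemma resolvent_mod_perturb:
  assumes I: "operator_ideal I" and B: "inverse_mod I (sc z - T) B"
  shows "\<exists>d>0. \<forall>w T'. cmod (w - z) + norm (T' - T) < d \<longrightarrow> (\<exists>B'. inverse_mod I (sc w - T') B' \<and>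
    norm (B' - B) \<le> 2 * (norm B)\<^sup>2 * ((1 + norm J) * (cmod (w - z) + norm (T' - T))))"
proof -
  \<comment> \<open>Since \<open>norm (sc w) \<le> (1 + norm J) * cmod w\<close>, this makes the
    perturbation times \<open>norm B\<close> at most \<open>1/2\<close>; adding \<open>1\<close> to
    \<open>norm B\<close> avoids division by zero.\<close>
  define d where "d = 1 / (2 * (1 + norm J) * (norm B + 1))"
  have d: "d > 0" unfolding d_def by (intro divide_pos_pos mult_pos_pos add_pos_nonneg add_nonneg_pos) auto
  show ?thesis
  proof (intro exI[of _ d] conjI allI impI)
    show "d > 0" by fact
    fix w T' assume w: "cmod (w - z) + norm (T' - T) < d"
    have "(sc w - T') - (sc z - T) = sc (w - z) - (T' - T)" by (simp add: sc_diff)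
    then have "norm ((sc w - T') - (sc z - T)) = norm (sc (w - z) - (T' - T))" by (rule arg_cong)
    then have le: "norm ((sc w - T') - (sc z - T)) \<le> (1 + norm J) * (cmod (w - z) + norm (T' - T))"
      using norm_triangle_ineq4[of "sc (w - z)" "T' - T"] norm_sc[of "w - z"]
        mult_right_mono[of 1 "1 + norm J" "norm (T' - T)", OF _ norm_ge_zero]
      unfolding distrib_left by simp
    have "norm ((sc w - T') - (sc z - T)) * norm B \<le> ((1 + norm J) * d) * (norm B + 1)"
    proof (rule mult_mono)
      show "norm ((sc w - T') - (sc z - T)) \<le> (1 + norm J) * d"
        using w by (intro order_trans[OF le] mult_left_mono) auto
      show "0 \<le> (1 + norm J) * d" using d by (intro mult_nonneg_nonneg) auto
    qed auto
    also have "\<dots> = 1/2"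
    proof -
      have "1 + norm J > 0" "norm B + 1 > 0" by (auto simp: add_pos_nonneg add_nonneg_pos)
      then show ?thesis by (simp add: d_def)
    qed
    finally obtain B' where B': "inverse_mod I (sc w - T') B'"
      "norm (B' - B) \<le> 2 * (norm B)\<^sup>2 * norm ((sc w - T') - (sc z - T))"
      by (rule inverse_mod_perturb[OF I B])
    have "2 * (norm B)\<^sup>2 * norm ((sc w - T') - (sc z - T)) \<le> 2 * (norm B)\<^sup>2 * ((1 + norm J) * (cmod (w - z) + norm (T' - T)))"
      by (intro mult_left_mono le) auto
    with B' show "\<exists>B'. inverse_mod I (sc w - T') B' \<and>
        norm (B' - B) \<le> 2 * (norm B)\<^sup>2 * ((1 + norm J) * (cmod (w - z) + norm (T' - T)))"
      by (meson order_trans)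
  qed
qed

lemma open_resolvent_set_mod:
  assumes I: "operator_ideal I" shows "open (resolvent_set_mod I T)"
  unfolding open_dist
proof
  fix z assume "z \<in> resolvent_set_mod I T"
  then obtain B where "inverse_mod I (sc z - T) B" by (auto simp: resolvent_set_mod_def)
  from resolvent_mod_perturb[OF I this] obtain d where "d > 0" and
    P: "\<And>w T'. cmod (w - z) + norm (T' - T) < d \<Longrightarrow> \<exists>B'. inverse_mod I (sc w - T') B' \<and>
    norm (B' - B) \<le> 2 * (norm B)\<^sup>2 * ((1 + norm J) * (cmod (w - z) + norm (T' - T)))"
    by blast
  have "y \<in> resolvent_set_mod I T" if y: "dist y z < d" for y
  proof -
    obtain B' where "inverse_mod I (sc y - T) B'" using P[of y T] y by (auto simp: dist_norm)
    then show ?thesis by (auto simp: resolvent_set_mod_def)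
  qed
  then show "\<exists>e>0. \<forall>y. dist y z < e \<longrightarrow> y \<in> resolvent_set_mod I T" using \<open>d > 0\<close> by blast
qed

text \<open>Modulo \<open>I\<close>, the commutator \<open>B X - X B\<close> equals
  \<open>- B (S X - X S) B\<close>.\<close>

lemma inverse_mod_commute:
  assumes I: "operator_ideal I" and B: "inverse_mod I S B" and X: "S \<circ>\<^sub>L X - X \<circ>\<^sub>L S \<in> I"
  shows "B \<circ>\<^sub>L X - X \<circ>\<^sub>L B \<in> I"
proof -
  have "(B \<circ>\<^sub>L X) \<circ>\<^sub>L (id_blinfun - S \<circ>\<^sub>L B) \<in> I" "(B \<circ>\<^sub>L S - id_blinfun) \<circ>\<^sub>L (X \<circ>\<^sub>L B) \<in> I"
    "B \<circ>\<^sub>L ((S \<circ>\<^sub>L X - X \<circ>\<^sub>L S) \<circ>\<^sub>L B) \<in> I"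
    using B X operator_ideal_diff[OF I operator_ideal_0[OF I], of "S \<circ>\<^sub>L B - id_blinfun"]
    by (auto simp: inverse_mod_def intro: operator_ideal_left[OF I] operator_ideal_right[OF I])
  then have "(B \<circ>\<^sub>L X) \<circ>\<^sub>L (id_blinfun - S \<circ>\<^sub>L B) + (B \<circ>\<^sub>L S - id_blinfun) \<circ>\<^sub>L (X \<circ>\<^sub>L B) - B \<circ>\<^sub>L ((S \<circ>\<^sub>L X - X \<circ>\<^sub>L S) \<circ>\<^sub>L B) \<in> I"
    by (intro operator_ideal_diff[OF I] operator_ideal_add[OF I])
  moreover have "(B \<circ>\<^sub>L X) \<circ>\<^sub>L (id_blinfun - S \<circ>\<^sub>L B) + (B \<circ>\<^sub>L S - id_blinfun) \<circ>\<^sub>L (X \<circ>\<^sub>L B) - B \<circ>\<^sub>L ((S \<circ>\<^sub>L X - X \<circ>\<^sub>L S) \<circ>\<^sub>L B) = B \<circ>\<^sub>L X - X \<circ>\<^sub>L B"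
    by (rule blinfun_eqI) (simp add: op_simps)
  ultimately show ?thesis by simp
qed

text \<open>The chosen representatives may jump, so near \<open>z\<close> they are exchanged for the
  perturbed inverses \<open>F w\<close>, which converge to \<open>B\<close>; \<open>\<psi>\<close>
  does not notice the exchange. The resolvent identity modulo \<open>I\<close> then produces the
  derivative \<open>- \<psi> (B \<circ>\<^sub>L B)\<close>.\<close>

lemma functional_resolvent_derivative:
  assumes I: "operator_ideal I" and T: "clinear_op T" and \<psi>: "functional \<psi>" "\<And>Y. Y \<in> I \<Longrightarrow> \<psi> Y = 0"
    and z: "z \<in> resolvent_set_mod I T"
  shows "\<exists>D. ((\<lambda>w. \<psi> (resolvent_mod I T w)) has_field_derivative D) (at z)"
proof -
  define B where "B = resolvent_mod I T z"
  have B: "inverse_mod I (sc z - T) B" unfolding B_def by (rule resolvent_mod[OF z])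
  from resolvent_mod_perturb[OF I B] obtain d where d: "d > 0" and
    P: "\<And>w T'. cmod (w - z) + norm (T' - T) < d \<Longrightarrow> \<exists>B'. inverse_mod I (sc w - T') B' \<and>
    norm (B' - B) \<le> 2 * (norm B)\<^sup>2 * ((1 + norm J) * (cmod (w - z) + norm (T' - T)))"
    by blast
  have "\<exists>B'. inverse_mod I (sc w - T) B' \<and> norm (B' - B) \<le> 2 * (norm B)\<^sup>2 * ((1 + norm J) * cmod (w - z))"
    if "cmod (w - z) < d" for w using P[of w T] that by simp
  then obtain F where F: "\<And>w. cmod (w - z) < d \<Longrightarrow> inverse_mod I (sc w - T) (F w)"
    "\<And>w. cmod (w - z) < d \<Longrightarrow> norm (F w - B) \<le> 2 * (norm B)\<^sup>2 * ((1 + norm J) * cmod (w - z))"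
    by metis
  have eqI: "\<psi> X = \<psi> Y" if "X - Y \<in> I" for X Y
    using \<psi>(2)[OF that] functional_diff[OF \<psi>(1)] by simp
  have \<psi>F: "\<psi> (resolvent_mod I T w) = \<psi> (F w)" if w: "cmod (w - z) < d" for w
  proof -
    have "w \<in> resolvent_set_mod I T" using F(1)[OF w] by (auto simp: resolvent_set_mod_def)
    then show ?thesis by (intro eqI inverse_mod_unique[OF I resolvent_mod F(1)[OF w]])
  qed
  have quot: "(\<psi> (F w) - \<psi> B) / (w - z) = - \<psi> (F w \<circ>\<^sub>L B)" if w: "cmod (w - z) < d" "w \<noteq> z" for w
  proof -
    \<comment> \<open>The scalar has to be moved to the left of \<open>F w\<close>, where
      \<open>\<psi>\<close> is homogeneous. \<open>F w\<close> commutes with scalars only modulo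
      \<open>I\<close>.\<close>
    have c: "F w \<circ>\<^sub>L sc (w - z) - sc (w - z) \<circ>\<^sub>L F w \<in> I"
    proof (rule inverse_mod_commute[OF I F(1)[OF w(1)]])
      have "(sc w - T) \<circ>\<^sub>L sc (w - z) - sc (w - z) \<circ>\<^sub>L (sc w - T) = 0"
        by (rule blinfun_eqI) (simp add: op_simps clinear_op_sc[OF T] mult.commute flip: sc_mult_apply)
      then show "(sc w - T) \<circ>\<^sub>L sc (w - z) - sc (w - z) \<circ>\<^sub>L (sc w - T) \<in> I"
        using operator_ideal_0[OF I] by simp
    qed
    have "F w \<circ>\<^sub>L ((sc z - T) \<circ>\<^sub>L B - id_blinfun) - (F w \<circ>\<^sub>L (sc w - T) - id_blinfun) \<circ>\<^sub>L B
        + (F w \<circ>\<^sub>L sc (w - z) - sc (w - z) \<circ>\<^sub>L F w) \<circ>\<^sub>L B \<in> I"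
      by (rule operator_ideal_add[OF I operator_ideal_diff[OF I operator_ideal_left[OF I] operator_ideal_right[OF I]]
            operator_ideal_right[OF I c]])
        (use B F(1)[OF w(1)] in \<open>auto simp: inverse_mod_def\<close>)
    moreover have "F w \<circ>\<^sub>L ((sc z - T) \<circ>\<^sub>L B - id_blinfun) - (F w \<circ>\<^sub>L (sc w - T) - id_blinfun) \<circ>\<^sub>L B
        + (F w \<circ>\<^sub>L sc (w - z) - sc (w - z) \<circ>\<^sub>L F w) \<circ>\<^sub>L B = (B - F w) - sc (w - z) \<circ>\<^sub>L (F w \<circ>\<^sub>L B)"
      by (rule blinfun_eqI) (simp add: op_simps sc_diff algebra_simps)
    ultimately have "\<psi> (B - F w) = \<psi> (sc (w - z) \<circ>\<^sub>L (F w \<circ>\<^sub>L B))" by (intro eqI) simp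
    then have "\<psi> B - \<psi> (F w) = (w - z) * \<psi> (F w \<circ>\<^sub>L B)"
      by (simp only: functional_diff[OF \<psi>(1)] functional_sc[OF \<psi>(1)])
    then have "\<psi> (F w) - \<psi> B = - \<psi> (F w \<circ>\<^sub>L B) * (w - z)" by (simp add: algebra_simps)
    then show ?thesis using w(2) by (simp add: divide_simps)
  qed
  have F_tendsto: "(F \<longlongrightarrow> B) (at z)"
  proof (rule LIM_zero_cancel, rule tendsto_norm_zero_cancel, rule tendsto_sandwich[OF _ _ tendsto_const])
    show "\<forall>\<^sub>F w in at z. norm (F w - B) \<le> 2 * (norm B)\<^sup>2 * ((1 + norm J) * cmod (w - z))"
      unfolding eventually_at using d(1) F(2) by (auto simp: dist_norm)
    have "((\<lambda>w. 2 * (norm B)\<^sup>2 * ((1 + norm J) * cmod (w - z))) \<longlongrightarrow> 2 * (norm B)\<^sup>2 * ((1 + norm J) * cmod (z - z))) (at z)"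
      by (intro tendsto_intros)
    then show "((\<lambda>w. 2 * (norm B)\<^sup>2 * ((1 + norm J) * cmod (w - z))) \<longlongrightarrow> 0) (at z)" by simp
  qed simp
  have bl: "bounded_linear (\<lambda>X. - \<psi> (X \<circ>\<^sub>L B))"
    by (rule bounded_linear_minus[OF bounded_linear_compose[OF _
          bounded_bilinear.bounded_linear_left[OF bounded_bilinear_blinfun_compose]]])
      (use \<psi>(1) in \<open>simp add: functional_def\<close>)
  have lim: "((\<lambda>w. - \<psi> (F w \<circ>\<^sub>L B)) \<longlongrightarrow> - \<psi> (B \<circ>\<^sub>L B)) (at z)"
    by (rule bounded_linear.tendsto[OF bl F_tendsto])
  have "((\<lambda>w. \<psi> (resolvent_mod I T w)) has_field_derivative - \<psi> (B \<circ>\<^sub>L B)) (at z)"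
    unfolding has_field_derivative_iff
  proof (rule Lim_transform_eventually[OF lim])
    show "\<forall>\<^sub>F w in at z. - \<psi> (F w \<circ>\<^sub>L B) = (\<psi> (resolvent_mod I T w) - \<psi> (resolvent_mod I T z)) / (w - z)"
      unfolding eventually_at using d(1) quot \<psi>F by (intro exI[of _ d]) (auto simp: dist_norm simp flip: B_def)
  qed
  then show ?thesis by blast
qed

lemma holomorphic_resolvent_mod:
  assumes "operator_ideal I" "clinear_op T" "functional \<psi>" "\<And>Y. Y \<in> I \<Longrightarrow> \<psi> Y = 0"
  shows "(\<lambda>z. \<psi> (resolvent_mod I T z)) holomorphic_on resolvent_set_mod I T"
  unfolding holomorphic_on_open[OF open_resolvent_set_mod[OF assms(1)]]
  using functional_resolvent_derivative[OF assms] by blast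

lemma resolvent_mod_zero: "z \<notin> spectrum_wrt J T \<Longrightarrow> resolvent_mod {0} T z = resolvent_wrt J T z"
  using resolvent_mod[of z "{0}" T] resolvent_wrt_eqI[of z T]
  by (simp add: resolvent_set_mod_zero inverse_mod_zero_iff)

lemma closed_spectrum: "closed (spectrum_wrt J T)"
  using open_resolvent_set_mod[OF operator_ideal_zero] by (simp add: resolvent_set_mod_zero closed_def)

lemma functional_eq_resolvent_mod:
  assumes I: "operator_ideal I" and \<psi>: "functional \<psi>" "\<And>Y. Y \<in> I \<Longrightarrow> \<psi> Y = 0" and z: "z \<notin> spectrum_wrt J T"
  shows "\<psi> (resolvent_wrt J T z) = \<psi> (resolvent_mod I T z)"
proof -
  have R: "inverse_mod I (sc z - T) (resolvent_wrt J T z)"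
    by (rule inverse_op_inverse_mod[OF I resolvent_inverse[OF z]])
  then have "inverse_mod I (sc z - T) (resolvent_mod I T z)"
    by (intro resolvent_mod) (auto simp: resolvent_set_mod_def)
  from \<psi>(2)[OF inverse_mod_unique[OF I R this]] show ?thesis by (simp add: functional_diff[OF \<psi>(1)])
qed

lemma resolvent_set_mod_superset:
  "operator_ideal I \<Longrightarrow> - spectrum_wrt J T \<subseteq> resolvent_set_mod I T"
  using inverse_op_inverse_mod resolvent_inverse by (fastforce simp: resolvent_set_mod_def)

lemma holomorphic_resolvent:
  assumes "clinear_op T" "functional \<psi>"
  shows "(\<lambda>z. \<psi> (resolvent_wrt J T z)) holomorphic_on - spectrum_wrt J T"
  using holomorphic_resolvent_mod[OF operator_ideal_zero assms] functional_zero[OF assms(2)] resolvent_mod_zero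
  unfolding resolvent_set_mod_zero by (auto elim!: holomorphic_transform)

lemma resolvent_perturb:
  assumes z: "z \<notin> spectrum_wrt J T"
  shows "\<exists>d>0. \<forall>w T'. cmod (w - z) + norm (T' - T) < d \<longrightarrow> w \<notin> spectrum_wrt J T' \<and>
    norm (resolvent_wrt J T' w - resolvent_wrt J T z)
      \<le> 2 * (norm (resolvent_wrt J T z))\<^sup>2 * ((1 + norm J) * (cmod (w - z) + norm (T' - T)))"
proof -
  have "inverse_mod {0} (sc z - T) (resolvent_wrt J T z)"
    using resolvent_inverse[OF z] by (simp add: inverse_mod_zero_iff)
  from resolvent_mod_perturb[OF operator_ideal_zero this]
  obtain d where d: "d > 0" "\<And>w T'. cmod (w - z) + norm (T' - T) < d \<Longrightarrow> \<exists>B'. is_inverse_op (sc w - T') B' \<and>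
    norm (B' - resolvent_wrt J T z) \<le> 2 * (norm (resolvent_wrt J T z))\<^sup>2 * ((1 + norm J) * (cmod (w - z) + norm (T' - T)))"
    unfolding inverse_mod_zero_iff by blast
  show ?thesis
  proof (intro exI[of _ d] conjI allI impI)
    fix w T' assume "cmod (w - z) + norm (T' - T) < d"
    then obtain B' where B': "is_inverse_op (sc w - T') B'"
      "norm (B' - resolvent_wrt J T z) \<le> 2 * (norm (resolvent_wrt J T z))\<^sup>2 * ((1 + norm J) * (cmod (w - z) + norm (T' - T)))"
      using d(2) by blast
    show "w \<notin> spectrum_wrt J T'" using B'(1) by (auto simp: spectrum_wrt_def)
    show "norm (resolvent_wrt J T' w - resolvent_wrt J T z)
      \<le> 2 * (norm (resolvent_wrt J T z))\<^sup>2 * ((1 + norm J) * (cmod (w - z) + norm (T' - T)))"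
      using B'(2) resolvent_wrt_eqI[OF B'(1)] by simp
  qed (rule d(1))
qed

lemma continuous_resolvent: "continuous_on (- spectrum_wrt J T) (resolvent_wrt J T)"
proof -
  have "isCont (resolvent_wrt J T) z" if z: "z \<notin> spectrum_wrt J T" for z
  proof -
    define C where "C = 2 * (norm (resolvent_wrt J T z))\<^sup>2 * (1 + norm J)"
    obtain d where d: "d > 0" and P: "\<And>w T'. cmod (w - z) + norm (T' - T) < d \<Longrightarrow>
        norm (resolvent_wrt J T' w - resolvent_wrt J T z)
          \<le> 2 * (norm (resolvent_wrt J T z))\<^sup>2 * ((1 + norm J) * (cmod (w - z) + norm (T' - T)))"
      using resolvent_perturb[OF z] by blast
    have P: "norm (resolvent_wrt J T w - resolvent_wrt J T z) \<le> C * cmod (w - z)" if "cmod (w - z) < d" for w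
      using P[of w T] that by (simp add: C_def mult.assoc)
    have "((\<lambda>w. resolvent_wrt J T w - resolvent_wrt J T z) \<longlongrightarrow> 0) (at z)"
    proof (rule tendsto_norm_zero_cancel, rule tendsto_sandwich[OF _ _ tendsto_const])
      show "\<forall>\<^sub>F w in at z. norm (resolvent_wrt J T w - resolvent_wrt J T z) \<le> C * cmod (w - z)"
        unfolding eventually_at using d P by (auto simp: dist_norm)
      have "((\<lambda>w. C * cmod (w - z)) \<longlongrightarrow> C * cmod (z - z)) (at z)" by (intro tendsto_intros)
      then show "((\<lambda>w. C * cmod (w - z)) \<longlongrightarrow> 0) (at z)" by simp
    qed simp
    then show ?thesis by (simp add: isCont_def LIM_zero_cancel)
  qed
  then show ?thesis by (simp add: continuous_at_imp_continuous_on)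
qed

text \<open>\<open>sc z - T\<close> is a perturbation of \<open>sc z\<close>, whose inverse has norm
  at most \<open>(1 + norm J) / cmod z\<close>. The factor \<open>1 + norm J\<close> is the price
  for a norm that need not be homogeneous over the complex numbers.\<close>

lemma resolvent_large:
  assumes z: "cmod z > (1 + norm J) * norm T"
  shows "z \<notin> spectrum_wrt J T"
    and "norm (resolvent_wrt J T z) \<le> (1 + norm J) / (cmod z - (1 + norm J) * norm T)"
proof -
  have z0: "cmod z > 0" 
  proof -
    have "0 \<le> (1 + norm J) * norm T" by simp
    then show ?thesis using z by linarith
  qed
  then have inv: "is_inverse_op (sc z) (sc (1/z))"
    by (simp add: is_inverse_op_def sc_one flip: sc_mult)
  have n: "norm (sc (1/z)) \<le> (1 + norm J) / cmod z" using norm_sc[of "1/z"] by (simp add: norm_divide)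
  have le: "norm ((sc z - T) - sc z) * norm (sc (1/z)) \<le> norm T * ((1 + norm J) / cmod z)"
  proof -
    have "(sc z - T) - sc z = - T" by simp
    then show ?thesis using mult_left_mono[OF n norm_ge_zero[of T]] by (simp only: norm_minus_cancel)
  qed
  also have sm: "\<dots> < 1" using z z0 by (simp add: field_simps)
  finally have lt: "norm ((sc z - T) - sc z) * norm (sc (1/z)) < 1" .
  obtain R where R: "is_inverse_op (sc z - T) R"
    "norm R \<le> norm (sc (1/z)) / (1 - norm ((sc z - T) - sc z) * norm (sc (1/z)))"
    by (rule inverse_op_perturb[OF inv lt])
  show "z \<notin> spectrum_wrt J T" using R(1) by (auto simp: spectrum_wrt_def)
  have "norm R \<le> ((1 + norm J) / cmod z) / (1 - norm T * ((1 + norm J) / cmod z))"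
  proof (rule order_trans[OF R(2) frac_le])
    have "norm ((sc z - T) - sc z) * norm (sc (1/z)) \<le> norm T * ((1 + norm J) / cmod z)" by (fact le)
    then show "1 - norm T * ((1 + norm J) / cmod z) \<le> 1 - norm ((sc z - T) - sc z) * norm (sc (1/z))" by simp
    show "0 < 1 - norm T * ((1 + norm J) / cmod z)" using sm by linarith
    show "0 \<le> (1 + norm J) / cmod z" using z0 by (intro divide_nonneg_pos) auto
  qed (rule n)
  also have "\<dots> = (1 + norm J) / (cmod z - (1 + norm J) * norm T)"
  proof -
    have "1 - norm T * ((1 + norm J) / cmod z) = (cmod z - (1 + norm J) * norm T) / cmod z"
      using z0 by (simp add: diff_divide_distrib mult.commute)
    then show ?thesis using z0 by simp
  qed
  finally show "norm (resolvent_wrt J T z) \<le> (1 + norm J) / (cmod z - (1 + norm J) * norm T)"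
    using resolvent_wrt_eqI[OF R(1)] by simp
qed

section \<open>Fredholm operators on the imaginary axis\<close>

text \<open>For complex-linear \<open>S\<close> this describes the Fredholm operators of index zero.
  In this form openness is immediate, and the determinant of the correction is at hand.\<close>

definition weyl :: "('a \<Rightarrow>\<^sub>L 'a) \<Rightarrow> bool" where
  "weyl S \<longleftrightarrow> (\<exists>n \<phi> f R. (\<forall>i<n. vfunctional (\<phi> i)) \<and> is_inverse_op (S + finite_rank n \<phi> f) R)"

lemma weylI: "\<forall>i<n. vfunctional (\<phi> i) \<Longrightarrow> is_inverse_op (S + finite_rank n \<phi> f) R \<Longrightarrow> weyl S"
  unfolding weyl_def by blast

lemma weylE:
  assumes "weyl S"
  obtains n \<phi> f R where "\<forall>i<n. vfunctional (\<phi> i)" "is_inverse_op (S + finite_rank n \<phi> f) R"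
proof -
  obtain n \<phi> f R where "\<forall>i<n. vfunctional (\<phi> i)" "is_inverse_op (S + finite_rank n \<phi> f) R"
    using assms unfolding weyl_def by blast
  then show thesis by (intro that[of n \<phi> f R]) auto
qed

lemma weyl_inverse: "is_inverse_op S R \<Longrightarrow> weyl S"
  by (rule weylI[of 0]) (simp_all add: finite_rank_def)

lemma vfunctional_neg: "vfunctional \<phi> \<Longrightarrow> vfunctional (\<lambda>x. - \<phi> x)"
  by (simp add: vfunctional_def bounded_linear_minus)

lemma finite_rank_snoc:
  "finite_rank n \<phi> f + rank_one \<theta> c = finite_rank (Suc n) (\<phi>(n := \<theta>)) (f(n := c))"
  by (simp add: finite_rank_def)

lemma finite_rank_neg:
  assumes "\<forall>i<n. vfunctional (\<phi> i)"
  shows "finite_rank n (\<lambda>i x. - \<phi> i x) f = - finite_rank n \<phi> f"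
proof (rule blinfun_eqI)
  fix x
  have "finite_rank n (\<lambda>i x. - \<phi> i x) f x = (\<Sum>i<n. sc (- \<phi> i x) (f i))"
    by (rule finite_rank_apply) (use vfunctional_neg assms in blast)
  then show "finite_rank n (\<lambda>i x. - \<phi> i x) f x = (- finite_rank n \<phi> f) x"
    by (simp add: blinfun.minus_left finite_rank_apply assms sc_minus sum_negf)
qed

lemma weyl_add_rank_one:
  assumes \<theta>: "vfunctional \<theta>"
  shows "weyl (S + rank_one \<theta> c) \<longleftrightarrow> weyl S"
proof -
  have imp: "weyl S" if a: "weyl (S + rank_one \<theta> c)" "vfunctional \<theta>" for S \<theta>
  proof -
    obtain n \<phi> f R where nf: "\<forall>i<n. vfunctional (\<phi> i)" "is_inverse_op (S + rank_one \<theta> c + finite_rank n \<phi> f) R"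
      by (rule weylE[OF a(1)]) blast
    have "S + rank_one \<theta> c + finite_rank n \<phi> f = S + finite_rank (Suc n) (\<phi>(n := \<theta>)) (f(n := c))"
      by (simp add: algebra_simps flip: finite_rank_snoc)
    then have inv: "is_inverse_op (S + finite_rank (Suc n) (\<phi>(n := \<theta>)) (f(n := c))) R"
      using nf(2) by metis
    show ?thesis by (rule weylI[OF _ inv]) (use nf(1) a(2) in \<open>auto simp: less_Suc_eq\<close>)
  qed
  have neg: "rank_one (\<lambda>x. - \<theta> x) c = - rank_one \<theta> c"
    by (rule blinfun_eqI) (simp add: rank_one_apply \<theta> vfunctional_neg blinfun.minus_left sc_minus)
  show ?thesis using imp[OF _ \<theta>, of S] imp[OF _ vfunctional_neg[OF \<theta>], of "S + rank_one \<theta> c"] by (auto simp: neg)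
qed

lemma weyl_decompose:
  assumes "weyl S" "clinear_op S"
  obtains n \<phi> f U G where "\<forall>i<n. vfunctional (\<phi> i)" "is_inverse_op U G" "clinear_op U" "S = U + finite_rank n \<phi> f"
proof -
  obtain n \<phi> f R where nf: "\<forall>i<n. vfunctional (\<phi> i)" "is_inverse_op (S + finite_rank n \<phi> f) R"
    by (rule weylE[OF assms(1)]) blast
  show thesis
  proof (rule that[of n "\<lambda>i x. - \<phi> i x" "S + finite_rank n \<phi> f" R f])
    show "S = S + finite_rank n \<phi> f + finite_rank n (\<lambda>i x. - \<phi> i x) f"
      using finite_rank_neg[of n \<phi> f] nf(1) by simp
    show "clinear_op (S + finite_rank n \<phi> f)"
      using assms(2) nf(1) by (intro clinear_op_add clinear_op_finite_rank) auto
  qed (use nf vfunctional_neg in auto)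
qed

text \<open>One half of the Fredholm alternative: a vanishing determinant would produce a kernel
  vector. \<open>weyl_surjective\<close> is the other half.\<close>

lemma weyl_injective:
  assumes "weyl S" "clinear_op S" and inj: "\<And>x. S x = 0 \<Longrightarrow> x = 0"
  obtains R where "is_inverse_op S R"
proof -
  obtain n \<phi> f U G where d: "\<forall>i<n. vfunctional (\<phi> i)" "is_inverse_op U G" "clinear_op U" "S = U + finite_rank n \<phi> f"
    by (rule weyl_decompose[OF assms(1,2)]) blast
  have "sq_det n (perturbation_matrix G \<phi> f) \<noteq> 0"
  proof
    assume "sq_det n (perturbation_matrix G \<phi> f) = 0"
    then obtain x where "x \<noteq> 0" "(U + finite_rank n \<phi> f) x = 0"
      by (rule perturbation_not_injective[OF d(1-3)])
    then show False using inj[of x] d(4) by simp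
  qed
  then obtain R where "is_inverse_op (U + finite_rank n \<phi> f) R"
    by (rule perturbation_invertible[OF d(1-3)])
  then show thesis using that unfolding d(4) by blast
qed

lemma weyl_surjective:
  assumes "weyl S" "clinear_op S" and surj: "surj S"
  obtains R where "is_inverse_op S R"
proof -
  obtain n \<phi> f U G where d: "\<forall>i<n. vfunctional (\<phi> i)" "is_inverse_op U G" "clinear_op U" "S = U + finite_rank n \<phi> f"
    by (rule weyl_decompose[OF assms(1,2)]) blast
  have "sq_det n (perturbation_matrix G \<phi> f) \<noteq> 0"
    using perturbation_not_surjective[OF d(1-3)] surj unfolding d(4) by blast
  then obtain R where "is_inverse_op (U + finite_rank n \<phi> f) R"
    by (rule perturbation_invertible[OF d(1-3)])
  then show thesis using that unfolding d(4) by blast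
qed

lemma inverse_near_preimages:
  fixes S V R :: "'a \<Rightarrow>\<^sub>L 'a"
  assumes V: "is_inverse_op V R" and C: "C > 0" "\<And>x. norm x \<le> 2 * C * norm (V x)"
    and near: "norm (S - V) < 1 / (4 * C)"
  obtains R' where "is_inverse_op S R'"
proof -
  have "norm R \<le> 2 * C"
    using C(1) C(2)[of "R _"] by (intro norm_blinfun_bound) (simp_all add: is_inverse_op_apply[OF V])
  then have "norm (S - V) * norm R \<le> 1 / (4 * C) * (2 * C)" using near C(1) by (intro mult_mono) auto
  also have "\<dots> < 1" using C(1) by simp
  finally have small: "norm (S - V) * norm R < 1" .
  obtain R' where "is_inverse_op S R'" by (rule inverse_op_perturb[OF V small])
  then show thesis by (rule that)
qed

text \<open>An injective operator with closed range is bounded below, and so is every sufficiently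
  close \<open>V\<close>, with \<open>2 * C\<close> in place of \<open>C\<close>. A Weyl operator
  that is bounded below is invertible, and \<open>S\<close> is close enough to \<open>V\<close> to
  inherit this, because \<open>1 / (4 * C) * (2 * C) < 1\<close>.\<close>

lemma weyl_closure_injective:
  assumes S: "clinear_op S" "closed (range S)" "\<And>x. S x = 0 \<Longrightarrow> x = 0"
    and near: "\<And>e. e > 0 \<Longrightarrow> \<exists>V. clinear_op V \<and> weyl V \<and> norm (S - V) < e"
  shows "weyl S"
proof -
  obtain C where C: "C > 0" "\<And>y. y \<in> range S \<Longrightarrow> \<exists>x. S x = y \<and> norm x \<le> C * norm y"
    using closed_range_bounded_preimages[OF S(2)] by blast
  have bb: "norm x \<le> C * norm (S x)" for x
  proof -
    obtain x' where x': "S x' = S x" "norm x' \<le> C * norm (S x)" using C(2)[of "S x"] by auto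
    have "x' - x = 0" by (rule S(3)) (simp add: blinfun.diff_right x'(1))
    then have "x' = x" by simp
    then show ?thesis using x'(2) by blast
  qed
  obtain V where V: "clinear_op V" "weyl V" "norm (S - V) < 1 / (4 * C)" using near[of "1 / (4 * C)"] C(1) by auto
  have bV: "norm x \<le> 2 * C * norm (V x)" for x
  proof -
    have "norm (S x) \<le> norm (V x) + norm ((S - V) x)"
      using norm_triangle_ineq[of "V x" "(S - V) x"] by (simp add: blinfun.diff_left)
    also have "norm ((S - V) x) \<le> 1 / (4 * C) * norm x"
      using V(3) by (intro order_trans[OF norm_blinfun] mult_right_mono) auto
    finally have "C * norm (S x) \<le> C * (norm (V x) + 1 / (4 * C) * norm x)" using C(1) by (simp add: mult_left_mono)
    also have "\<dots> = C * norm (V x) + norm x / 4" using C(1) by (simp add: distrib_left)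
    finally have "norm x \<le> C * norm (V x) + norm x / 4" using bb[of x] by linarith
    moreover have "0 \<le> C * norm (V x)" using C(1) by simp
    ultimately show ?thesis by simp
  qed
  have "x = 0" if "V x = 0" for x using bV[of x] that by simp
  then obtain R where R: "is_inverse_op V R" by (rule weyl_injective[OF V(2,1)])
  obtain R' where "is_inverse_op S R'" by (rule inverse_near_preimages[OF R C(1) bV V(3)])
  then show ?thesis by (rule weyl_inverse)
qed

text \<open>The dual argument: bounded preimages under \<open>S\<close> are approximate preimages
  under a close \<open>V\<close>, hence \<open>V\<close> is surjective and, being Weyl, invertible;
  \<open>S\<close> lies within the stability radius of \<open>V\<close>.\<close>

lemma weyl_closure_surjective:
  assumes S: "clinear_op S" "surj S"
    and near: "\<And>e. e > 0 \<Longrightarrow> \<exists>V. clinear_op V \<and> weyl V \<and> norm (S - V) < e"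
  shows "weyl S"
proof -
  obtain C where C: "C > 0" "\<And>y. \<exists>x. S x = y \<and> norm x \<le> C * norm y"
    using closed_range_bounded_preimages[of S] S(2) by auto
  obtain V where V: "clinear_op V" "weyl V" "norm (S - V) < 1 / (4 * C)" using near[of "1 / (4 * C)"] C(1) by auto
  have pre: "\<exists>x. V x = y \<and> norm x \<le> 2 * C * norm y" for y
  proof (rule approximate_preimages_exact[where S=UNIV])
    fix y
    obtain x where x: "S x = y" "norm x \<le> C * norm y" using C(2) by blast
    have "norm (y - V x) = norm ((S - V) x)" by (simp add: blinfun.diff_left x(1))
    also have "\<dots> \<le> 1 / (4 * C) * (C * norm y)"
      using V(3) x(2) C(1) by (intro order_trans[OF norm_blinfun] mult_mono) auto
    also have "\<dots> = norm y / 4" using C(1) by simp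
    also have "\<dots> \<le> norm y / 2" by simp
    finally show "\<exists>x. norm x \<le> C * norm y \<and> norm (y - V x) \<le> norm y / 2 \<and> y - V x \<in> UNIV" using x(2) by blast
  qed (use C(1) in auto)
  then have "surj V" unfolding surj_def by metis
  then obtain R where R: "is_inverse_op V R" by (rule weyl_surjective[OF V(2,1)])
  have bV: "norm x \<le> 2 * C * norm (V x)" for x
  proof -
    obtain x' where x': "V x' = V x" "norm x' \<le> 2 * C * norm (V x)" using pre by blast
    have "x' = x" using arg_cong[OF x'(1), of R] by (simp add: is_inverse_op_apply[OF R])
    then show ?thesis using x'(2) by simp
  qed
  obtain R' where "is_inverse_op S R'" by (rule inverse_near_preimages[OF R C(1) bV V(3)])
  then show ?thesis by (rule weyl_inverse)
qed

text \<open>A rank-one perturbation \<open>S + \<phi> \<otimes> c\<close> with \<open>\<phi> u = 1\<close> for a \<open>u\<close> in the kernel and \<open>c\<close> outside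
  the range lowers both the dimension of the kernel and the codimension of the range, and hence
  reduces to the injective or the surjective case.\<close>

lemma weyl_closure:
  assumes "clinear_op S" "closed (range S)"
    and "\<And>B. B \<subseteq> {x. S x = 0} \<Longrightarrow> independent B \<Longrightarrow> finite B \<and> card B \<le> k"
    and "\<And>e. e > 0 \<Longrightarrow> \<exists>V. clinear_op V \<and> weyl V \<and> norm (S - V) < e"
  shows "weyl S"
  using assms
proof (induction k arbitrary: S)
  case 0
  have "x = 0" if "S x = 0" for x
  proof (rule ccontr)
    assume "x \<noteq> 0"
    then have "independent {x}" by simp
    then show False using 0(3)[of "{x}"] that by simp
  qed
  then show ?case by (rule weyl_closure_injective[OF 0(1,2) _ 0(4)])
next
  case (Suc k)
  show ?case
  proof (cases "surj S \<or> (\<forall>x. S x = 0 \<longrightarrow> x = 0)")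
    case True
    then show ?thesis
      using weyl_closure_injective[OF Suc.prems(1,2) _ Suc.prems(4)] weyl_closure_surjective[OF Suc.prems(1) _ Suc.prems(4)]
      by blast
  next
    case False
    then obtain u c where u: "S u = 0" "u \<noteq> 0" and c: "c \<notin> range S" unfolding surj_def by blast
    have "J x \<in> {0}" if "x \<in> {0}" for x using that by (simp add: blinfun.zero_right)
    from vfunctional_separates[OF subspace_single_0 closed_singleton this, of u] u(2)
    obtain \<phi> where \<phi>: "vfunctional \<phi>" "\<phi> u = 1" by blast
    have sub: "subspace (range S)"
      by (rule linear_subspace_image[OF blinfun.bounded_linear_right[THEN bounded_linear.linear] subspace_UNIV])
    have Jr: "J x \<in> range S" if "x \<in> range S" for x
    proof -
      obtain x' where "x = S x'" using \<open>x \<in> range S\<close> by blast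
      then have "J x = S (J x')" using Suc.prems(1) by (simp add: clinear_op_def)
      then show ?thesis by simp
    qed
    have "\<exists>\<psi>. vfunctional \<psi> \<and> (\<forall>x. \<psi> (S x) = 0) \<and> \<psi> c = 1"
    proof (rule vfunctional_separates[OF sub Suc.prems(2) Jr c])
      fix \<psi> assume "vfunctional \<psi>" "\<And>x. x \<in> range S \<Longrightarrow> \<psi> x = 0" "\<psi> c = 1"
      then show ?thesis by (intro exI[of _ \<psi>]) simp
    qed
    then obtain \<psi> where "vfunctional \<psi>" "\<forall>x. \<psi> (S x) = 0" "\<psi> c = 1" by blast
    note \<psi> = this(1) this(2)[rule_format] this(3)
    define S1 where "S1 = S + rank_one \<phi> c"
    have S1: "S1 x = S x + sc (\<phi> x) c" for x by (simp add: S1_def blinfun.add_left rank_one_apply \<phi>)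
    have "weyl S1"
    proof (rule Suc.IH)
      show "clinear_op S1" unfolding S1_def by (intro clinear_op_add clinear_op_rank_one Suc.prems(1) \<phi>(1))
      \<comment> \<open>\<open>\<psi>\<close> reads off from \<open>S1 x\<close> the coefficient of
        \<open>c\<close>, so the new range is the preimage of the old one under a continuous map and
        therefore closed.\<close>
      have "range S1 = (\<lambda>y. y - sc (\<psi> y) c) -` range S"
      proof (intro equalityI subsetI)
        fix y assume "y \<in> range S1"
        then obtain x where "y = S1 x" by blast
        then have "y - sc (\<psi> y) c = S x"
          by (simp add: S1 vfunctional_add[OF \<psi>(1)] vfunctional_sc[OF \<psi>(1)] \<psi>(2,3))
        then show "y \<in> (\<lambda>y. y - sc (\<psi> y) c) -` range S" by auto
      next
        fix y assume "y \<in> (\<lambda>y. y - sc (\<psi> y) c) -` range S"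
        then obtain x where x: "y - sc (\<psi> y) c = S x" by auto
        \<comment> \<open>Moving along the kernel vector \<open>u\<close> adjusts the value of
          \<open>\<phi>\<close> to \<open>\<psi> y\<close> without changing
          \<open>S x\<close>.\<close>
        have "S1 (x + sc (\<psi> y - \<phi> x) u) = S x + sc (\<psi> y) c"
          by (simp add: S1 blinfun.add_right clinear_op_sc[OF Suc.prems(1)] u(1) blinfun.zero_right
              vfunctional_add[OF \<phi>(1)] vfunctional_sc[OF \<phi>(1)] \<phi>(2)
              sc_diff blinfun.diff_left blinfun.diff_right vfunctional_diff[OF \<phi>(1)])
        also have "\<dots> = y" using x by (simp add: algebra_simps)
        finally show "y \<in> range S1" by (metis rangeI)
      qed
      moreover have "closed ((\<lambda>y. y - sc (\<psi> y) c) -` range S)"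
      proof (rule continuous_closed_vimage[OF Suc.prems(2)])
        have "bounded_linear (\<lambda>y. y - sc (\<psi> y) c)"
          by (rule bounded_linear_sub[OF bounded_linear_ident bounded_linear_compose[OF bounded_linear_compose[OF
             blinfun.bounded_linear_left bounded_linear_sc]]]) (use \<psi>(1) in \<open>simp add: vfunctional_def\<close>)
        then show "isCont (\<lambda>y. y - sc (\<psi> y) c) x" for x by (rule linear_continuous_at)
      qed
      ultimately show "closed (range S1)" by simp
    next
      fix B assume B: "B \<subseteq> {x. S1 x = 0}" "independent B"
      have ker: "\<phi> x = 0 \<and> S x = 0" if "S1 x = 0" for x
      proof -
        have "\<psi> (S1 x) = \<phi> x" unfolding S1 by (simp add: vfunctional_add[OF \<psi>(1)] vfunctional_sc[OF \<psi>(1)] \<psi>(2,3))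
        then have "\<phi> x = 0" using that vfunctional_zero[OF \<psi>(1)] by simp
        moreover have "S x = 0" using that calculation by (simp add: S1 sc_zero)
        ultimately show ?thesis by blast
      qed
      have "span B \<subseteq> {x. \<phi> x = 0}"
      proof (rule span_minimal)
        show "B \<subseteq> {x. \<phi> x = 0}" using ker B(1) by blast
        show "subspace {x. \<phi> x = 0}"
          using \<phi>(1) unfolding vfunctional_def by (intro linear_subspace_kernel) (auto intro: bounded_linear.linear)
      qed
      \<comment> \<open>\<open>u\<close> is lost from the kernel, since \<open>\<phi> u = 1\<close>
        while \<open>\<phi>\<close> vanishes on the kernel of \<open>S1\<close>. Adjoining it to
        \<open>B\<close> gives an independent set in the kernel of \<open>S\<close> with one more
        element.\<close>
      then have "u \<notin> span B" using \<phi>(2) by auto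
      then have "independent (insert u B)" "u \<notin> B" using B(2) by (auto simp: independent_insert span_base)
      moreover have "insert u B \<subseteq> {x. S x = 0}" using u(1) ker B(1) by blast
      ultimately have "finite (insert u B) \<and> card (insert u B) \<le> Suc k" by (intro Suc.prems(3))
      then show "finite B \<and> card B \<le> k" using \<open>u \<notin> B\<close> card_insert_disjoint[of B u] by auto
    next
      fix e :: real assume "e > 0"
      then obtain V where V: "clinear_op V" "weyl V" "norm (S - V) < e" using Suc.prems(4) by blast
      then show "\<exists>V. clinear_op V \<and> weyl V \<and> norm (S1 - V) < e"
        by (intro exI[of _ "V + rank_one \<phi> c"])
          (simp add: S1_def clinear_op_add clinear_op_rank_one weyl_add_rank_one \<phi>(1))
    qed
    then show ?thesis unfolding S1_def using weyl_add_rank_one[OF \<phi>(1)] by blast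
  qed
qed

section \<open>Index zero and isolated spectrum along the imaginary axis\<close>

lemma weyl_open:
  assumes "weyl S"
  shows "\<exists>e>0. \<forall>S'. norm (S' - S) < e \<longrightarrow> weyl S'"
proof -
  obtain n \<phi> f R where nf: "\<forall>i<n. vfunctional (\<phi> i)" "is_inverse_op (S + finite_rank n \<phi> f) R"
    by (rule weylE[OF assms(1)]) blast
  show ?thesis
  proof (intro exI[of _ "1 / (norm R + 1)"] conjI allI impI)
    show "0 < 1 / (norm R + 1)" by (simp add: add_nonneg_pos)
    fix S' assume S': "norm (S' - S) < 1 / (norm R + 1)"
    have small: "norm ((S' + finite_rank n \<phi> f) - (S + finite_rank n \<phi> f)) * norm R < 1"
    proof -
      have "norm (S' - S) * norm R \<le> norm (S' - S) * (norm R + 1)" by (simp add: mult_left_mono)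
      also have "\<dots> < 1" using S' by (simp add: pos_less_divide_eq add_nonneg_pos)
      finally show ?thesis by simp
    qed
    obtain R' where "is_inverse_op (S' + finite_rank n \<phi> f) R'" by (rule inverse_op_perturb[OF nf(2) small])
    then show "weyl S'" by (rule weylI[OF nf(1)])
  qed
qed

text \<open>Mediates between \<open>T - \<lambda>\<close> in the notion of essential hyperbolicity
  and \<open>\<lambda> - T\<close> in the resolvent.\<close>

lemma fredholm_uminus:
  fixes S :: "'a \<Rightarrow>\<^sub>L 'a"
  shows "fredholm (- S) \<longleftrightarrow> fredholm S"
proof -
  have imp: "fredholm (- S)" if "fredholm S" for S :: "'a \<Rightarrow>\<^sub>L 'a"
  proof -
    have r: "range (- S) = range S"
    proof (intro equalityI subsetI)
      show "y \<in> range S" if "y \<in> range (- S)" for y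
        using that by (auto simp: blinfun.minus_left simp flip: blinfun.minus_right)
      show "y \<in> range (- S)" if y: "y \<in> range S" for y
      proof -
        obtain x where "y = S x" using y by blast
        then have "y = (- S) (- x)" by (simp add: blinfun.minus_left blinfun.minus_right)
        then show ?thesis by blast
      qed
    qed
    have "\<exists>x. y - (- S) x \<in> span B" if B: "\<forall>y. \<exists>x. y - S x \<in> span B" for y B
    proof -
      obtain x where "y - S x \<in> span B" using B by blast
      then have "y - (- S) (- x) \<in> span B" by (simp add: blinfun.minus_left blinfun.minus_right)
      then show ?thesis by blast
    qed
    then show ?thesis using that r unfolding fredholm_def by (simp add: blinfun.minus_left) blast
  qed
  show ?thesis using imp[of S] imp[of "- S"] by auto
qed

text \<open>The parameters with the Weyl property form an open set; it is closed by
  \<open>weyl_closure\<close>, where Fredholmness supplies the closed range and the bound on the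
  kernel; and it contains all large parameters, where the operator is invertible. The line is
  connected.\<close>

lemma fredholm_line_weyl:
  assumes T: "clinear_op T" and F: "\<And>y. fredholm (sc (\<i> * of_real y) - T)"
  shows "weyl (sc (\<i> * of_real y) - T)"
proof -
  define S where "S = (\<lambda>y::real. sc (\<i> * of_real y) - T)"
  have S: "clinear_op (S y)" for y unfolding S_def by (intro clinear_op_diff clinear_op_scalar T)
  have Sd: "norm (S y - S y') \<le> (1 + norm J) * \<bar>y - y'\<bar>" for y y'
  proof -
    have "S y - S y' = sc (\<i> * of_real (y - y'))" by (simp add: S_def algebra_simps sc_diff)
    then show ?thesis using norm_sc[of "\<i> * of_real (y - y')"] by (simp add: norm_mult del: of_real_diff)
  qed
  have J1: "1 + norm J > 0" by (simp add: add_pos_nonneg)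
  let ?W = "{y. weyl (S y)}"
  have "open ?W"
    unfolding open_dist
  proof clarify
    fix y assume "weyl (S y)"
    then obtain e where e: "e > 0" "\<And>S'. norm (S' - S y) < e \<Longrightarrow> weyl S'" using weyl_open by blast
    show "\<exists>e>0. \<forall>y'. dist y' y < e \<longrightarrow> y' \<in> ?W"
    proof (intro exI[of _ "e / (1 + norm J)"] conjI allI impI)
      show "0 < e / (1 + norm J)" using e J1 by simp
      fix y' assume "dist y' y < e / (1 + norm J)"
      then have "(1 + norm J) * \<bar>y' - y\<bar> < e" using J1 by (simp add: dist_real_def pos_less_divide_eq mult.commute)
      then show "y' \<in> ?W" using e(2) Sd[of y' y] by force
    qed
  qed
  moreover have "closed ?W"
  proof -
    have "y \<in> ?W" if y: "y \<in> closure ?W" for y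
    proof -
      obtain B where B: "finite B" "{x. S y x = 0} \<subseteq> span B" and cl: "closed (range (S y))"
        using F[of y] unfolding fredholm_def S_def by blast
      have "weyl (S y)"
      proof (rule weyl_closure[OF S cl])
        show "finite C \<and> card C \<le> card B" if "C \<subseteq> {x. S y x = 0}" "independent C" for C
          using independent_span_bound[OF B(1) that(2)] that(1) B(2) by blast
        fix e :: real assume e: "e > 0"
        then obtain y' where y': "weyl (S y')" "dist y' y < e / (1 + norm J)"
          using y J1 unfolding closure_approachable by (metis divide_pos_pos mem_Collect_eq)
        have "(1 + norm J) * \<bar>y - y'\<bar> < e"
          using y'(2) J1 by (simp add: dist_real_def pos_less_divide_eq mult.commute abs_minus_commute)
        then show "\<exists>V. clinear_op V \<and> weyl V \<and> norm (S y - V) < e"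
          using y'(1) S Sd[of y y'] by (intro exI[of _ "S y'"]) auto
      qed
      then show ?thesis by simp
    qed
    then have "closure ?W \<subseteq> ?W" by blast
    then show ?thesis by (simp add: closure_subset_eq)
  qed
  moreover have "?W \<noteq> {}"
  proof -
    define y where "y = (1 + norm J) * norm T + 1"
    have "y \<ge> 1" using J1 by (simp add: y_def)
    then have "cmod (\<i> * of_real y) = y" by (simp add: norm_mult)
    then have "cmod (\<i> * of_real y) > (1 + norm J) * norm T" by (simp add: y_def)
    from resolvent_inverse[OF resolvent_large(1)[OF this]] have "weyl (S y)" unfolding S_def by (rule weyl_inverse)
    then show ?thesis by blast
  qed
  ultimately have "?W = UNIV" using clopen[of ?W] by metis
  then show ?thesis unfolding S_def by auto
qed

text \<open>With the finite-rank correction for \<open>z0\<close> kept fixed, \<open>D\<close> is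
  holomorphic near \<open>z0\<close> and its zeros there are exactly the spectral points of
  \<open>T\<close>. The two alternatives are those of the identity theorem.\<close>

lemma weyl_isolated:
  assumes T: "clinear_op T" and w: "weyl (sc z0 - T)"
  shows "\<exists>e>0. ball z0 e \<subseteq> spectrum_wrt J T \<or> ball z0 e - {z0} \<subseteq> - spectrum_wrt J T"
proof -
  have S: "clinear_op (sc z - T)" for z by (intro clinear_op_diff clinear_op_scalar T)
  obtain n \<phi> f R where nf: "\<forall>i<n. vfunctional (\<phi> i)" "is_inverse_op (sc z0 - T + finite_rank n \<phi> f) R"
    by (rule weylE[OF w]) blast
  define T1 where "T1 = T - finite_rank n \<phi> f"
  have T1: "clinear_op T1" unfolding T1_def by (intro clinear_op_diff T clinear_op_finite_rank) (use nf(1) in blast)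
  have "z0 \<notin> spectrum_wrt J T1"
    using nf(2) unfolding spectrum_wrt_def T1_def by (auto simp: algebra_simps)
  then obtain e where e: "e > 0" "ball z0 e \<subseteq> - spectrum_wrt J T1"
    using closed_spectrum[of T1] by (metis ComplI closed_def open_contains_ball)
  define G where "G = resolvent_wrt J T1"
  have G: "is_inverse_op (sc z - T1) (G z)" if "z \<in> ball z0 e" for z
    unfolding G_def using e(2) that by (intro resolvent_inverse) auto
  define \<phi>' where "\<phi>' = (\<lambda>i x. - \<phi> i x)"
  have \<phi>': "\<forall>i<n. vfunctional (\<phi>' i)" unfolding \<phi>'_def using vfunctional_neg nf(1) by blast
  have dec: "sc z - T = (sc z - T1) + finite_rank n \<phi>' f" for z
    using finite_rank_neg[of n \<phi> f] nf(1) by (simp add: \<phi>'_def T1_def)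
  define D where "D = (\<lambda>z. sq_det n (perturbation_matrix (G z) \<phi>' f))"
  have D: "z \<in> spectrum_wrt J T \<longleftrightarrow> D z = 0" if z: "z \<in> ball z0 e" for z
  proof
    have U: "clinear_op (sc z - T1)" by (intro clinear_op_diff clinear_op_scalar T1)
    show "D z = 0" if zs: "z \<in> spectrum_wrt J T"
    proof (rule ccontr)
      assume "D z \<noteq> 0"
      then have ne: "sq_det n (perturbation_matrix (G z) \<phi>' f) \<noteq> 0" by (simp add: D_def)
      obtain R where "is_inverse_op ((sc z - T1) + finite_rank n \<phi>' f) R"
        by (rule perturbation_invertible[OF \<phi>' G[OF z] U ne])
      then show False using zs unfolding dec[symmetric] spectrum_wrt_def by blast
    qed
    show "z \<in> spectrum_wrt J T" if Dz: "D z = 0"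
    proof -
      from Dz have eq0: "sq_det n (perturbation_matrix (G z) \<phi>' f) = 0" by (simp add: D_def)
      obtain x where "x \<noteq> 0" "((sc z - T1) + finite_rank n \<phi>' f) x = 0"
        by (rule perturbation_not_injective[OF \<phi>' G[OF z] U eq0])
      then have x: "x \<noteq> 0" "(sc z - T) x = 0" unfolding dec[symmetric] by blast+
      have False if "is_inverse_op (sc z - T) R" for R
        using is_inverse_op_apply(2)[OF that, of x] x by (simp add: blinfun.zero_right)
      then show ?thesis unfolding spectrum_wrt_def by blast
    qed
  qed
  have "(\<lambda>z. \<phi>' i (G z (f j))) holomorphic_on ball z0 e" if "i < n" for i j
  proof -
    have bl: "bounded_linear (\<phi>' i)" and hom: "\<And>x. \<phi>' i (J x) = \<i> * \<phi>' i x"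
      using \<phi>' that by (auto simp: vfunctional_def)
    have "functional (\<lambda>X. \<phi>' i (X (f j)))"
      unfolding functional_def by (simp add: hom bounded_linear_compose[OF bl blinfun.bounded_linear_left])
    from holomorphic_resolvent[OF T1 this] show ?thesis
      unfolding G_def by (rule holomorphic_on_subset) (rule e(2))
  qed
  then have hol: "D holomorphic_on ball z0 e"
    unfolding D_def perturbation_matrix_def by (intro holomorphic_on_sq_det holomorphic_intros)
  show ?thesis
  proof (cases "\<forall>z\<in>ball z0 e. D z = 0")
    case True then show ?thesis using D e(1) by blast
  next
    case False
    then obtain b where b: "b \<in> ball z0 e" "D b \<noteq> 0" by blast
    have "\<exists>r>0. ball z0 r \<subseteq> ball z0 e \<and> (\<forall>z\<in>ball z0 r - {z0}. D z \<noteq> 0)"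
    proof (cases "D z0 = 0")
      case True
      obtain r where "0 < r" "ball z0 r \<subseteq> ball z0 e" "\<And>z. z \<in> ball z0 r - {z0} \<Longrightarrow> D z \<noteq> 0"
        using isolated_zeros[OF hol open_ball connected_ball _ True b] e(1) by (metis centre_in_ball)
      then show ?thesis by blast
    next
      case False
      obtain r where "0 < r" "\<forall>y. dist z0 y < r \<longrightarrow> D y \<noteq> 0"
        using continuous_at_avoid[of z0 D 0] holomorphic_on_imp_continuous_on[OF hol] False e(1)
        by (metis centre_in_ball continuous_on_eq_continuous_at open_ball)
      then show ?thesis using e(1) by (intro exI[of _ "min r e"]) auto
    qed
    then obtain r where r: "r > 0" "ball z0 r \<subseteq> ball z0 e" "\<And>z. z \<in> ball z0 r - {z0} \<Longrightarrow> D z \<noteq> 0" by blast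
    then have "ball z0 r - {z0} \<subseteq> - spectrum_wrt J T" using D by blast
    then show ?thesis using r(1) by blast
  qed
qed

text \<open>Both alternatives of \<open>weyl_isolated\<close> are open conditions on
  \<open>y\<close> and exclude each other. If a whole disc of spectrum occurred at one point, it
  would occur along the entire axis, but far out there is no spectrum.\<close>

lemma fredholm_line_isolated:
  assumes T: "clinear_op T" and F: "\<And>y. fredholm (sc (\<i> * of_real y) - T)"
  shows "\<exists>e>0. ball (\<i> * of_real y) e - {\<i> * of_real y} \<subseteq> - spectrum_wrt J T"
proof -
  let ?V = "{y. \<exists>e>0. ball (\<i> * of_real y) e \<subseteq> spectrum_wrt J T}"
  have d: "dist (\<i> * of_real y) (\<i> * of_real y') = dist y y'" for y y' :: real
    by (simp add: dist_norm norm_mult flip: right_diff_distrib of_real_diff)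
  have iso: "\<exists>e>0. ball (\<i> * of_real y) e \<subseteq> spectrum_wrt J T \<or> ball (\<i> * of_real y) e - {\<i> * of_real y} \<subseteq> - spectrum_wrt J T" for y
    by (rule weyl_isolated[OF T fredholm_line_weyl[OF T F]])
  have "open ?V"
    unfolding open_dist
  proof clarify
    fix y :: real and e assume e: "e > 0" "ball (\<i> * of_real y) e \<subseteq> spectrum_wrt J T"
    have "ball (\<i> * of_real y') (e/2) \<subseteq> ball (\<i> * of_real y) e" if "dist y' y < e/2" for y'
      using that d[of y y'] by (intro ball_subset_ball_iff[THEN iffD2]) (auto simp: dist_commute)
    then show "\<exists>e>0. \<forall>y'. dist y' y < e \<longrightarrow> y' \<in> ?V"
      using e by (intro exI[of _ "e/2"]) (auto intro!: exI[of _ "e/2"])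
  qed
  moreover have "open (- ?V)"
    unfolding open_dist
  proof
    fix y assume "y \<in> - ?V"
    then obtain e where e: "e > 0" "ball (\<i> * of_real y) e - {\<i> * of_real y} \<subseteq> - spectrum_wrt J T" using iso[of y] by auto
    have "y' \<in> - ?V" if y': "dist y' y < e" for y'
    proof (cases "y' = y")
      case True then show ?thesis using \<open>y \<in> - ?V\<close> by simp
    next
      case False
      then have "\<i> * of_real y' \<in> - spectrum_wrt J T"
        using y' d[of y y'] by (intro subsetD[OF e(2)]) (auto simp: dist_commute)
      then show ?thesis by force
    qed
    then show "\<exists>e>0. \<forall>y'. dist y' y < e \<longrightarrow> y' \<in> - ?V" using e(1) by blast
  qed
  then have "closed ?V" by (simp add: closed_def)
  moreover have "?V \<noteq> UNIV"
  proof -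
    define y where "y = (1 + norm J) * norm T + 1"
    have "y \<ge> 1" by (simp add: y_def add_nonneg_nonneg)
    then have "cmod (\<i> * of_real y) = y" by (simp add: norm_mult)
    then have "cmod (\<i> * of_real y) > (1 + norm J) * norm T" by (simp add: y_def)
    from resolvent_large(1)[OF this] have "y \<notin> ?V" by force
    then show ?thesis by blast
  qed
  ultimately have "?V = {}" using clopen[of ?V] by metis
  then show ?thesis using iso[of y] by auto
qed

end

section \<open>Riesz projectors\<close>

text \<open>The homotopy runs through the pencil spanned by the two circles: where both quadratic
  equations have the same sign, so does every convex combination. Interpolating centres and radii
  linearly could sweep over \<open>\<sigma>\<close>.\<close>

lemma homotopic_loops_circlepath_pencil:
  assumes r: "r0 > 0" "r1 > 0" and \<sigma>: "\<And>z. z \<in> \<sigma> \<Longrightarrow> (cmod (z - c0) < r0 \<and> cmod (z - c1) < r1) \<or> (cmod (z - c0) > r0 \<and> cmod (z - c1) > r1)"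
    and z0: "cmod (z0 - c0) < r0" "cmod (z0 - c1) < r1"
  shows "homotopic_loops (- \<sigma>) (circlepath c0 r0) (circlepath c1 r1)"
proof -
  define c where "c = (\<lambda>s::real. (1 - s) *\<^sub>R c0 + s *\<^sub>R c1)"
  \<comment> \<open>The squared radius of the circle, with centre \<open>c s\<close>, on which the
    convex combination of the two quadratic equations vanishes.\<close>
  define \<rho> where "\<rho> = (\<lambda>s::real. (cmod (c s))\<^sup>2 - (1 - s) * ((cmod c0)\<^sup>2 - r0\<^sup>2) - s * ((cmod c1)\<^sup>2 - r1\<^sup>2))"
  have pencil: "(1 - s) * ((cmod (z - c0))\<^sup>2 - r0\<^sup>2) + s * ((cmod (z - c1))\<^sup>2 - r1\<^sup>2) = (cmod (z - c s))\<^sup>2 - \<rho> s" for s z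
    unfolding \<rho>_def c_def cmod_power2 by (simp add: power2_eq_square algebra_simps)
  have sq: "(cmod a)\<^sup>2 < r\<^sup>2 \<longleftrightarrow> cmod a < r" if "r > 0" for a r
    using that by (metis abs_norm_cancel abs_of_pos power2_less_eq_zero_iff abs_le_square_iff not_less)
  have sq': "r\<^sup>2 < (cmod a)\<^sup>2" if "r > 0" "r < cmod a" for a r
    using that by (simp add: power_strict_mono)
  have comb: "(1 - s) * a + s * b < 0" if "0 \<le> s" "s \<le> 1" "a < 0" "b < 0" for s a b :: real
  proof (cases "s = 0")
    case False
    with that have "s * b < 0" "(1 - s) * a \<le> 0" by (auto simp: mult_less_0_iff mult_le_0_iff)
    then show ?thesis by simp
  qed (use that in simp)
  \<comment> \<open>The common interior point \<open>z0\<close> lies inside every circle of the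
    pencil, so none of them degenerates.\<close>
  have \<rho>pos: "\<rho> s > 0" if s: "0 \<le> s" "s \<le> 1" for s
  proof -
    have "(cmod (z0 - c s))\<^sup>2 - \<rho> s < 0"
      unfolding pencil[symmetric] using z0 r sq by (intro comb s) auto
    then show ?thesis using zero_le_power2[of "cmod (z0 - c s)"] by linarith
  qed
  have avoid: "(cmod (z - c s))\<^sup>2 \<noteq> \<rho> s" if s: "0 \<le> s" "s \<le> 1" and z: "z \<in> \<sigma>" for s z
    using \<sigma>[OF z]
  proof
    assume "cmod (z - c0) < r0 \<and> cmod (z - c1) < r1"
    then have "(cmod (z - c s))\<^sup>2 - \<rho> s < 0" unfolding pencil[symmetric] using r sq by (intro comb s) auto
    then show ?thesis by simp
  next
    assume "cmod (z - c0) > r0 \<and> cmod (z - c1) > r1"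
    then have "(1 - s) * (- ((cmod (z - c0))\<^sup>2 - r0\<^sup>2)) + s * (- ((cmod (z - c1))\<^sup>2 - r1\<^sup>2)) < 0"
      using r sq' by (intro comb s) auto
    then have "- ((cmod (z - c s))\<^sup>2 - \<rho> s) < 0"
      unfolding pencil[symmetric] by (simp only: mult_minus_right minus_add_distrib)
    then show ?thesis by simp
  qed
  define h where "h = (\<lambda>(s, t). c s + complex_of_real (sqrt (\<rho> s)) * exp (2 * of_real pi * \<i> * complex_of_real t))"
  show ?thesis
    unfolding homotopic_loops
  proof (intro exI[of _ h] conjI ballI)
    show "continuous_on ({0..1} \<times> {0..1}) h"
      unfolding h_def case_prod_unfold c_def \<rho>_def by (intro continuous_intros)
    show "h \<in> {0..1} \<times> {0..1} \<rightarrow> - \<sigma>"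
    proof
      fix p :: "real \<times> real" assume "p \<in> {0..1} \<times> {0..1}"
      then obtain s t where p: "p = (s, t)" "0 \<le> s" "s \<le> 1" by auto
      have "cmod (h p - c s) = sqrt (\<rho> s)"
        using \<rho>pos[OF p(2,3)] by (simp add: h_def p(1) norm_mult)
      then have "(cmod (h p - c s))\<^sup>2 = \<rho> s" using \<rho>pos[OF p(2,3)] by simp
      then show "h p \<in> - \<sigma>" using avoid[OF p(2,3)] by blast
    qed
    have "\<rho> 0 = r0\<^sup>2" "\<rho> 1 = r1\<^sup>2" by (simp_all add: \<rho>_def c_def)
    then show "h (0, x) = circlepath c0 r0 x" "h (1, x) = circlepath c1 r1 x" for x
      using r by (simp_all add: h_def c_def circlepath)
    show "pathfinish (h \<circ> Pair t) = pathstart (h \<circ> Pair t)" for t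
      by (simp add: h_def pathfinish_def pathstart_def exp_eq_1)
  qed
qed

text \<open>For nested discs, segments joining points of equal angle stay outside the inner open
  disc and inside the outer closed one. This homotopy needs control only of the region between the
  circles.\<close>

lemma homotopic_loops_circlepath_nested:
  assumes "r0 > 0" and nest: "cmod (c1 - c0) + r0 \<le> r1"
    and \<Omega>: "\<And>z. cmod (z - c0) \<ge> r0 \<Longrightarrow> cmod (z - c1) \<le> r1 \<Longrightarrow> z \<in> \<Omega>"
  shows "homotopic_loops \<Omega> (circlepath c0 r0) (circlepath c1 r1)"
proof (rule homotopic_loops_linear)
  fix t :: real assume "t \<in> {0..1}"
  define e where "e = exp (2 * of_real pi * \<i> * complex_of_real t)"
  have e: "cmod e = 1" by (simp add: e_def)
  have r1: "r0 \<le> r1" using nest norm_ge_zero[of "c1 - c0"] by linarith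
  show "closed_segment (circlepath c0 r0 t) (circlepath c1 r1 t) \<subseteq> \<Omega>"
  proof
    fix z assume "z \<in> closed_segment (circlepath c0 r0 t) (circlepath c1 r1 t)"
    then obtain u where u: "0 \<le> u" "u \<le> 1"
      and z: "z = (1 - u) *\<^sub>R (c0 + of_real r0 * e) + u *\<^sub>R (c1 + of_real r1 * e)"
      by (auto simp: closed_segment_def circlepath e_def)
    have z0: "z - c0 = of_real ((1 - u) * r0 + u * r1) * e + of_real u * (c1 - c0)"
      unfolding z by (simp add: scaleR_conv_of_real algebra_simps)
    have "cmod (of_real ((1 - u) * r0 + u * r1) * e) = (1 - u) * r0 + u * r1"
      using u assms(1) r1 e by (simp add: norm_mult del: of_real_add of_real_mult)
    moreover have "cmod (of_real u * (c1 - c0)) = u * cmod (c1 - c0)" using u by (simp add: norm_mult)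
    ultimately have "cmod (z - c0) \<ge> (1 - u) * r0 + u * r1 - u * cmod (c1 - c0)"
      unfolding z0 using norm_diff_ineq[of "of_real ((1 - u) * r0 + u * r1) * e" "of_real u * (c1 - c0)"] by linarith
    also have "(1 - u) * r0 + u * r1 - u * cmod (c1 - c0) = r0 + u * (r1 - r0 - cmod (c1 - c0))" by (simp add: algebra_simps)
    finally have ge: "r0 \<le> cmod (z - c0)" using mult_nonneg_nonneg[OF u(1), of "r1 - r0 - cmod (c1 - c0)"] nest by linarith
    have z1: "z - c1 = of_real ((1 - u) * r0 + u * r1) * e + of_real (1 - u) * (c0 - c1)"
      unfolding z by (simp add: scaleR_conv_of_real algebra_simps)
    have "cmod (of_real ((1 - u) * r0 + u * r1) * e) = (1 - u) * r0 + u * r1"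
      using u assms(1) r1 e by (simp add: norm_mult del: of_real_add of_real_mult)
    moreover have "cmod (of_real (1 - u) * (c0 - c1)) = (1 - u) * cmod (c1 - c0)"
      using u by (simp add: norm_mult norm_minus_commute del: of_real_diff)
    ultimately have "cmod (z - c1) \<le> (1 - u) * r0 + u * r1 + (1 - u) * cmod (c1 - c0)"
      unfolding z1 using norm_triangle_ineq[of "of_real ((1 - u) * r0 + u * r1) * e" "of_real (1 - u) * (c0 - c1)"] by linarith
    also have "\<dots> = r1 - (1 - u) * (r1 - r0 - cmod (c1 - c0))" by (simp add: algebra_simps)
    finally have "cmod (z - c1) \<le> r1"
      using mult_nonneg_nonneg[of "1 - u" "r1 - r0 - cmod (c1 - c0)"] nest u by linarith
    with ge show "z \<in> \<Omega>" by (rule \<Omega>)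
  qed
qed auto

context complex_structure
begin

section \<open>Riesz projectors as contour integrals\<close>

definition riesz :: "('a \<Rightarrow>\<^sub>L 'a) \<Rightarrow> complex \<Rightarrow> real \<Rightarrow> 'a \<Rightarrow>\<^sub>L 'a" where
  "riesz T c r = sc (1 / (2 * of_real pi * \<i>)) \<circ>\<^sub>L op_contour_integral J (circlepath c r) (resolvent_wrt J T)"

lemma op_contour_integrand:
  assumes "continuous_on (sphere c r) F" "r \<ge> 0"
  shows "continuous_on {0..1} (\<lambda>t. sc (vector_derivative (circlepath c r) (at t within {0..1})) \<circ>\<^sub>L F (circlepath c r t))"
proof -
  have "continuous_on {0..1} (\<lambda>t. F (circlepath c r t))"
  proof (rule continuous_on_compose2[OF assms(1)])
    show "continuous_on {0..1} (circlepath c r)" using path_circlepath[of c r] by (simp add: path_def)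
    show "circlepath c r ` {0..1} \<subseteq> sphere c r"
      using path_image_circlepath_nonneg[OF assms(2), of c] by (simp add: path_image_def)
  qed
  moreover have "continuous_on {0..1} (\<lambda>t. sc (vector_derivative (circlepath c r) (at t within {0..1})))"
  proof -
    have "continuous_on {0..1} (\<lambda>t. sc (2 * of_real pi * \<i> * of_real r * exp (2 * of_real pi * \<i> * complex_of_real t)))"
      by (intro continuous_intros)
    then show ?thesis by (rule continuous_on_eq) (simp add: vector_derivative_circlepath01)
  qed
  ultimately show ?thesis
    by (intro bounded_bilinear.continuous_on[OF bounded_bilinear_blinfun_compose])
qed

lemma functional_op_contour_integral:
  assumes \<psi>: "functional \<psi>" and F: "continuous_on (sphere c r) F" "r \<ge> 0"
  shows "\<psi> (op_contour_integral J (circlepath c r) F) = contour_integral (circlepath c r) (\<lambda>z. \<psi> (F z))"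
proof -
  let ?g = "\<lambda>t. sc (vector_derivative (circlepath c r) (at t within {0..1})) \<circ>\<^sub>L F (circlepath c r t)"
  have bl: "bounded_linear \<psi>" using \<psi> by (simp add: functional_def)
  have int: "?g integrable_on {0..1}"
    using op_contour_integrand[OF F] by (rule integrable_continuous_interval)
  have "\<psi> (op_contour_integral J (circlepath c r) F) = integral {0..1} (\<psi> \<circ> ?g)"
    unfolding op_contour_integral_def by (rule integral_linear[OF int bl, symmetric])
  also have "\<dots> = integral {0..1} (\<lambda>t. \<psi> (F (circlepath c r t)) * vector_derivative (circlepath c r) (at t within {0..1}))"
    by (rule integral_cong) (simp add: functional_sc[OF \<psi>] mult.commute)
  \<comment> \<open>The derivative within the interval is replaced by the two-sided one, which is
    compared off the end points only.\<close>
  also have "\<dots> = integral {0..1} (\<lambda>t. \<psi> (F (circlepath c r t)) * vector_derivative (circlepath c r) (at t))"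
  proof (rule integral_spike[of "{0, 1}"])
    fix t :: real assume "t \<in> {0..1} - {0, 1}"
    then show "\<psi> (F (circlepath c r t)) * vector_derivative (circlepath c r) (at t) =
        \<psi> (F (circlepath c r t)) * vector_derivative (circlepath c r) (at t within {0..1})"
      by (simp add: vector_derivative_circlepath01 vector_derivative_circlepath)
  qed auto
  finally show ?thesis unfolding contour_integral_integral .
qed

lemma functional_riesz:
  assumes \<psi>: "functional \<psi>" and r: "r \<ge> 0" and av: "sphere c r \<inter> spectrum_wrt J T = {}"
  shows "\<psi> (riesz T c r) = 1 / (2 * of_real pi * \<i>) * contour_integral (circlepath c r) (\<lambda>z. \<psi> (resolvent_wrt J T z))"
  unfolding riesz_def functional_sc[OF \<psi>]
  by (subst functional_op_contour_integral[OF \<psi> _ r])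
    (use av in \<open>auto intro: continuous_on_subset[OF continuous_resolvent]\<close>)

lemma in_ideal_if_functionals:
  assumes "operator_ideal I" "\<And>\<psi>. functional \<psi> \<Longrightarrow> (\<forall>Y\<in>I. \<psi> Y = 0) \<Longrightarrow> \<psi> X = 0"
  shows "X \<in> I"
proof (rule ccontr)
  assume "X \<notin> I"
  then obtain \<psi> where "functional \<psi>" "\<And>Y. Y \<in> I \<Longrightarrow> \<psi> Y = 0" "\<psi> X \<noteq> 0"
    by (rule functional_separates[OF assms(1)]) blast
  then show False using assms(2) by blast
qed

lemma eq_if_functionals:
  assumes "\<And>\<psi>. functional \<psi> \<Longrightarrow> \<psi> X = \<psi> Y" shows "X = Y"
proof -
  have "X - Y \<in> {0}"
    by (rule in_ideal_if_functionals[OF operator_ideal_zero]) (simp add: functional_diff assms)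
  then show ?thesis by simp
qed

text \<open>On the two circles \<open>\<psi>\<close> does not distinguish the resolvent from the one
  modulo \<open>I\<close>, and the latter is holomorphic on a larger set. The homotopy may thus
  sweep over spectrum that is invisible modulo \<open>I\<close>.\<close>

lemma riesz_homotopic:
  assumes I: "operator_ideal I" and T: "clinear_op T"
    and av: "r0 > 0" "sphere c0 r0 \<inter> spectrum_wrt J T = {}" "r1 > 0" "sphere c1 r1 \<inter> spectrum_wrt J T = {}"
    and hom: "homotopic_loops (resolvent_set_mod I T) (circlepath c0 r0) (circlepath c1 r1)"
  shows "riesz T c0 r0 - riesz T c1 r1 \<in> I"
proof (rule in_ideal_if_functionals[OF I])
  fix \<psi> assume \<psi>: "functional \<psi>" "\<forall>Y\<in>I. \<psi> Y = 0"
  have val: "\<psi> (riesz T c r) = 1 / (2 * of_real pi * \<i>) * contour_integral (circlepath c r) (\<lambda>z. \<psi> (resolvent_mod I T z))"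
    if "r > 0" "sphere c r \<inter> spectrum_wrt J T = {}" for c r
  proof -
    have "contour_integral (circlepath c r) (\<lambda>z. \<psi> (resolvent_wrt J T z)) =
        contour_integral (circlepath c r) (\<lambda>z. \<psi> (resolvent_mod I T z))"
      using that \<psi> by (intro contour_integral_cong refl functional_eq_resolvent_mod[OF I]) auto
    then show ?thesis using functional_riesz[OF \<psi>(1) _ that(2)] that(1) by simp
  qed
  have "contour_integral (circlepath c0 r0) (\<lambda>z. \<psi> (resolvent_mod I T z)) =
      contour_integral (circlepath c1 r1) (\<lambda>z. \<psi> (resolvent_mod I T z))"
    using \<psi> by (intro Cauchy_theorem_homotopic_loops[OF hom open_resolvent_set_mod[OF I] holomorphic_resolvent_mod[OF I T]]) auto
  then show "\<psi> (riesz T c0 r0 - riesz T c1 r1) = 0"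
    by (simp add: functional_diff[OF \<psi>(1)] val av)
qed

lemma riesz_zero:
  assumes T: "clinear_op T" and r: "r > 0" and av: "cball c r \<inter> spectrum_wrt J T = {}"
  shows "riesz T c r = 0"
proof (rule eq_if_functionals)
  fix \<psi> assume \<psi>: "functional \<psi>"
  have "sphere c r \<inter> spectrum_wrt J T = {}" using av by auto
  moreover have "((\<lambda>z. \<psi> (resolvent_wrt J T z)) has_contour_integral 0) (circlepath c r)"
  proof (rule Cauchy_theorem_convex_simple[of _ "cball c r"])
    show "(\<lambda>z. \<psi> (resolvent_wrt J T z)) holomorphic_on cball c r"
      using av by (intro holomorphic_on_subset[OF holomorphic_resolvent[OF T \<psi>]]) auto
  qed (use r in auto)
  ultimately show "\<psi> (riesz T c r) = \<psi> 0"
    using functional_riesz[OF \<psi>] r by (simp add: functional_zero[OF \<psi>] contour_integral_unique)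
qed

text \<open>The pencil homotopy requires a point inside both discs. Any enclosed spectral point is
  one; without enclosed spectrum both integrals vanish by Cauchy's theorem.\<close>

lemma riesz_independent:
  assumes T: "clinear_op T"
    and av: "r0 > 0" "sphere c0 r0 \<inter> spectrum_wrt J T = {}" "r1 > 0" "sphere c1 r1 \<inter> spectrum_wrt J T = {}"
    and eq: "spectrum_wrt J T \<inter> ball c0 r0 = spectrum_wrt J T \<inter> ball c1 r1"
  shows "riesz T c0 r0 = riesz T c1 r1"
proof (cases "spectrum_wrt J T \<inter> ball c0 r0 = {}")
  case True
  have "cball c0 r0 \<inter> spectrum_wrt J T = {}" "cball c1 r1 \<inter> spectrum_wrt J T = {}"
    using True eq av by (auto simp: cball_def ball_def sphere_def order_le_less)
  then show ?thesis using riesz_zero[OF T] av by simp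
next
  case False
  then obtain z0 where "z0 \<in> spectrum_wrt J T \<inter> ball c0 r0" by blast
  then have z0: "z0 \<in> spectrum_wrt J T" "z0 \<in> ball c0 r0" "z0 \<in> ball c1 r1" using eq by blast+
  have "homotopic_loops (- spectrum_wrt J T) (circlepath c0 r0) (circlepath c1 r1)"
  proof (rule homotopic_loops_circlepath_pencil)
    show "cmod (z0 - c0) < r0" "cmod (z0 - c1) < r1" using z0 by (auto simp: dist_norm norm_minus_commute)
    fix z assume z: "z \<in> spectrum_wrt J T"
    then have "cmod (z - c0) \<noteq> r0" "cmod (z - c1) \<noteq> r1" using av by (auto simp: dist_norm norm_minus_commute)
    moreover have "cmod (z - c0) < r0 \<longleftrightarrow> cmod (z - c1) < r1"
      using eq z by (auto simp: dist_norm norm_minus_commute)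
    ultimately show "(cmod (z - c0) < r0 \<and> cmod (z - c1) < r1) \<or> (cmod (z - c0) > r0 \<and> cmod (z - c1) > r1)"
      by linarith
  qed (use av in auto)
  then have "riesz T c0 r0 - riesz T c1 r1 \<in> {0}"
    using av by (intro riesz_homotopic[OF operator_ideal_zero T]) (auto simp: resolvent_set_mod_zero)
  then show ?thesis by simp
qed

lemma spectral_projector_riesz:
  assumes T: "clinear_op T" and "r > 0" "sphere c r \<inter> spectrum_wrt J T = {}" "spectrum_wrt J T \<inter> ball c r = S"
  shows "spectral_projector_wrt J T S = riesz T c r"
  unfolding spectral_projector_wrt_def
proof (rule the_equality)
  show "\<exists>c' r'. 0 < r' \<and> spectrum_wrt J T \<inter> sphere c' r' = {} \<and> spectrum_wrt J T \<inter> ball c' r' = S \<and>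
      riesz T c r = sc (1 / (2 * of_real pi * \<i>)) \<circ>\<^sub>L op_contour_integral J (circlepath c' r') (resolvent_wrt J T)"
    using assms by (intro exI[of _ c] exI[of _ r]) (auto simp: riesz_def)
  fix P assume "\<exists>c' r'. 0 < r' \<and> spectrum_wrt J T \<inter> sphere c' r' = {} \<and> spectrum_wrt J T \<inter> ball c' r' = S \<and>
      P = sc (1 / (2 * of_real pi * \<i>)) \<circ>\<^sub>L op_contour_integral J (circlepath c' r') (resolvent_wrt J T)"
  then obtain c' r' where *: "0 < r'" "spectrum_wrt J T \<inter> sphere c' r' = {}" "spectrum_wrt J T \<inter> ball c' r' = S"
    "P = riesz T c' r'" unfolding riesz_def by blast
  have "sphere c' r' \<inter> spectrum_wrt J T = {}" using *(2) by blast
  then show "P = riesz T c r" unfolding *(4)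
    by (intro riesz_independent[OF T]) (use assms * in simp_all)
qed

text \<open>Products with a fixed operator are absorbed into the functional, so that identities
  between operators become scalar contour integrals. On the left, \<open>A\<close> has to commute
  with \<open>J\<close> to preserve complex linearity.\<close>

lemma functional_transform:
  assumes \<psi>: "functional \<psi>"
  shows "functional (\<lambda>Y. \<psi> (Y \<circ>\<^sub>L B))" and "clinear_op A \<Longrightarrow> functional (\<lambda>Y. \<psi> (A \<circ>\<^sub>L Y))"
proof -
  have bl: "bounded_linear \<psi>" and hom: "\<And>X. \<psi> (J \<circ>\<^sub>L X) = \<i> * \<psi> X" using \<psi> by (auto simp: functional_def)
  have "(J \<circ>\<^sub>L Y) \<circ>\<^sub>L B = J \<circ>\<^sub>L (Y \<circ>\<^sub>L B)" for Y by (rule blinfun_eqI) simp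
  then show "functional (\<lambda>Y. \<psi> (Y \<circ>\<^sub>L B))"
    unfolding functional_def
    by (simp add: hom bounded_linear_compose[OF bl bounded_bilinear.bounded_linear_left[OF bounded_bilinear_blinfun_compose]])
  have eq: "A \<circ>\<^sub>L (J \<circ>\<^sub>L Y) = J \<circ>\<^sub>L (A \<circ>\<^sub>L Y)" if "clinear_op A" for Y
    using that by (intro blinfun_eqI) (simp add: clinear_op_def)
  show "functional (\<lambda>Y. \<psi> (A \<circ>\<^sub>L Y))" if "clinear_op A"
    unfolding functional_def eq[OF that] hom
    by (intro conjI allI refl bounded_linear_compose[OF bl bounded_bilinear.bounded_linear_right[OF bounded_bilinear_blinfun_compose]])
qed

lemma functional_minus: "functional \<psi> \<Longrightarrow> functional \<theta> \<Longrightarrow> functional (\<lambda>Y. \<psi> Y - \<theta> Y)"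
  by (simp add: functional_def bounded_linear_sub right_diff_distrib)

text \<open>The functional \<open>Y \<mapsto> \<psi> (Y X) - \<psi> (X Y)\<close> vanishes at every
  resolvent on the circle, hence at their integral.\<close>

lemma riesz_commute_mod:
  assumes I: "operator_ideal I" and r: "r > 0" "sphere c r \<inter> spectrum_wrt J T = {}"
    and X: "clinear_op X" "T \<circ>\<^sub>L X - X \<circ>\<^sub>L T \<in> I"
  shows "riesz T c r \<circ>\<^sub>L X - X \<circ>\<^sub>L riesz T c r \<in> I"
proof (rule in_ideal_if_functionals[OF I])
  fix \<psi> assume \<psi>: "functional \<psi>" "\<forall>Y\<in>I. \<psi> Y = 0"
  let ?\<theta> = "\<lambda>Y. \<psi> (Y \<circ>\<^sub>L X) - \<psi> (X \<circ>\<^sub>L Y)"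
  have \<theta>: "functional ?\<theta>" by (intro functional_minus functional_transform \<psi>(1) X(1))
  have "?\<theta> (resolvent_wrt J T z) = 0" if "z \<in> sphere c r" for z
  proof -
    have z: "z \<notin> spectrum_wrt J T" using that r(2) by auto
    have "inverse_mod I (sc z - T) (resolvent_wrt J T z)" by (rule inverse_op_inverse_mod[OF I resolvent_inverse[OF z]])
    moreover have "(sc z - T) \<circ>\<^sub>L X - X \<circ>\<^sub>L (sc z - T) \<in> I"
    proof -
      have "(sc z - T) \<circ>\<^sub>L X - X \<circ>\<^sub>L (sc z - T) = 0 - (T \<circ>\<^sub>L X - X \<circ>\<^sub>L T)"
        by (rule blinfun_eqI) (simp add: op_simps clinear_op_sc[OF X(1)])
      then show ?thesis using operator_ideal_diff[OF I operator_ideal_0[OF I] X(2)] by simp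
    qed
    ultimately have "resolvent_wrt J T z \<circ>\<^sub>L X - X \<circ>\<^sub>L resolvent_wrt J T z \<in> I" by (rule inverse_mod_commute[OF I])
    then show ?thesis using \<psi> functional_diff[OF \<psi>(1)] by fastforce
  qed
  then have "contour_integral (circlepath c r) (\<lambda>z. ?\<theta> (resolvent_wrt J T z)) = 0"
    using r(1) by (intro contour_integral_eq_0) auto
  then have "?\<theta> (riesz T c r) = 0" using functional_riesz[OF \<theta> _ r(2)] r(1) by simp
  then show "\<psi> (riesz T c r \<circ>\<^sub>L X - X \<circ>\<^sub>L riesz T c r) = 0" by (simp add: functional_diff[OF \<psi>(1)])
qed

text \<open>Complex linearity is commutation with \<open>J\<close>, and \<open>J\<close> commutes
  with \<open>T\<close>.\<close>

lemma clinear_riesz: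
  assumes T: "clinear_op T" and r: "r > 0" "sphere c r \<inter> spectrum_wrt J T = {}"
  shows "clinear_op (riesz T c r)"
proof -
  have "T \<circ>\<^sub>L J - J \<circ>\<^sub>L T = 0" using T by (intro blinfun_eqI) (simp add: op_simps clinear_op_def)
  then have "T \<circ>\<^sub>L J - J \<circ>\<^sub>L T \<in> {0}" by simp
  moreover have "clinear_op J" by (simp add: clinear_op_def)
  ultimately have "riesz T c r \<circ>\<^sub>L J - J \<circ>\<^sub>L riesz T c r \<in> {0}"
    by (intro riesz_commute_mod[OF operator_ideal_zero r])
  then have "riesz T c r \<circ>\<^sub>L J = J \<circ>\<^sub>L riesz T c r" by simp
  then show ?thesis unfolding clinear_op_def by (metis blinfun_apply_blinfun_compose)
qed

lemma riesz_commute: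
  assumes r: "r > 0" "sphere c r \<inter> spectrum_wrt J T = {}" and X: "clinear_op X" "T \<circ>\<^sub>L X = X \<circ>\<^sub>L T"
  shows "riesz T c r \<circ>\<^sub>L X = X \<circ>\<^sub>L riesz T c r"
  using riesz_commute_mod[OF operator_ideal_zero r X(1)] X(2) by simp

end

section \<open>Products of Riesz projectors\<close>

lemma contour_integral_circlepath_inside:
  assumes "cmod (w - c) < r"
  shows "contour_integral (circlepath c r) (\<lambda>z. 1 / (z - w)) = 2 * of_real pi * \<i>"
proof -
  have "w \<notin> path_image (circlepath c r)" using assms by (auto simp: dist_norm norm_minus_commute)
  from winding_number_valid_path[OF valid_path_circlepath this] winding_number_circlepath[OF assms]
  show ?thesis by (simp add: field_simps)
qed

lemma contour_integral_circlepath_outside: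
  assumes "cmod (w - c) > r" "r > 0"
  shows "contour_integral (circlepath c r) (\<lambda>z. 1 / (z - w)) = 0"
proof (rule contour_integral_unique, rule Cauchy_theorem_convex_simple[of _ "cball c r"])
  show "(\<lambda>z. 1 / (z - w)) holomorphic_on cball c r"
    using assms by (intro holomorphic_intros) (auto simp: dist_norm norm_minus_commute)
qed (use assms in auto)

context complex_structure
begin

lemma clinear_resolvent:
  "clinear_op T \<Longrightarrow> z \<notin> spectrum_wrt J T \<Longrightarrow> clinear_op (resolvent_wrt J T z)"
  by (rule clinear_op_inverse[OF clinear_op_diff[OF clinear_op_scalar] resolvent_inverse])

lemma continuous_functional_resolvent:
  assumes "functional \<psi>" "sphere c r \<inter> spectrum_wrt J T = {}"
  shows "continuous_on (sphere c r) (\<lambda>z. \<psi> (resolvent_wrt J T z))"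
proof -
  have "continuous_on (sphere c r) (resolvent_wrt J T)"
    using assms(2) by (intro continuous_on_subset[OF continuous_resolvent]) auto
  then show ?thesis using assms(1) unfolding functional_def by (blast intro: bounded_linear.continuous_on)
qed

lemma functional_resolvent_quotient:
  assumes T: "clinear_op T" and \<psi>: "functional \<psi>" and z: "z \<notin> spectrum_wrt J T" and w: "w \<notin> spectrum_wrt J T" "z \<noteq> w"
  shows "\<psi> (resolvent_wrt J T z \<circ>\<^sub>L resolvent_wrt J T w) = \<psi> (resolvent_wrt J T w) * (1 / (z - w)) - \<psi> (resolvent_wrt J T z) * (1 / (z - w))"
proof -
  let ?R = "resolvent_wrt J T"
  have "sc (z - w) \<circ>\<^sub>L (?R z \<circ>\<^sub>L ?R w) = ?R w - ?R z"
  proof (rule blinfun_eqI)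
    fix x
    have "sc (z - w) (?R z (?R w x)) = ?R z (sc (z - w) (?R w x))"
      using clinear_op_sc[OF clinear_resolvent[OF T z]] by simp
    also have "sc (z - w) (?R w x) = (sc z - T) (?R w x) - (sc w - T) (?R w x)"
      by (simp add: sc_diff blinfun.diff_left)
    also have "?R z \<dots> = ?R w x - ?R z x"
      by (simp only: blinfun.diff_right is_inverse_op_apply[OF resolvent_inverse[OF z]] is_inverse_op_apply[OF resolvent_inverse[OF w(1)]])
    finally show "(sc (z - w) \<circ>\<^sub>L (?R z \<circ>\<^sub>L ?R w)) x = (?R w - ?R z) x" by (simp add: blinfun.diff_left)
  qed
  then have "(z - w) * \<psi> (?R z \<circ>\<^sub>L ?R w) = \<psi> (?R w) - \<psi> (?R z)"
    by (metis functional_sc[OF \<psi>] functional_diff[OF \<psi>])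
  then have "\<psi> (?R z \<circ>\<^sub>L ?R w) = (\<psi> (?R w) - \<psi> (?R z)) / (z - w)"
    using w(2) by (simp add: nonzero_eq_divide_eq mult.commute)
  then show ?thesis by (simp add: diff_divide_distrib)
qed

text \<open>The resolvent identity splits the integrand into two terms; the one with
  \<open>resolvent_wrt J T z\<close> integrates to zero because \<open>z\<close> lies outside the
  circle.\<close>

lemma functional_resolvent_riesz:
  assumes T: "clinear_op T" and \<psi>: "functional \<psi>" and r: "r > 0" "sphere c r \<inter> spectrum_wrt J T = {}"
    and z: "z \<notin> spectrum_wrt J T" "cmod (z - c) > r"
  shows "\<psi> (resolvent_wrt J T z \<circ>\<^sub>L riesz T c r) =
    1 / (2 * of_real pi * \<i>) * contour_integral (circlepath c r) (\<lambda>w. \<psi> (resolvent_wrt J T w) * (1 / (z - w)))"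
proof -
  let ?R = "resolvent_wrt J T"
  have \<theta>: "functional (\<lambda>Y. \<psi> (?R z \<circ>\<^sub>L Y))"
    by (rule functional_transform(2)[OF \<psi> clinear_resolvent[OF T z(1)]])
  have ne: "z \<noteq> w" "w \<notin> spectrum_wrt J T" if "w \<in> sphere c r" for w
    using that z r by (auto simp: dist_norm norm_minus_commute)
  have cont: "continuous_on (sphere c r) (\<lambda>w. \<psi> (?R w) * (1 / (z - w)))"
    using ne by (intro continuous_intros continuous_functional_resolvent[OF \<psi> r(2)]) auto
  have cont': "continuous_on (sphere c r) (\<lambda>w. \<psi> (?R z) * (1 / (z - w)))"
    using ne by (intro continuous_intros) auto
  have "contour_integral (circlepath c r) (\<lambda>w. \<psi> (?R z \<circ>\<^sub>L ?R w)) =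
      contour_integral (circlepath c r) (\<lambda>w. \<psi> (?R w) * (1 / (z - w)) - \<psi> (?R z) * (1 / (z - w)))"
    using r(1) by (intro contour_integral_cong refl functional_resolvent_quotient[OF T \<psi> z(1)]) (use ne in auto)
  also have "\<dots> = contour_integral (circlepath c r) (\<lambda>w. \<psi> (?R w) * (1 / (z - w)))
      - contour_integral (circlepath c r) (\<lambda>w. \<psi> (?R z) * (1 / (z - w)))"
    using cont cont' r(1) by (intro contour_integral_diff contour_integrable_continuous_circlepath) auto
  also have "contour_integral (circlepath c r) (\<lambda>w. \<psi> (?R z) * (1 / (z - w))) = 0"
  proof (rule contour_integral_unique, rule Cauchy_theorem_convex_simple[of _ "cball c r"])
    show "(\<lambda>w. \<psi> (?R z) * (1 / (z - w))) holomorphic_on cball c r"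
      using z(2) by (intro holomorphic_intros) (auto simp: dist_norm norm_minus_commute)
  qed (use r in auto)
  finally show ?thesis using functional_riesz[OF \<theta> _ r(2)] r(1) by simp
qed

text \<open>After the resolvent identity and an exchange of the integrals, only the integral of
  \<open>1 / (z - w)\<close> over the second circle remains. Its value \<open>m\<close> is left
  open: a surrounding second circle gives \<open>2 * pi * \<i>\<close> and hence idempotence, a
  separate one gives \<open>0\<close>.\<close>

lemma functional_riesz_product:
  assumes T: "clinear_op T" and \<psi>: "functional \<psi>"
    and r: "r > 0" "sphere c r \<inter> spectrum_wrt J T = {}" and r': "r' > 0" "sphere c' r' \<inter> spectrum_wrt J T = {}"
    and out: "\<And>z. z \<in> sphere c' r' \<Longrightarrow> cmod (z - c) > r"
    and m: "\<And>w. w \<in> sphere c r \<Longrightarrow> contour_integral (circlepath c' r') (\<lambda>z. 1 / (z - w)) = m"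
  shows "\<psi> (riesz T c' r' \<circ>\<^sub>L riesz T c r) = 1 / (2 * of_real pi * \<i>) * m * \<psi> (riesz T c r)"
proof -
  let ?R = "resolvent_wrt J T"
  let ?k = "1 / (2 * of_real pi * \<i>)"
  let ?g = "\<lambda>w. \<psi> (?R w)"
  have ne: "z \<noteq> w" if "z \<in> sphere c' r'" "w \<in> sphere c r" for z w
    using out[OF that(1)] that(2) by (auto simp: dist_norm norm_minus_commute)
  have cont: "continuous_on (sphere c' r' \<times> sphere c r) (\<lambda>(z, w). ?g w * (1 / (z - w)))"
    unfolding case_prod_unfold
    by (intro continuous_intros continuous_on_compose2[OF continuous_functional_resolvent[OF \<psi> r(2)], of _ snd])
      (use ne in auto)
  have der: "continuous_on {0..1} (\<lambda>t. vector_derivative (circlepath a s) (at t))" for a s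
    unfolding vector_derivative_circlepath by (intro continuous_intros)
  have contz: "continuous_on (sphere c' r') (\<lambda>z. 1 / (z - w))" if "w \<in> sphere c r" for w
    using ne[OF _ that] by (intro continuous_intros) auto
  have \<theta>: "functional (\<lambda>Y. \<psi> (Y \<circ>\<^sub>L riesz T c r))" by (rule functional_transform(1)[OF \<psi>])
  have "\<psi> (riesz T c' r' \<circ>\<^sub>L riesz T c r) = ?k * contour_integral (circlepath c' r') (\<lambda>z. \<psi> (?R z \<circ>\<^sub>L riesz T c r))"
    using functional_riesz[OF \<theta> _ r'(2)] r'(1) by simp
  also have "contour_integral (circlepath c' r') (\<lambda>z. \<psi> (?R z \<circ>\<^sub>L riesz T c r))
      = contour_integral (circlepath c' r') (\<lambda>z. ?k * contour_integral (circlepath c r) (\<lambda>w. ?g w * (1 / (z - w))))"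
    using r'(1) by (intro contour_integral_cong refl functional_resolvent_riesz[OF T \<psi> r]) (use r' out in auto)
  also have "\<dots> = ?k * contour_integral (circlepath c' r') (\<lambda>z. contour_integral (circlepath c r) (\<lambda>w. ?g w * (1 / (z - w))))"
  proof -
    \<comment> \<open>Continuity of the inner integral is read off from its closed form in terms of
      the resolvent at \<open>z\<close>.\<close>
    have "(\<lambda>z. contour_integral (circlepath c r) (\<lambda>w. ?g w * (1 / (z - w)))) contour_integrable_on circlepath c' r'"
    proof (rule contour_integrable_continuous_circlepath)
      have "continuous_on (sphere c' r') (\<lambda>z. ?R z)"
        using r'(2) by (intro continuous_on_subset[OF continuous_resolvent]) auto
      then have "continuous_on (sphere c' r') (\<lambda>z. (2 * of_real pi * \<i>) * \<psi> (?R z \<circ>\<^sub>L riesz T c r))"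
        using \<theta> unfolding functional_def
        by (intro continuous_on_mult continuous_on_const) (rule bounded_linear.continuous_on, auto)
      then have "continuous_on (sphere c' r') (\<lambda>z. contour_integral (circlepath c r) (\<lambda>w. ?g w * (1 / (z - w))))"
        by (rule continuous_on_eq) (subst functional_resolvent_riesz[OF T \<psi> r], use r' out in auto)
      then show "continuous_on (path_image (circlepath c' r')) (\<lambda>z. contour_integral (circlepath c r) (\<lambda>w. ?g w * (1 / (z - w))))"
        using r'(1) by simp
    qed
    then show ?thesis by (rule contour_integral_lmul)
  qed
  also have "contour_integral (circlepath c' r') (\<lambda>z. contour_integral (circlepath c r) (\<lambda>w. ?g w * (1 / (z - w))))
      = contour_integral (circlepath c r) (\<lambda>w. contour_integral (circlepath c' r') (\<lambda>z. ?g w * (1 / (z - w))))"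
    using cont r r' by (intro contour_integral_swap der) (auto simp: case_prod_unfold)
  also have "\<dots> = contour_integral (circlepath c r) (\<lambda>w. m * ?g w)"
  proof (rule contour_integral_cong[OF refl])
    fix w assume "w \<in> path_image (circlepath c r)"
    then have w: "w \<in> sphere c r" using r(1) by simp
    have "contour_integral (circlepath c' r') (\<lambda>z. ?g w * (1 / (z - w))) = ?g w * contour_integral (circlepath c' r') (\<lambda>z. 1 / (z - w))"
      using contz[OF w] r'(1) by (intro contour_integral_lmul contour_integrable_continuous_circlepath) simp
    then show "contour_integral (circlepath c' r') (\<lambda>z. ?g w * (1 / (z - w))) = m * ?g w"
      by (simp only: m[OF w] mult.commute)
  qed
  also have "\<dots> = m * contour_integral (circlepath c r) ?g"
    using r by (intro contour_integral_lmul contour_integrable_continuous_circlepath)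
      (simp add: continuous_functional_resolvent[OF \<psi>])
  finally have "\<psi> (riesz T c' r' \<circ>\<^sub>L riesz T c r) = ?k * m * (?k * contour_integral (circlepath c r) ?g)"
    by (simp only: mult_ac)
  then show ?thesis using functional_riesz[OF \<psi> _ r(2)] r(1) by simp
qed

text \<open>The product formula needs two circles, so one factor is moved to a slightly larger
  circle. The circle and the spectrum have positive distance \<open>e\<close>, so the annulus in
  between is free of spectrum and the projector unchanged.\<close>

lemma riesz_idempotent:
  assumes T: "clinear_op T" and r: "r > 0" "sphere c r \<inter> spectrum_wrt J T = {}"
  shows "riesz T c r \<circ>\<^sub>L riesz T c r = riesz T c r"
proof -
  obtain e where e: "e > 0" "\<And>z w. z \<in> sphere c r \<Longrightarrow> cmod (w - z) < e \<Longrightarrow> w \<notin> spectrum_wrt J T"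
  proof -
    have "\<exists>e>0. \<forall>z\<in>sphere c r. \<forall>w\<in>spectrum_wrt J T. e \<le> dist z w"
      by (rule separate_compact_closed[OF compact_sphere closed_spectrum r(2)])
    then show thesis using that by (metis dist_norm linorder_not_less norm_minus_commute)
  qed
  define r' where "r' = r + e / 2"
  have r': "r' > r" "r' > 0" using e(1) r(1) by (simp_all add: r'_def)
  have ann: "z \<notin> spectrum_wrt J T" if z: "r \<le> cmod (z - c)" "cmod (z - c) \<le> r'" for z
  proof -
    \<comment> \<open>The radial projection of \<open>z\<close> onto the circle, at distance
      \<open>cmod (z - c) - r \<le> e / 2\<close>.\<close>
    define y where "y = c + of_real (r / cmod (z - c)) * (z - c)"
    have zc: "cmod (z - c) > 0" using z r by linarith
    have dy: "dist c y = r" using r zc by (simp add: y_def dist_norm norm_mult norm_divide)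
    have "z - y = of_real (1 - r / cmod (z - c)) * (z - c)" by (simp add: y_def algebra_simps)
    then have "cmod (z - y) = \<bar>1 - r / cmod (z - c)\<bar> * cmod (z - c)" by (simp only: norm_mult norm_of_real)
    moreover have "0 \<le> 1 - r / cmod (z - c)" using zc z by simp
    ultimately have "cmod (z - y) = (1 - r / cmod (z - c)) * cmod (z - c)" by simp
    then have "cmod (z - y) = cmod (z - c) - r" using zc by (simp add: left_diff_distrib)
    then have "cmod (z - y) < e" using z e(1) by (simp add: r'_def)
    then show ?thesis using e(2)[of y z] dy by simp
  qed
  have av': "sphere c r' \<inter> spectrum_wrt J T = {}" using ann r' by (auto simp: dist_norm norm_minus_commute)
  have eq: "riesz T c r' = riesz T c r"
  proof (rule riesz_independent[OF T r'(2) av' r])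
    show "spectrum_wrt J T \<inter> ball c r' = spectrum_wrt J T \<inter> ball c r"
      using ann r' by (force simp: dist_norm norm_minus_commute not_less)
  qed
  have "riesz T c r' \<circ>\<^sub>L riesz T c r = riesz T c r"
  proof (rule eq_if_functionals)
    fix \<psi> assume \<psi>: "functional \<psi>"
    have "contour_integral (circlepath c r') (\<lambda>z. 1 / (z - w)) = 2 * of_real pi * \<i>" if "w \<in> sphere c r" for w
      using that r' by (intro contour_integral_circlepath_inside) (simp add: dist_norm norm_minus_commute)
    from functional_riesz_product[OF T \<psi> r r'(2) av' _ this] r'
    show "\<psi> (riesz T c r' \<circ>\<^sub>L riesz T c r) = \<psi> (riesz T c r)" by (simp add: dist_norm norm_minus_commute)
  qed
  then show ?thesis by (simp add: eq)
qed

lemma riesz_disjoint_product: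
  assumes T: "clinear_op T" and r: "r > 0" "sphere c r \<inter> spectrum_wrt J T = {}" and r': "r' > 0" "sphere c' r' \<inter> spectrum_wrt J T = {}"
    and disj: "cball c r \<inter> cball c' r' = {}"
  shows "riesz T c' r' \<circ>\<^sub>L riesz T c r = 0"
proof (rule eq_if_functionals)
  fix \<psi> assume \<psi>: "functional \<psi>"
  have 1: "cmod (z - c) > r" if "z \<in> sphere c' r'" for z
    using that disj r' by (force simp: dist_norm norm_minus_commute not_le[symmetric])
  have 2: "contour_integral (circlepath c' r') (\<lambda>z. 1 / (z - w)) = 0" if "w \<in> sphere c r" for w
  proof (rule contour_integral_circlepath_outside)
    show "cmod (w - c') > r'" using that disj r by (force simp: dist_norm norm_minus_commute not_le[symmetric])
  qed (rule r'(1))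
  from functional_riesz_product[OF T \<psi> r r' 1 2] show "\<psi> (riesz T c' r' \<circ>\<^sub>L riesz T c r) = \<psi> 0"
    by (simp add: functional_zero[OF \<psi>])
qed

section \<open>Complementary Riesz projectors\<close>

lemma riesz_whole_spectrum:
  assumes T: "clinear_op T" and r: "r > 0" "spectrum_wrt J T \<subseteq> ball c r"
  shows "riesz T c r = id_blinfun"
proof (rule eq_if_functionals)
  fix \<psi> assume \<psi>: "functional \<psi>"
  let ?R = "resolvent_wrt J T"
  obtain B where B: "B > 0" "\<And>X. cmod (\<psi> X) \<le> norm X * B"
    using \<psi> bounded_linear.pos_bounded unfolding functional_def by blast
  define a where "a = (1 + norm J) * norm T"
  have a: "a \<ge> 0" by (simp add: a_def)
  \<comment> \<open>From \<open>(z - c) R = id + (T - c) R\<close>: \<open>B\<close> bounds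
    \<open>\<psi>\<close>, and \<open>1 + norm J\<close> is the numerator in the bound of the
    resolvent at large points.\<close>
  define D where "D = B * ((1 + norm J) * norm (T - sc c))"
  have D: "D \<ge> 0" using B(1) by (simp add: D_def)
  let ?d = "\<psi> (riesz T c r) - \<psi> id_blinfun"
  \<comment> \<open>The circle can be enlarged freely. At radius \<open>s\<close> the resolvent
    differs from \<open>1 / (z - c)\<close> by order \<open>1 / s\<^sup>2\<close> under
    \<open>\<psi>\<close>, against a length of order \<open>s\<close>.\<close>
  have bound: "cmod ?d \<le> D / (s - cmod c - a)" if s: "s > r" "s > cmod c + a" for s
  proof -
    have s0: "s > 0" using s r by linarith
    have av: "sphere c s \<inter> spectrum_wrt J T = {}" using r s by (auto simp: dist_norm)
    have "riesz T c r = riesz T c s"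
    proof (rule riesz_independent[OF T r(1) _ s0 av])
      show "sphere c r \<inter> spectrum_wrt J T = {}" using r by (auto simp: dist_norm)
      show "spectrum_wrt J T \<inter> ball c r = spectrum_wrt J T \<inter> ball c s" using r s by (auto simp: dist_norm)
    qed
    then have "\<psi> (riesz T c r) = 1 / (2 * of_real pi * \<i>) * contour_integral (circlepath c s) (\<lambda>z. \<psi> (?R z))"
      using functional_riesz[OF \<psi> _ av] s0 by simp
    moreover have "\<psi> id_blinfun = 1 / (2 * of_real pi * \<i>) * contour_integral (circlepath c s) (\<lambda>z. \<psi> id_blinfun * (1 / (z - c)))"
      using contour_integral_circlepath_inside[of c c s] s0
      by (subst contour_integral_lmul[OF contour_integrable_continuous_circlepath])
        (auto intro!: continuous_intros)
    ultimately have d: "?d = 1 / (2 * of_real pi * \<i>) * (contour_integral (circlepath c s) (\<lambda>z. \<psi> (?R z))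
        - contour_integral (circlepath c s) (\<lambda>z. \<psi> id_blinfun * (1 / (z - c))))" by (simp add: right_diff_distrib)
    have int: "(\<lambda>z. \<psi> (?R z)) contour_integrable_on circlepath c s"
      "(\<lambda>z. \<psi> id_blinfun * (1 / (z - c))) contour_integrable_on circlepath c s"
      using s0 continuous_functional_resolvent[OF \<psi> av]
      by (auto intro!: contour_integrable_continuous_circlepath continuous_intros)
    have "cmod (contour_integral (circlepath c s) (\<lambda>z. \<psi> (?R z)) - contour_integral (circlepath c s) (\<lambda>z. \<psi> id_blinfun * (1 / (z - c))))
        \<le> D / (s * (s - cmod c - a)) * (2 * pi * s)"
    proof (rule has_contour_integral_bound_circlepath[OF has_contour_integral_diff])
      show "((\<lambda>z. \<psi> (?R z)) has_contour_integral contour_integral (circlepath c s) (\<lambda>z. \<psi> (?R z))) (circlepath c s)"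
        using int(1) by (rule has_contour_integral_integral)
      show "((\<lambda>z. \<psi> id_blinfun * (1 / (z - c))) has_contour_integral contour_integral (circlepath c s) (\<lambda>z. \<psi> id_blinfun * (1 / (z - c)))) (circlepath c s)"
        using int(2) by (rule has_contour_integral_integral)
      show "0 \<le> D / (s * (s - cmod c - a))" using D s s0 by simp
      show "0 < s" by fact
      fix z assume z: "cmod (z - c) = s"
      have zs: "z \<notin> spectrum_wrt J T" using av z by (auto simp: dist_norm norm_minus_commute)
      have "cmod z \<ge> s - cmod c" using z norm_triangle_ineq4[of z c] by linarith
      then have za: "cmod z > a" "s - cmod c - a \<le> cmod z - a" "0 < s - cmod c - a" using s by linarith+
      have "norm (?R z) \<le> (1 + norm J) / (cmod z - a)"
        using resolvent_large(2)[of T z] za unfolding a_def by blast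
      also have "\<dots> \<le> (1 + norm J) / (s - cmod c - a)" using za by (intro divide_left_mono mult_pos_pos) auto
      finally have nR: "norm (?R z) \<le> (1 + norm J) / (s - cmod c - a)" .
      have "sc (z - c) \<circ>\<^sub>L ?R z = id_blinfun + (T - sc c) \<circ>\<^sub>L ?R z"
      proof (rule blinfun_eqI)
        fix x
        have "(sc z - T) (?R z x) = x" by (rule is_inverse_op_apply(1)[OF resolvent_inverse[OF zs]])
        then show "(sc (z - c) \<circ>\<^sub>L ?R z) x = (id_blinfun + (T - sc c) \<circ>\<^sub>L ?R z) x"
          by (simp add: op_simps sc_diff algebra_simps)
      qed
      then have "(z - c) * \<psi> (?R z) = \<psi> id_blinfun + \<psi> ((T - sc c) \<circ>\<^sub>L ?R z)"
        by (metis functional_sc[OF \<psi>] functional_add[OF \<psi>])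
      moreover have "z - c \<noteq> 0" using z s0 by auto
      ultimately have "\<psi> (?R z) - \<psi> id_blinfun * (1 / (z - c)) = \<psi> ((T - sc c) \<circ>\<^sub>L ?R z) / (z - c)"
        by (simp add: field_simps)
      then have "cmod (\<psi> (?R z) - \<psi> id_blinfun * (1 / (z - c))) = cmod (\<psi> ((T - sc c) \<circ>\<^sub>L ?R z)) / s"
        by (simp add: norm_divide z)
      also have "\<dots> \<le> (norm (T - sc c) * ((1 + norm J) / (s - cmod c - a)) * B) / s"
      proof (intro divide_right_mono order_trans[OF B(2)] mult_right_mono)
        show "norm ((T - sc c) \<circ>\<^sub>L ?R z) \<le> norm (T - sc c) * ((1 + norm J) / (s - cmod c - a))"
          by (rule order_trans[OF norm_blinfun_compose mult_left_mono[OF nR norm_ge_zero]])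
      qed (use B s0 in auto)
      also have "\<dots> = D / (s * (s - cmod c - a))" by (simp add: D_def mult_ac)
      finally show "cmod (\<psi> (?R z) - \<psi> id_blinfun * (1 / (z - c))) \<le> D / (s * (s - cmod c - a))" .
    qed
    then have "cmod ?d \<le> 1 / (2 * pi) * (D / (s * (s - cmod c - a)) * (2 * pi * s))"
      unfolding d by (simp add: norm_mult norm_divide divide_right_mono)
    also have "\<dots> = D / (s - cmod c - a)" using s0 by simp
    finally show ?thesis .
  qed
  have "cmod ?d \<le> 0"
  proof (rule tendsto_lowerbound)
    show "((\<lambda>s. D / (s - cmod c - a)) \<longlongrightarrow> 0) at_top" by real_asymp
    show "\<forall>\<^sub>F s in at_top. cmod ?d \<le> D / (s - cmod c - a)"
      using eventually_gt_at_top[of r] eventually_gt_at_top[of "cmod c + a"] by eventually_elim (rule bound)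
  qed simp
  then show "\<psi> (riesz T c r) = \<psi> id_blinfun" by simp
qed

lemma functional_scaled_resolvent_integral:
  assumes \<psi>: "functional \<psi>" and r: "r > 0" "sphere c r \<inter> spectrum_wrt J T = {}" and z: "cmod (z - c) < r"
    and C: "C = sc (1 / (2 * of_real pi * \<i>)) \<circ>\<^sub>L op_contour_integral J (circlepath c r) (\<lambda>w. sc (1 / (w - z)) \<circ>\<^sub>L resolvent_wrt J T w)"
  shows "\<psi> C = 1 / (2 * of_real pi * \<i>) * contour_integral (circlepath c r) (\<lambda>w. 1 / (w - z) * \<psi> (resolvent_wrt J T w))"
proof -
  have "continuous_on (sphere c r) (resolvent_wrt J T)"
    using r by (intro continuous_on_subset[OF continuous_resolvent]) auto
  moreover have "continuous_on (sphere c r) (\<lambda>w. sc (1 / (w - z)))"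
    using z by (intro continuous_intros) (auto simp: dist_norm norm_minus_commute)
  ultimately have "continuous_on (sphere c r) (\<lambda>w. sc (1 / (w - z)) \<circ>\<^sub>L resolvent_wrt J T w)"
    by (intro bounded_bilinear.continuous_on[OF bounded_bilinear_blinfun_compose])
  from functional_op_contour_integral[OF \<psi> this] r(1) show ?thesis
    unfolding C functional_sc[OF \<psi>] by simp
qed

text \<open>Even at a spectral point \<open>z\<close> inside the circle, \<open>z - T\<close> is
  invertible on the range of the complementary projector. The inverse is the integral of the
  resolvent divided by \<open>w - z\<close>: since \<open>(z - T) R w = id - (w - z) R w\<close>,
  its product with \<open>z - T\<close> is the identity minus the Riesz projector.\<close>

lemma riesz_partial_inverse:
  assumes T: "clinear_op T" and r: "r > 0" "sphere c r \<inter> spectrum_wrt J T = {}" and z: "cmod (z - c) < r"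
  obtains Y where "(sc z - T) \<circ>\<^sub>L Y = id_blinfun - riesz T c r" "Y \<circ>\<^sub>L (sc z - T) = id_blinfun - riesz T c r"
    "\<And>X. clinear_op X \<Longrightarrow> T \<circ>\<^sub>L X = X \<circ>\<^sub>L T \<Longrightarrow> Y \<circ>\<^sub>L X = X \<circ>\<^sub>L Y"
proof -
  let ?R = "resolvent_wrt J T"
  let ?k = "1 / (2 * of_real pi * \<i>)"
  define Y where "Y = sc ?k \<circ>\<^sub>L op_contour_integral J (circlepath c r) (\<lambda>w. sc (1 / (w - z)) \<circ>\<^sub>L ?R w)"
  note val = functional_scaled_resolvent_integral[OF _ r z Y_def]
  have comm: "Y \<circ>\<^sub>L X = X \<circ>\<^sub>L Y" if X: "clinear_op X" "T \<circ>\<^sub>L X = X \<circ>\<^sub>L T" for X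
  proof (rule eq_if_functionals)
    fix \<psi> assume \<psi>: "functional \<psi>"
    let ?\<theta> = "\<lambda>Y. \<psi> (Y \<circ>\<^sub>L X) - \<psi> (X \<circ>\<^sub>L Y)"
    have \<theta>: "functional ?\<theta>" by (intro functional_minus functional_transform \<psi> X(1))
    have "?\<theta> (?R w) = 0" if w: "w \<in> sphere c r" for w
    proof -
      have ws: "w \<notin> spectrum_wrt J T" using w r by auto
      have "inverse_mod {0} (sc w - T) (?R w)" using resolvent_inverse[OF ws] by (simp add: inverse_mod_zero_iff)
      moreover have "(sc w - T) \<circ>\<^sub>L X - X \<circ>\<^sub>L (sc w - T) \<in> {0}"
      proof -
        have "(sc w - T) \<circ>\<^sub>L X - X \<circ>\<^sub>L (sc w - T) = - (T \<circ>\<^sub>L X - X \<circ>\<^sub>L T)"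
          by (rule blinfun_eqI) (simp add: op_simps clinear_op_sc[OF X(1)])
        then show ?thesis by (simp add: X(2))
      qed
      ultimately have "?R w \<circ>\<^sub>L X - X \<circ>\<^sub>L ?R w \<in> {0}" by (rule inverse_mod_commute[OF operator_ideal_zero])
      then show ?thesis by simp
    qed
    then have "contour_integral (circlepath c r) (\<lambda>w. 1 / (w - z) * ?\<theta> (?R w)) = 0"
      using r(1) by (intro contour_integral_eq_0) auto
    then have "?\<theta> Y = 0" using val[OF \<theta>] by simp
    then show "\<psi> (Y \<circ>\<^sub>L X) = \<psi> (X \<circ>\<^sub>L Y)" by simp
  qed
  have left: "(sc z - T) \<circ>\<^sub>L Y = id_blinfun - riesz T c r"
  proof (rule eq_if_functionals)
    fix \<psi> assume \<psi>: "functional \<psi>"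
    have S: "clinear_op (sc z - T)" by (intro clinear_op_diff clinear_op_scalar T)
    have \<theta>: "functional (\<lambda>Y. \<psi> ((sc z - T) \<circ>\<^sub>L Y))" by (rule functional_transform(2)[OF \<psi> S])
    have "\<psi> ((sc z - T) \<circ>\<^sub>L Y) = ?k * contour_integral (circlepath c r) (\<lambda>w. 1 / (w - z) * \<psi> ((sc z - T) \<circ>\<^sub>L ?R w))"
      by (rule val[OF \<theta>])
    also have "contour_integral (circlepath c r) (\<lambda>w. 1 / (w - z) * \<psi> ((sc z - T) \<circ>\<^sub>L ?R w))
        = contour_integral (circlepath c r) (\<lambda>w. \<psi> id_blinfun * (1 / (w - z)) - \<psi> (?R w))"
    proof (rule contour_integral_cong[OF refl])
      fix w assume "w \<in> path_image (circlepath c r)"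
      then have w: "w \<in> sphere c r" using r(1) by simp
      then have ws: "w \<notin> spectrum_wrt J T" "w \<noteq> z" using r z by (auto simp: dist_norm norm_minus_commute)
      have "(sc z - T) \<circ>\<^sub>L ?R w = id_blinfun - sc (w - z) \<circ>\<^sub>L ?R w"
      proof (rule blinfun_eqI)
        fix x
        have "(sc w - T) (?R w x) = x" by (rule is_inverse_op_apply(1)[OF resolvent_inverse[OF ws(1)]])
        then show "((sc z - T) \<circ>\<^sub>L ?R w) x = (id_blinfun - sc (w - z) \<circ>\<^sub>L ?R w) x"
          by (simp add: op_simps sc_diff algebra_simps)
      qed
      then have "\<psi> ((sc z - T) \<circ>\<^sub>L ?R w) = \<psi> id_blinfun - (w - z) * \<psi> (?R w)"
        by (simp only: functional_diff[OF \<psi>] functional_sc[OF \<psi>])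
      then show "1 / (w - z) * \<psi> ((sc z - T) \<circ>\<^sub>L ?R w) = \<psi> id_blinfun * (1 / (w - z)) - \<psi> (?R w)"
        using ws(2) by (simp add: diff_divide_distrib)
    qed
    also have "\<dots> = contour_integral (circlepath c r) (\<lambda>w. \<psi> id_blinfun * (1 / (w - z))) - contour_integral (circlepath c r) (\<lambda>w. \<psi> (?R w))"
      using r z continuous_functional_resolvent[OF \<psi> r(2)]
      by (intro contour_integral_diff contour_integrable_continuous_circlepath)
        (auto intro!: continuous_intros simp: dist_norm norm_minus_commute)
    also have "contour_integral (circlepath c r) (\<lambda>w. \<psi> id_blinfun * (1 / (w - z))) = \<psi> id_blinfun * (2 * of_real pi * \<i>)"
      using contour_integral_circlepath_inside[OF z] r(1) z
      by (subst contour_integral_lmul[OF contour_integrable_continuous_circlepath])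
        (auto intro!: continuous_intros simp: dist_norm norm_minus_commute)
    finally show "\<psi> ((sc z - T) \<circ>\<^sub>L Y) = \<psi> (id_blinfun - riesz T c r)"
      using functional_riesz[OF \<psi> _ r(2)] r(1)
      by (simp add: functional_diff[OF \<psi>] right_diff_distrib)
  qed
  have "T \<circ>\<^sub>L (sc z - T) = (sc z - T) \<circ>\<^sub>L T"
    by (rule blinfun_eqI) (simp add: op_simps clinear_op_sc[OF T])
  then have right: "Y \<circ>\<^sub>L (sc z - T) = id_blinfun - riesz T c r"
    using comm[of "sc z - T"] left by (simp add: clinear_op_diff clinear_op_scalar T)
  show thesis by (rule that[OF left right comm])
qed

text \<open>Moving the part of the spectrum inside the first circle to the centre \<open>c'\<close> of the second one
  yields an operator whose Riesz projector for the second circle is the identity.\<close>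

lemma riesz_sum:
  assumes T: "clinear_op T" and r: "r > 0" and r': "r' > 0"
    and disj: "cball c r \<inter> cball c' r' = {}" and \<sigma>: "spectrum_wrt J T \<subseteq> ball c r \<union> ball c' r'"
  shows "riesz T c r + riesz T c' r' = id_blinfun"
proof -
  have av: "sphere c r \<inter> spectrum_wrt J T = {}" "sphere c' r' \<inter> spectrum_wrt J T = {}"
  proof -
    have "False" if "x \<in> sphere c r" "x \<in> spectrum_wrt J T" for x
    proof -
      have "x \<in> ball c' r'" using \<sigma> that by auto
      then have "x \<in> cball c r \<inter> cball c' r'" using that(1) by auto
      then show False using disj by blast
    qed
    moreover have "False" if "x \<in> sphere c' r'" "x \<in> spectrum_wrt J T" for x
    proof -
      have "x \<in> ball c r" using \<sigma> that by auto
      then have "x \<in> cball c r \<inter> cball c' r'" using that(1) by auto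
      then show False using disj by blast
    qed
    ultimately show "sphere c r \<inter> spectrum_wrt J T = {}" "sphere c' r' \<inter> spectrum_wrt J T = {}" by blast+
  qed
  let ?R = "resolvent_wrt J T"
  let ?k = "1 / (2 * of_real pi * \<i>)"
  define P where "P = riesz T c r"
  have P: "clinear_op P" "P \<circ>\<^sub>L P = P" "\<And>X. clinear_op X \<Longrightarrow> T \<circ>\<^sub>L X = X \<circ>\<^sub>L T \<Longrightarrow> P \<circ>\<^sub>L X = X \<circ>\<^sub>L P"
    unfolding P_def by (rule clinear_riesz[OF T r av(1)], rule riesz_idempotent[OF T r av(1)], rule riesz_commute[OF r av(1)])
  have PP: "P (P x) = P x" for x using P(2) by (metis blinfun_apply_blinfun_compose)
  have PT: "P (T x) = T (P x)" for x using P(3)[OF T refl] by (metis blinfun_apply_blinfun_compose)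
  define T1 where "T1 = T \<circ>\<^sub>L (id_blinfun - P) + sc c' \<circ>\<^sub>L P"
  have T1: "clinear_op T1"
    unfolding T1_def by (intro clinear_op_intros T P(1))
  \<comment> \<open>One computation for two situations: \<open>E\<close> is the identity when
    \<open>Y\<close> is the resolvent at a regular point, and \<open>0\<close> when \<open>Y\<close>
    is the partial inverse at a spectral point inside the first circle.\<close>
  have inv: "is_inverse_op (sc z - T1) (Y \<circ>\<^sub>L (id_blinfun - P) + sc (1 / (z - c')) \<circ>\<^sub>L P)"
    if z: "z \<noteq> c'" and Y: "\<And>x. (sc z - T) (Y x) = x - P x + P (E x)" "\<And>x. Y ((sc z - T) x) = x - P x + P (E x)" "\<And>x. P (Y x) = Y (P x)"
      and E: "\<And>x. P (E x) = E (P x)" for z and Y E :: "'a \<Rightarrow>\<^sub>L 'a"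
  proof -
    have PS: "P (sc w x) = sc w (P x)" for w x by (rule clinear_op_sc[OF P(1)])
    have dec: "(sc z - T1) x = (sc z - T) (x - P x) + sc (z - c') (P x)" for x
      by (simp add: T1_def op_simps sc_diff)
    have sc1: "sc (z - c') (sc (1 / (z - c')) x) = x" "sc (1 / (z - c')) (sc (z - c') x) = x" for x
      using z by (simp_all add: sc_one flip: sc_mult_apply)
    have SP: "P ((sc z - T) x) = (sc z - T) (P x)" for x by (simp add: op_simps PS PT)
    show ?thesis
    proof (rule is_inverse_opI)
      fix x
      let ?u = "Y (x - P x)" and ?v = "sc (1 / (z - c')) (P x)"
      have "P ?u = 0" by (simp add: Y(3) blinfun.diff_right PP blinfun.zero_right)
      moreover have "P ?v = ?v" by (simp add: PS PP)
      ultimately have "(sc z - T1) (?u + ?v) = (sc z - T) ?u + sc (z - c') ?v"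
        by (simp only: dec blinfun.add_right) simp
      also have "\<dots> = x" unfolding Y(1) sc1 by (simp add: blinfun.diff_right PP E)
      finally show "(sc z - T1) ((Y \<circ>\<^sub>L (id_blinfun - P) + sc (1 / (z - c')) \<circ>\<^sub>L P) x) = x"
        by (simp add: blinfun.add_left blinfun.diff_left)
      define w where "w = (sc z - T1) x"
      have Pw: "P w = sc (z - c') (P x)"
        unfolding w_def dec by (simp add: blinfun.add_right SP blinfun.diff_right PP PS blinfun.zero_right)
      then have "w - P w = (sc z - T) (x - P x)" unfolding w_def dec by simp
      then have Yw: "Y (w - P w) = x - P x" by (simp only: Y(2)) (simp add: blinfun.diff_right PP E)
      have "(Y \<circ>\<^sub>L (id_blinfun - P) + sc (1 / (z - c')) \<circ>\<^sub>L P) w = Y (w - P w) + sc (1 / (z - c')) (P w)"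
        by (simp add: blinfun.add_left blinfun.diff_left)
      then have "(Y \<circ>\<^sub>L (id_blinfun - P) + sc (1 / (z - c')) \<circ>\<^sub>L P) w = x"
        unfolding Yw unfolding Pw sc1 by simp
      then show "(Y \<circ>\<^sub>L (id_blinfun - P) + sc (1 / (z - c')) \<circ>\<^sub>L P) ((sc z - T1) x) = x"
        unfolding w_def .
    qed
  qed
  have res: "is_inverse_op (sc z - T1) (?R z \<circ>\<^sub>L (id_blinfun - P) + sc (1 / (z - c')) \<circ>\<^sub>L P)"
    if z: "z \<noteq> c'" "z \<notin> spectrum_wrt J T" for z
  proof (rule inv[OF z(1), where E=id_blinfun])
    have "T \<circ>\<^sub>L ?R z - ?R z \<circ>\<^sub>L T = 0"
    proof -
      have "inverse_mod {0} (sc z - T) (?R z)" using resolvent_inverse[OF z(2)] by (simp add: inverse_mod_zero_iff)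
      moreover have "(sc z - T) \<circ>\<^sub>L T - T \<circ>\<^sub>L (sc z - T) \<in> {0}"
        by (auto intro!: blinfun_eqI simp: op_simps clinear_op_sc[OF T])
      ultimately have "?R z \<circ>\<^sub>L T - T \<circ>\<^sub>L ?R z \<in> {0}" by (rule inverse_mod_commute[OF operator_ideal_zero])
      then show ?thesis by simp
    qed
    then have "P \<circ>\<^sub>L ?R z = ?R z \<circ>\<^sub>L P" by (intro P(3) clinear_resolvent T z(2)) simp
    then show "P (?R z x) = ?R z (P x)" for x by (metis blinfun_apply_blinfun_compose)
  qed (use is_inverse_op_apply[OF resolvent_inverse[OF z(2)]] in simp_all)
  have out: "z \<notin> spectrum_wrt J T1" if z: "z \<notin> ball c' r'" for z
  proof -
    have zc: "z \<noteq> c'" using z r' by auto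
    show ?thesis
    proof (cases "z \<in> spectrum_wrt J T")
      case False
      then show ?thesis using res[OF zc] by (auto simp: spectrum_wrt_def)
    next
      case True
      then have "cmod (z - c) < r" using \<sigma> z by (auto simp: dist_norm norm_minus_commute)
      from riesz_partial_inverse[OF T r av(1) this] obtain Y where
        Y: "(sc z - T) \<circ>\<^sub>L Y = id_blinfun - P" "Y \<circ>\<^sub>L (sc z - T) = id_blinfun - P"
           "\<And>X. clinear_op X \<Longrightarrow> T \<circ>\<^sub>L X = X \<circ>\<^sub>L T \<Longrightarrow> Y \<circ>\<^sub>L X = X \<circ>\<^sub>L Y" unfolding P_def by metis
      have YP: "Y \<circ>\<^sub>L P = P \<circ>\<^sub>L Y" using P(3)[OF T refl] by (intro Y(3) P(1)) simp
      have ap: "(sc z - T) (Y x) = x - P x" "Y ((sc z - T) x) = x - P x" "P (Y x) = Y (P x)" for x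
        using Y(1,2) YP by (metis blinfun_apply_blinfun_compose blinfun.diff_left blinfun_apply_id_blinfun)+
      have "is_inverse_op (sc z - T1) (Y \<circ>\<^sub>L (id_blinfun - P) + sc (1 / (z - c')) \<circ>\<^sub>L P)"
        by (rule inv[OF zc, where E=0]) (simp_all add: ap blinfun.zero_left blinfun.zero_right)
      then show ?thesis by (auto simp: spectrum_wrt_def)
    qed
  qed
  have av1: "sphere c' r' \<inter> spectrum_wrt J T1 = {}" using out by auto
  have "riesz T1 c' r' = id_blinfun" using out by (intro riesz_whole_spectrum[OF T1 r']) blast
  \<comment> \<open>On the second circle the resolvent of \<open>T1\<close> is that of
    \<open>T\<close> on the complement of \<open>P\<close> plus \<open>P / (z - c')\<close>; the
    latter integrates to \<open>P\<close>.\<close>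
  moreover have "riesz T1 c' r' = riesz T c' r' \<circ>\<^sub>L (id_blinfun - P) + P"
  proof (rule eq_if_functionals)
    fix \<psi> assume \<psi>: "functional \<psi>"
    have \<theta>: "functional (\<lambda>Y. \<psi> (Y \<circ>\<^sub>L (id_blinfun - P)))" by (rule functional_transform(1)[OF \<psi>])
    have "contour_integral (circlepath c' r') (\<lambda>z. \<psi> (resolvent_wrt J T1 z))
        = contour_integral (circlepath c' r') (\<lambda>z. \<psi> (?R z \<circ>\<^sub>L (id_blinfun - P)) + \<psi> P * (1 / (z - c')))"
    proof (rule contour_integral_cong[OF refl])
      fix z assume "z \<in> path_image (circlepath c' r')"
      then have z: "z \<notin> spectrum_wrt J T" "z \<noteq> c'" using av(2) r' by auto
      show "\<psi> (resolvent_wrt J T1 z) = \<psi> (?R z \<circ>\<^sub>L (id_blinfun - P)) + \<psi> P * (1 / (z - c'))"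
        unfolding resolvent_wrt_eqI[OF res[OF z(2,1)]] functional_add[OF \<psi>] functional_sc[OF \<psi>] by (simp only: mult.commute)
    qed
    also have "\<dots> = contour_integral (circlepath c' r') (\<lambda>z. \<psi> (?R z \<circ>\<^sub>L (id_blinfun - P)))
        + contour_integral (circlepath c' r') (\<lambda>z. \<psi> P * (1 / (z - c')))"
      using r' continuous_functional_resolvent[OF \<theta> av(2)]
      by (intro contour_integral_add contour_integrable_continuous_circlepath) (auto intro!: continuous_intros)
    also have "contour_integral (circlepath c' r') (\<lambda>z. \<psi> P * (1 / (z - c'))) = \<psi> P * (2 * of_real pi * \<i>)"
      using contour_integral_circlepath_inside[of c' c' r'] r'
      by (subst contour_integral_lmul[OF contour_integrable_continuous_circlepath]) (auto intro!: continuous_intros)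
    finally show "\<psi> (riesz T1 c' r') = \<psi> (riesz T c' r' \<circ>\<^sub>L (id_blinfun - P) + P)"
      using functional_riesz[OF \<psi> _ av1] functional_riesz[OF \<theta> _ av(2)] r'
      by (simp add: functional_add[OF \<psi>] distrib_left)
  qed
  moreover have "riesz T c' r' \<circ>\<^sub>L P = 0"
    unfolding P_def by (rule riesz_disjoint_product[OF T r av(1) r' av(2) disj])
  moreover have "riesz T c' r' \<circ>\<^sub>L (id_blinfun - P) = riesz T c' r' - riesz T c' r' \<circ>\<^sub>L P"
    by (rule blinfun_eqI) (simp add: op_simps)
  ultimately have "id_blinfun = riesz T c' r' + P" by simp
  then show ?thesis by (simp add: P_def add.commute)
qed

text \<open>The length \<open>2 * pi * r\<close> cancels the \<open>2 * pi\<close> in the prefactor;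
  the prefactor and the derivative of the path each cost a factor \<open>1 + norm J\<close>.\<close>

lemma norm_riesz_diff_le:
  assumes r: "r > 0" "sphere c r \<inter> spectrum_wrt J T = {}" "sphere c r \<inter> spectrum_wrt J T' = {}"
    and e: "\<And>z. z \<in> sphere c r \<Longrightarrow> norm (resolvent_wrt J T' z - resolvent_wrt J T z) \<le> e"
  shows "norm (riesz T' c r - riesz T c r) \<le> (1 + norm J)\<^sup>2 * r * e"
proof -
  let ?f = "\<lambda>T t. sc (vector_derivative (circlepath c r) (at t within {0..1})) \<circ>\<^sub>L resolvent_wrt J T (circlepath c r t)"
  have cont: "continuous_on {0..1} (?f S)" if "sphere c r \<inter> spectrum_wrt J S = {}" for S
    using r(1) that by (intro op_contour_integrand) (auto intro: continuous_on_subset[OF continuous_resolvent])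
  have J1: "0 \<le> 1 + norm J" by simp
  have on: "circlepath c r t \<in> sphere c r" if "t \<in> {0..1}" for t
    using that r(1) path_image_circlepath_nonneg[of r c] by (auto simp: path_image_def)
  have e0: "0 \<le> e" using e[OF on[of 0]] norm_ge_zero by (meson atLeastAtMost_iff order_refl order_trans zero_le_one)
  have "norm (integral {0..1} (\<lambda>t. ?f T' t - ?f T t)) \<le> ((1 + norm J) * (2 * pi * r) * e) * (1 - 0)"
  proof (rule integral_bound)
    show "continuous_on {0..1} (\<lambda>t. ?f T' t - ?f T t)" using cont r by (intro continuous_on_diff) auto
    fix t :: real assume t: "t \<in> {0..1}"
    have "?f T' t - ?f T t = sc (vector_derivative (circlepath c r) (at t within {0..1})) \<circ>\<^sub>L
        (resolvent_wrt J T' (circlepath c r t) - resolvent_wrt J T (circlepath c r t))"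
      by (rule blinfun_eqI) (simp add: op_simps)
    then have "norm (?f T' t - ?f T t) \<le> norm (sc (vector_derivative (circlepath c r) (at t within {0..1}))) *
        norm (resolvent_wrt J T' (circlepath c r t) - resolvent_wrt J T (circlepath c r t))"
      by (simp only: norm_blinfun_compose)
    also have "\<dots> \<le> (1 + norm J) * (2 * pi * r) * e"
    proof (rule mult_mono)
      have "cmod (vector_derivative (circlepath c r) (at t within {0..1})) = 2 * pi * r"
        using t r(1) by (simp add: vector_derivative_circlepath01 norm_mult)
      then show "norm (sc (vector_derivative (circlepath c r) (at t within {0..1}))) \<le> (1 + norm J) * (2 * pi * r)"
        using norm_sc by metis
      show "0 \<le> (1 + norm J) * (2 * pi * r)" using r(1) by simp
    qed (use e on t in auto)
    finally show "norm (?f T' t - ?f T t) \<le> (1 + norm J) * (2 * pi * r) * e" .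
  qed simp
  moreover have "integral {0..1} (\<lambda>t. ?f T' t - ?f T t) = integral {0..1} (?f T') - integral {0..1} (?f T)"
    by (rule integral_diff) (intro integrable_continuous_interval cont r)+
  ultimately have n: "norm (integral {0..1} (?f T') - integral {0..1} (?f T)) \<le> (1 + norm J) * (2 * pi * r) * e" by simp
  have "riesz T' c r - riesz T c r = sc (1 / (2 * of_real pi * \<i>)) \<circ>\<^sub>L (integral {0..1} (?f T') - integral {0..1} (?f T))"
    unfolding riesz_def op_contour_integral_def by (rule blinfun_eqI) (simp add: blinfun.diff_left blinfun.diff_right)
  then have "norm (riesz T' c r - riesz T c r) \<le> norm (sc (1 / (2 * of_real pi * \<i>))) * norm (integral {0..1} (?f T') - integral {0..1} (?f T))"
    by (simp only: norm_blinfun_compose)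
  also have "\<dots> \<le> ((1 + norm J) * (1 / (2 * pi))) * ((1 + norm J) * (2 * pi * r) * e)"
    using norm_sc[of "1 / (2 * of_real pi * \<i>)"] n by (intro mult_mono) (simp_all add: norm_mult norm_divide)
  also have "\<dots> = (1 + norm J)\<^sup>2 * r * e" by (simp add: power2_eq_square)
  finally show ?thesis .
qed

end

section \<open>Spectral projectors of half-planes\<close>

text \<open>The discs with centre \<open>\<rho>\<close> and radius \<open>\<rho> - 1 / \<rho>\<close>, for \<open>\<rho> > 1\<close>, exhaust the right half-plane.\<close>

definition hp_disc :: "real \<Rightarrow> complex set" where
  "hp_disc \<rho> = ball (of_real \<rho>) (\<rho> - 1 / \<rho>)"

lemma hp_radius_pos:
  fixes \<rho> :: real shows "\<rho> > 1 \<Longrightarrow> \<rho> - 1 / \<rho> > 0"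
  using less_1_mult[of \<rho> \<rho>] by (simp add: field_simps)

lemma hp_cball_Re:
  assumes "\<rho> > 1" "cmod (z - of_real \<rho>) \<le> \<rho> - 1 / \<rho>"
  shows "Re z > 0"
proof -
  have "\<bar>Re z - \<rho>\<bar> \<le> \<rho> - 1 / \<rho>" using assms(2) abs_Re_le_cmod[of "z - of_real \<rho>"] by simp
  moreover have "1 / \<rho> > 0" using assms(1) by simp
  ultimately show ?thesis by linarith
qed

lemma hp_nested:
  assumes "1 < \<rho>" "\<rho> \<le> \<rho>'"
  shows "cmod (of_real \<rho>' - of_real \<rho>) + (\<rho> - 1 / \<rho>) \<le> \<rho>' - 1 / \<rho>'"
proof -
  have "cmod (of_real \<rho>' - of_real \<rho>) = \<rho>' - \<rho>" using assms by (simp flip: of_real_diff)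
  moreover have "1 / \<rho>' \<le> 1 / \<rho>" using assms by (intro divide_left_mono) auto
  ultimately show ?thesis by simp
qed

lemma hp_disc_mono:
  assumes "1 < \<rho>" "\<rho> \<le> \<rho>'" shows "hp_disc \<rho> \<subseteq> hp_disc \<rho>'"
proof
  fix z assume "z \<in> hp_disc \<rho>"
  then have "cmod (z - of_real \<rho>) < \<rho> - 1 / \<rho>" by (simp add: hp_disc_def dist_norm norm_minus_commute)
  moreover have "cmod (z - of_real \<rho>') \<le> cmod (z - of_real \<rho>) + cmod (of_real \<rho>' - of_real \<rho>)"
    using norm_triangle_ineq4[of "z - of_real \<rho>" "of_real \<rho>' - of_real \<rho>"] by simp
  ultimately show "z \<in> hp_disc \<rho>'" using hp_nested[OF assms] by (simp add: hp_disc_def dist_norm norm_minus_commute)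
qed

lemma hp_disc_exhaust:
  assumes K: "compact K" "\<And>z. z \<in> K \<Longrightarrow> Re z > 0"
  obtains \<rho> where "\<rho> > 1" "K \<subseteq> hp_disc \<rho>"
proof (cases "K = {}")
  case True then show thesis using that[of 2] by simp
next
  case False
  obtain M where M: "\<And>z. z \<in> K \<Longrightarrow> cmod z \<le> M" using compact_imp_bounded[OF K(1)] by (auto simp: bounded_iff)
  have "continuous_on K Re" by (intro continuous_intros)
  then obtain z0 where z0: "z0 \<in> K" "\<And>z. z \<in> K \<Longrightarrow> Re z0 \<le> Re z"
    using continuous_attains_inf[OF K(1) False] by blast
  define d where "d = Re z0"
  have d: "d > 0" using K(2) z0(1) by (simp add: d_def)
  \<comment> \<open>Membership in the disc means \<open>(cmod z)\<^sup>2 - 2 * \<rho> * Re z < - 2 +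
    1 / \<rho>\<^sup>2\<close>. It suffices that \<open>2 * \<rho> * d > M\<^sup>2 + 2\<close>; the
    extra \<open>2\<close> ensures \<open>\<rho> > 1\<close>.\<close>
  define \<rho> where "\<rho> = (M\<^sup>2 + 2) / (2 * d) + 2"
  have "(M\<^sup>2 + 2) / (2 * d) > 0" using d by (intro divide_pos_pos add_nonneg_pos) auto
  then have \<rho>: "\<rho> > 1" by (simp add: \<rho>_def)
  have "2 * \<rho> * d = M\<^sup>2 + 2 + 4 * d" using d by (simp add: \<rho>_def field_simps)
  then have key: "2 * \<rho> * d > M\<^sup>2 + 2" using d by simp
  show thesis
  proof (rule that[OF \<rho>], rule subsetI)
    fix z assume z: "z \<in> K"
    have "(cmod (z - of_real \<rho>))\<^sup>2 = (cmod z)\<^sup>2 - 2 * \<rho> * Re z + \<rho>\<^sup>2"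
      unfolding cmod_power2 by (simp add: power2_eq_square algebra_simps)
    moreover have "(cmod z)\<^sup>2 \<le> M\<^sup>2" using M[OF z] by (intro power_mono) auto
    moreover have "2 * \<rho> * d \<le> 2 * \<rho> * Re z" using z0(2)[OF z] \<rho> by (simp add: d_def)
    ultimately have "(cmod (z - of_real \<rho>))\<^sup>2 < \<rho>\<^sup>2 - 2" using key by linarith
    also have "\<dots> \<le> (\<rho> - 1 / \<rho>)\<^sup>2" using \<rho> by (simp add: power2_diff)
    finally have "cmod (z - of_real \<rho>) < \<rho> - 1 / \<rho>"
      using hp_radius_pos[OF \<rho>] by (meson power2_less_imp_less less_imp_le)
    then show "z \<in> hp_disc \<rho>" by (simp add: hp_disc_def dist_norm norm_minus_commute)
  qed
qed

abbreviation compacts :: "('a::banach \<Rightarrow>\<^sub>L 'a) set" where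
  "compacts \<equiv> {T. compact_operator T}"

context complex_structure
begin

section \<open>Uniform perturbation estimates over compact sets\<close>

lemma uniform_neighbourhood:
  fixes T :: "'a \<Rightarrow>\<^sub>L 'a"
  assumes K: "compact K"
    and Q: "\<And>z. z \<in> K \<Longrightarrow> \<exists>d>0. \<forall>w T'. cmod (w - z) + norm (T' - T) < d \<longrightarrow> Q w T'"
  shows "\<exists>e>0. \<forall>T'. norm (T' - T) < e \<longrightarrow> (\<forall>w\<in>K. Q w T')"
proof -
  obtain d where d: "\<And>z. z \<in> K \<Longrightarrow> d z > 0"
    "\<And>z w T'. z \<in> K \<Longrightarrow> cmod (w - z) + norm (T' - T) < d z \<Longrightarrow> Q w T'" using Q by metis
  \<comment> \<open>Halved radii: one half is spent on moving from \<open>z\<close> to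
    \<open>w\<close>, the other on moving from \<open>T\<close> to \<open>T'\<close>.\<close>
  have "K \<subseteq> (\<Union>z\<in>K. ball z (d z / 2))" using d(1) by force
  then obtain F where F: "F \<subseteq> K" "finite F" "K \<subseteq> (\<Union>z\<in>F. ball z (d z / 2))"
    by (rule compactE_image[OF K, rotated]) auto
  define e where "e = Min (insert 1 ((\<lambda>z. d z / 2) ` F))"
  have "e > 0" using F(1,2) d(1) by (auto simp: e_def)
  moreover have "Q w T'" if T': "norm (T' - T) < e" and w: "w \<in> K" for T' w
  proof -
    obtain z where z: "z \<in> F" "w \<in> ball z (d z / 2)" using F(3) w by blast
    have "e \<le> d z / 2" unfolding e_def using z(1) F(2) by (intro Min_le) auto
    then have "cmod (w - z) + norm (T' - T) < d z" using z(2) T' by (simp add: dist_norm norm_minus_commute)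
    then show ?thesis using d(2) z(1) F(1) by blast
  qed
  ultimately show ?thesis by blast
qed

lemma resolvent_set_mod_uniform:
  assumes I: "operator_ideal I" and K: "compact K" "K \<subseteq> resolvent_set_mod I T"
  shows "\<exists>e>0. \<forall>T'. norm (T' - T) < e \<longrightarrow> (\<forall>w\<in>K. w \<in> resolvent_set_mod I T')"
proof (rule uniform_neighbourhood[OF K(1)])
  fix z assume "z \<in> K"
  then obtain B where "inverse_mod I (sc z - T) B" using K(2) by (auto simp: resolvent_set_mod_def)
  from resolvent_mod_perturb[OF I this] show "\<exists>d>0. \<forall>w T'. cmod (w - z) + norm (T' - T) < d \<longrightarrow> w \<in> resolvent_set_mod I T'"
    unfolding resolvent_set_mod_def by blast
qed

lemma resolvent_uniform:
  assumes K: "compact K" "K \<inter> spectrum_wrt J T = {}" and \<eta>: "\<eta> > 0"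
  shows "\<exists>e>0. \<forall>T'. norm (T' - T) < e \<longrightarrow> (\<forall>w\<in>K. w \<notin> spectrum_wrt J T' \<and> norm (resolvent_wrt J T' w - resolvent_wrt J T w) \<le> \<eta>)"
proof (rule uniform_neighbourhood[OF K(1)])
  fix z assume "z \<in> K"
  then have z: "z \<notin> spectrum_wrt J T" using K(2) by blast
  define C where "C = 2 * (norm (resolvent_wrt J T z))\<^sup>2 * (1 + norm J) + 1"
  have C: "C > 0" by (simp add: C_def add_nonneg_pos)
  obtain d where d: "d > 0" "\<And>w T'. cmod (w - z) + norm (T' - T) < d \<Longrightarrow> w \<notin> spectrum_wrt J T' \<and>
    norm (resolvent_wrt J T' w - resolvent_wrt J T z)
      \<le> 2 * (norm (resolvent_wrt J T z))\<^sup>2 * ((1 + norm J) * (cmod (w - z) + norm (T' - T)))"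
    using resolvent_perturb[OF z] by blast
  \<comment> \<open>Both resolvents at \<open>w\<close>, that of \<open>T'\<close> and that of
    \<open>T\<close>, are compared with the one at the centre \<open>z\<close>; the second
    comparison is the case \<open>T' = T\<close>.\<close>
  have le: "norm (resolvent_wrt J T' w - resolvent_wrt J T z) \<le> \<eta> / 2"
    if "cmod (w - z) + norm (T' - T) < min d (\<eta> / (2 * C))" for w T'
  proof -
    have "norm (resolvent_wrt J T' w - resolvent_wrt J T z) \<le> (C - 1) * (cmod (w - z) + norm (T' - T))"
      using d(2)[of w T'] that by (simp add: C_def mult.assoc)
    also have "\<dots> \<le> C * (\<eta> / (2 * C))" using that C by (intro mult_mono) (auto simp: C_def)
    finally show ?thesis using C by simp
  qed
  show "\<exists>d>0. \<forall>w T'. cmod (w - z) + norm (T' - T) < d \<longrightarrow>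
      w \<notin> spectrum_wrt J T' \<and> norm (resolvent_wrt J T' w - resolvent_wrt J T w) \<le> \<eta>"
  proof (intro exI[of _ "min d (\<eta> / (2 * C))"] conjI allI impI)
    show "min d (\<eta> / (2 * C)) > 0" using d(1) \<eta> C by simp
    fix w T' assume wT: "cmod (w - z) + norm (T' - T) < min d (\<eta> / (2 * C))"
    then show "w \<notin> spectrum_wrt J T'" using d(2) by simp
    have "cmod (w - z) + norm (T - T) < min d (\<eta> / (2 * C))"
      using wT norm_ge_zero[of "T' - T"] by (simp del: norm_ge_zero)
    from le[OF this] le[OF wT] show "norm (resolvent_wrt J T' w - resolvent_wrt J T w) \<le> \<eta>"
      using norm_triangle_ineq4[of "resolvent_wrt J T' w - resolvent_wrt J T z" "resolvent_wrt J T w - resolvent_wrt J T z"] by simp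
  qed
qed

text \<open>The properties shared by the values of the path and its limits: no essential spectrum on
  the axis, and positive spectrum inside one of the discs, so that it stays away from the
  axis.\<close>

definition regular :: "('a \<Rightarrow>\<^sub>L 'a) \<Rightarrow> bool" where
  "regular T \<longleftrightarrow> clinear_op T \<and> (\<forall>z. Re z = 0 \<longrightarrow> z \<in> resolvent_set_mod compacts T) \<and>
     (\<exists>\<rho>>1. spectrum_wrt J T \<inter> {z. Re z > 0} \<subseteq> hp_disc \<rho>)"

definition pos_proj :: "('a \<Rightarrow>\<^sub>L 'a) \<Rightarrow> 'a \<Rightarrow>\<^sub>L 'a" where
  "pos_proj T = spectral_projector_wrt J T (spectrum_wrt J T \<inter> {z. Re z > 0})"

lemma hp_circle:
  assumes \<rho>: "1 < \<rho>" "\<rho> \<le> \<rho>'" and sub: "spectrum_wrt J T \<inter> {z. Re z > 0} \<subseteq> hp_disc \<rho>"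
  shows "sphere (of_real \<rho>') (\<rho>' - 1 / \<rho>') \<inter> spectrum_wrt J T = {}"
    and "spectrum_wrt J T \<inter> ball (of_real \<rho>') (\<rho>' - 1 / \<rho>') = spectrum_wrt J T \<inter> {z. Re z > 0}"
proof -
  have \<rho>': "\<rho>' > 1" using \<rho> by simp
  have Re: "Re z > 0" if "z \<in> cball (of_real \<rho>') (\<rho>' - 1 / \<rho>')" for z
    using that by (intro hp_cball_Re[OF \<rho>']) (simp add: dist_norm norm_minus_commute)
  have sub': "spectrum_wrt J T \<inter> {z. Re z > 0} \<subseteq> ball (of_real \<rho>') (\<rho>' - 1 / \<rho>')"
    using sub hp_disc_mono[OF \<rho>] unfolding hp_disc_def by blast
  show "spectrum_wrt J T \<inter> ball (of_real \<rho>') (\<rho>' - 1 / \<rho>') = spectrum_wrt J T \<inter> {z. Re z > 0}"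
    using sub' Re ball_subset_cball by blast
  show "sphere (of_real \<rho>') (\<rho>' - 1 / \<rho>') \<inter> spectrum_wrt J T = {}"
  proof (rule ccontr)
    assume "\<not> ?thesis"
    then obtain z where z: "z \<in> sphere (of_real \<rho>') (\<rho>' - 1 / \<rho>')" "z \<in> spectrum_wrt J T" by blast
    then have "z \<in> ball (of_real \<rho>') (\<rho>' - 1 / \<rho>')" using sub' Re[of z] by auto
    then show False using z(1) by auto
  qed
qed

lemma pos_proj_riesz:
  assumes "clinear_op T" "1 < \<rho>" "\<rho> \<le> \<rho>'" "spectrum_wrt J T \<inter> {z. Re z > 0} \<subseteq> hp_disc \<rho>"
  shows "pos_proj T = riesz T (of_real \<rho>') (\<rho>' - 1 / \<rho>')"
  unfolding pos_proj_def using assms hp_radius_pos[of \<rho>']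
  by (intro spectral_projector_riesz hp_circle[OF assms(2-4)]) auto

lemma
  assumes "regular T"
  shows clinear_pos_proj: "clinear_op (pos_proj T)"
    and pos_proj_idempotent: "pos_proj T \<circ>\<^sub>L pos_proj T = pos_proj T"
    and pos_proj_commute_mod: "\<And>X I. operator_ideal I \<Longrightarrow> clinear_op X \<Longrightarrow> T \<circ>\<^sub>L X - X \<circ>\<^sub>L T \<in> I \<Longrightarrow> pos_proj T \<circ>\<^sub>L X - X \<circ>\<^sub>L pos_proj T \<in> I"
proof -
  obtain \<rho> where \<rho>: "\<rho> > 1" "spectrum_wrt J T \<inter> {z. Re z > 0} \<subseteq> hp_disc \<rho>" and T: "clinear_op T"
    using assms unfolding regular_def by blast
  note P = pos_proj_riesz[OF T \<rho>(1) order_refl \<rho>(2)]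
  note av = hp_radius_pos[OF \<rho>(1)] hp_circle(1)[OF \<rho>(1) order_refl \<rho>(2)]
  show "clinear_op (pos_proj T)" unfolding P by (rule clinear_riesz[OF T av])
  show "pos_proj T \<circ>\<^sub>L pos_proj T = pos_proj T" unfolding P by (rule riesz_idempotent[OF T av])
  show "pos_proj T \<circ>\<^sub>L X - X \<circ>\<^sub>L pos_proj T \<in> I" if "operator_ideal I" "clinear_op X" "T \<circ>\<^sub>L X - X \<circ>\<^sub>L T \<in> I" for X I
    unfolding P by (rule riesz_commute_mod[OF that(1) av that(2,3)])
qed

text \<open>The circle fixed for \<open>T\<close> may miss positive spectrum of \<open>T'\<close>
  close to the axis. On that circle the two Riesz projectors are close in norm; passing to a larger
  circle that is valid for \<open>T'\<close> changes the projector by a compact operator, as no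
  essential spectrum of \<open>T'\<close> lies in between.\<close>

lemma pos_proj_essentially_continuous:
  assumes T: "regular T" and \<eta>: "\<eta> > 0"
  shows "\<exists>e>0. \<forall>T'. regular T' \<and> norm (T' - T) < e \<longrightarrow>
    (\<exists>C. compact_operator C \<and> norm (pos_proj T' - pos_proj T - C) < \<eta>)"
proof -
  note I = operator_ideal_compact
  obtain \<rho>0 where \<rho>0: "\<rho>0 > 1" "spectrum_wrt J T \<inter> {z. Re z > 0} \<subseteq> hp_disc \<rho>0" and lin: "clinear_op T"
    and line: "\<And>z. Re z = 0 \<Longrightarrow> z \<in> resolvent_set_mod compacts T"
    using T unfolding regular_def by blast
  define c0 where "c0 = complex_of_real \<rho>0"
  define r0 where "r0 = \<rho>0 - 1 / \<rho>0"
  have r0: "r0 > 0" unfolding r0_def by (rule hp_radius_pos[OF \<rho>0(1)])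
  have av0: "sphere c0 r0 \<inter> spectrum_wrt J T = {}"
    unfolding c0_def r0_def by (rule hp_circle(1)[OF \<rho>0(1) order_refl \<rho>0(2)])
  have P0: "pos_proj T = riesz T c0 r0" unfolding c0_def r0_def by (rule pos_proj_riesz[OF lin \<rho>0(1) order_refl \<rho>0(2)])
  \<comment> \<open>Beyond this radius no \<open>T'\<close> within distance \<open>1\<close> of
    \<open>T\<close> has spectrum, so compactness is needed only up to \<open>M\<close>.\<close>
  define M where "M = (1 + norm J) * (norm T + 1)"
  \<comment> \<open>The axis belongs to \<open>K\<close>: discs for \<open>T'\<close> come
    arbitrarily close to it, and only a compact set yields a uniform neighbourhood of
    \<open>T\<close>.\<close>
  define K where "K = {z. Re z \<ge> 0} \<inter> (cball 0 M - ball c0 r0)"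
  have "compact K"
    unfolding K_def by (intro closed_Int_compact closed_halfspace_Re_ge compact_diff compact_cball open_ball)
  have "K \<subseteq> resolvent_set_mod compacts T"
  proof
    fix z assume z: "z \<in> K"
    show "z \<in> resolvent_set_mod compacts T"
    proof (cases "Re z = 0")
      case False
      then have "z \<notin> spectrum_wrt J T" using z \<rho>0(2) by (auto simp: K_def hp_disc_def c0_def r0_def)
      then show ?thesis using resolvent_set_mod_superset[OF I] by blast
    qed (rule line)
  qed
  from resolvent_set_mod_uniform[OF I \<open>compact K\<close> this]
  obtain e1 where e1: "e1 > 0" "\<And>T' w. norm (T' - T) < e1 \<Longrightarrow> w \<in> K \<Longrightarrow> w \<in> resolvent_set_mod compacts T'" by blast
  \<comment> \<open>Chosen to turn the factor in \<open>norm_riesz_diff_le\<close> into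
    \<open>\<eta> / 2\<close>.\<close>
  define \<delta> where "\<delta> = \<eta> / (2 * ((1 + norm J)\<^sup>2 * r0))"
  have J1: "1 + norm J > 0" by (simp add: add_pos_nonneg)
  have \<delta>: "\<delta> > 0" using \<eta> r0 J1 by (simp add: \<delta>_def)
  from resolvent_uniform[OF compact_sphere av0 \<delta>]
  obtain e2 where e2: "e2 > 0" "\<And>T' w. norm (T' - T) < e2 \<Longrightarrow> w \<in> sphere c0 r0 \<Longrightarrow>
      w \<notin> spectrum_wrt J T' \<and> norm (resolvent_wrt J T' w - resolvent_wrt J T w) \<le> \<delta>" by blast
  show ?thesis
  proof (intro exI[of _ "min 1 (min e1 e2)"] conjI allI impI)
    show "0 < min 1 (min e1 e2)" using e1 e2 by simp
    fix T' assume "regular T' \<and> norm (T' - T) < min 1 (min e1 e2)"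
    then have T': "regular T'" and n: "norm (T' - T) < 1" "norm (T' - T) < e1" "norm (T' - T) < e2" by auto
    obtain \<rho>1 where \<rho>1: "\<rho>1 > 1" "spectrum_wrt J T' \<inter> {z. Re z > 0} \<subseteq> hp_disc \<rho>1" and lin': "clinear_op T'"
      using T' unfolding regular_def by blast
    define \<rho> where "\<rho> = max \<rho>0 \<rho>1"
    have \<rho>: "\<rho>1 \<le> \<rho>" "\<rho>0 \<le> \<rho>" "\<rho> > 1" using \<rho>1(1) by (auto simp: \<rho>_def)
    define c where "c = complex_of_real \<rho>"
    define r where "r = \<rho> - 1 / \<rho>"
    have r: "r > 0" unfolding r_def by (rule hp_radius_pos[OF \<rho>(3)])
    have av: "sphere c r \<inter> spectrum_wrt J T' = {}" unfolding c_def r_def by (rule hp_circle(1)[OF \<rho>1(1) \<rho>(1) \<rho>1(2)])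
    have P: "pos_proj T' = riesz T' c r" unfolding c_def r_def by (rule pos_proj_riesz[OF lin' \<rho>1(1) \<rho>(1) \<rho>1(2)])
    have av0': "sphere c0 r0 \<inter> spectrum_wrt J T' = {}" using e2(2)[OF n(3)] by blast
    have "homotopic_loops (resolvent_set_mod compacts T') (circlepath c0 r0) (circlepath c r)"
    proof (rule homotopic_loops_circlepath_nested[OF r0])
      show "cmod (c - c0) + r0 \<le> r" unfolding c_def c0_def r_def r0_def by (rule hp_nested[OF \<rho>0(1) \<rho>(2)])
      fix z assume z: "r0 \<le> cmod (z - c0)" "cmod (z - c) \<le> r"
      have Re: "Re z > 0" using z(2) unfolding c_def r_def by (rule hp_cball_Re[OF \<rho>(3)])
      show "z \<in> resolvent_set_mod compacts T'"
      proof (cases "cmod z \<le> M")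
        case True
        then have "z \<in> K" using Re z(1) by (auto simp: K_def dist_norm norm_minus_commute)
        then show ?thesis using e1(2)[OF n(2)] by blast
      next
        case False
        have "norm T' \<le> norm T + 1" using n(1) norm_triangle_ineq2[of T' T] by linarith
        then have "(1 + norm J) * norm T' \<le> M" unfolding M_def using J1 by (intro mult_left_mono) auto
        then have "z \<notin> spectrum_wrt J T'" using False by (intro resolvent_large(1)) simp
        then show ?thesis using resolvent_set_mod_superset[OF I] by blast
      qed
    qed
    from riesz_homotopic[OF I lin' r0 av0' r av this]
    have "compact_operator (riesz T' c0 r0 - riesz T' c r)" by simp
    then have C: "compact_operator (riesz T' c r - riesz T' c0 r0)" by (simp add: compact_operator_minus_commute)
    have "norm (riesz T' c0 r0 - riesz T c0 r0) \<le> (1 + norm J)\<^sup>2 * r0 * \<delta>"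
      by (rule norm_riesz_diff_le[OF r0 av0 av0']) (use e2(2)[OF n(3)] in blast)
    also have "\<dots> = \<eta> / 2" using r0 J1 by (simp add: \<delta>_def)
    also have "\<dots> < \<eta>" using \<eta> by simp
    finally have "norm (pos_proj T' - pos_proj T - (riesz T' c r - riesz T' c0 r0)) < \<eta>" unfolding P P0 by simp
    with C show "\<exists>C. compact_operator C \<and> norm (pos_proj T' - pos_proj T - C) < \<eta>" by blast
  qed
qed

section \<open>Hyperbolic and essentially hyperbolic operators\<close>

lemma spectrum_bounded: "bounded (spectrum_wrt J T)"
  using resolvent_large(1)[of T] unfolding bounded_iff by (meson not_le)

text \<open>Without spectrum on the axis both halves of the spectrum are compact. A disc of the
  family and a reflected one enclose them; they lie in opposite half-planes, so
  \<open>riesz_sum\<close> applies.\<close>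

lemma regular_hyperbolic:
  assumes T: "clinear_op T" and hyp: "\<forall>z\<in>spectrum_wrt J T. Re z \<noteq> 0"
  shows "regular T"
    and "spectral_projector_wrt J T (spectrum_wrt J T \<inter> {z. Re z < 0}) = id_blinfun - pos_proj T"
proof -
  have "compact (spectrum_wrt J T \<inter> {z. Re z \<ge> 0})"
    using compact_eq_bounded_closed closed_spectrum spectrum_bounded
    by (intro compact_Int_closed closed_halfspace_Re_ge) blast
  moreover have "spectrum_wrt J T \<inter> {z. Re z \<ge> 0} = spectrum_wrt J T \<inter> {z. Re z > 0}"
    using hyp by force
  ultimately have cp: "compact (spectrum_wrt J T \<inter> {z. Re z > 0})" by simp
  obtain \<rho> where \<rho>: "\<rho> > 1" "spectrum_wrt J T \<inter> {z. Re z > 0} \<subseteq> hp_disc \<rho>"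
    by (rule hp_disc_exhaust[OF cp]) auto
  then show "regular T"
    using T hyp resolvent_set_mod_superset[OF operator_ideal_compact, of T] unfolding regular_def by blast
  have "compact (spectrum_wrt J T \<inter> {z. Re z \<le> 0})"
    using compact_eq_bounded_closed closed_spectrum spectrum_bounded
    by (intro compact_Int_closed closed_halfspace_Re_le) blast
  moreover have eqn: "spectrum_wrt J T \<inter> {z. Re z \<le> 0} = spectrum_wrt J T \<inter> {z. Re z < 0}"
    using hyp by force
  ultimately have cn: "compact (uminus ` (spectrum_wrt J T \<inter> {z. Re z < 0}))"
    by (intro compact_continuous_image continuous_intros) simp
  obtain \<rho>' where \<rho>': "\<rho>' > 1" "uminus ` (spectrum_wrt J T \<inter> {z. Re z < 0}) \<subseteq> hp_disc \<rho>'"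
    by (rule hp_disc_exhaust[OF cn]) auto
  define c where "c = complex_of_real \<rho>"
  define r where "r = \<rho> - 1 / \<rho>"
  define c' where "c' = - complex_of_real \<rho>'"
  define r' where "r' = \<rho>' - 1 / \<rho>'"
  have r: "r > 0" "r' > 0" unfolding r_def r'_def using hp_radius_pos \<rho>(1) \<rho>'(1) by blast+
  have Rp: "Re z > 0" if "z \<in> cball c r" for z
    using that unfolding c_def r_def by (intro hp_cball_Re[OF \<rho>(1)]) (simp add: dist_norm norm_minus_commute)
  have Rn: "Re z < 0" if "z \<in> cball c' r'" for z
  proof -
    have "- z - complex_of_real \<rho>' = - (z + complex_of_real \<rho>')" by simp
    then have "cmod (- z - complex_of_real \<rho>') = cmod (z + complex_of_real \<rho>')" by (simp only: norm_minus_cancel)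
    then have "Re (- z) > 0"
      using that unfolding c'_def r'_def by (intro hp_cball_Re[OF \<rho>'(1)]) (simp add: dist_norm norm_minus_commute algebra_simps)
    then show ?thesis by simp
  qed
  have disj: "cball c r \<inter> cball c' r' = {}" using Rp Rn by force
  have inp: "z \<in> ball c r" if "z \<in> spectrum_wrt J T" "Re z > 0" for z
    using that \<rho>(2) unfolding hp_disc_def c_def r_def by blast
  have inn: "z \<in> ball c' r'" if "z \<in> spectrum_wrt J T" "Re z < 0" for z
  proof -
    have "- z \<in> ball (complex_of_real \<rho>') r'" using that \<rho>'(2) unfolding hp_disc_def r'_def by blast
    then show ?thesis by (simp add: c'_def dist_norm norm_minus_commute algebra_simps)
  qed
  have sub: "spectrum_wrt J T \<subseteq> ball c r \<union> ball c' r'"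
    using inp inn hyp by (metis UnCI linorder_neqE_linordered_idom subsetI)
  have "spectral_projector_wrt J T (spectrum_wrt J T \<inter> {z. Re z < 0}) = riesz T c' r'"
  proof (rule spectral_projector_riesz[OF T r(2)])
    show "spectrum_wrt J T \<inter> ball c' r' = spectrum_wrt J T \<inter> {z. Re z < 0}"
      using inn Rn ball_subset_cball by blast
    have "z \<in> ball c' r'" if "z \<in> sphere c' r'" "z \<in> spectrum_wrt J T" for z
      using that Rn[of z] by (intro inn) auto
    then show "sphere c' r' \<inter> spectrum_wrt J T = {}" by force
  qed
  moreover have "pos_proj T = riesz T c r" unfolding c_def r_def by (rule pos_proj_riesz[OF T \<rho>(1) order_refl \<rho>(2)])
  ultimately show "spectral_projector_wrt J T (spectrum_wrt J T \<inter> {z. Re z < 0}) = id_blinfun - pos_proj T"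
    using riesz_sum[OF T r disj sub] by (simp add: algebra_simps)
qed

text \<open>The inverse of the corrected operator inverts the original one up to finite-rank terms,
  which are compact.\<close>

lemma weyl_resolvent_set_mod:
  assumes "weyl (sc z - T)"
  shows "z \<in> resolvent_set_mod compacts T"
proof -
  obtain n \<phi> f R where nf: "\<forall>i<n. vfunctional (\<phi> i)" "is_inverse_op (sc z - T + finite_rank n \<phi> f) R"
    by (rule weylE[OF assms]) blast
  let ?F = "finite_rank n \<phi> f"
  have F: "compact_operator ?F" using nf(1) by (intro compact_operator_finite_rank) blast
  have "(sc z - T) \<circ>\<^sub>L R - id_blinfun = - (?F \<circ>\<^sub>L R)"
  proof (rule blinfun_eqI)
    fix x have "(sc z - T + ?F) (R x) = x" by (rule is_inverse_op_apply(1)[OF nf(2)])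
    then have "x = (sc z - T) (R x) + ?F (R x)" by (simp add: blinfun.add_left)
    then show "((sc z - T) \<circ>\<^sub>L R - id_blinfun) x = (- (?F \<circ>\<^sub>L R)) x"
      by (simp add: blinfun.diff_left blinfun.minus_left algebra_simps)
  qed
  moreover have "R \<circ>\<^sub>L (sc z - T) - id_blinfun = - (R \<circ>\<^sub>L ?F)"
  proof (rule blinfun_eqI)
    fix x have "R ((sc z - T + ?F) x) = x" by (rule is_inverse_op_apply(2)[OF nf(2)])
    then have "x = R ((sc z - T) x) + R (?F x)" by (simp add: blinfun.add_left blinfun.add_right)
    then show "(R \<circ>\<^sub>L (sc z - T) - id_blinfun) x = (- (R \<circ>\<^sub>L ?F)) x"
      by (simp add: blinfun.diff_left blinfun.diff_right blinfun.minus_left algebra_simps)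
  qed
  ultimately have "inverse_mod compacts (sc z - T) R"
    unfolding inverse_mod_def using F
    by (simp add: compact_operator_uminus compact_operator_compose_left compact_operator_compose_right)
  then show ?thesis by (auto simp: resolvent_set_mod_def)
qed

text \<open>The point is that the positive spectrum is closed: it can only accumulate outside itself
  on the axis, where spectral points are isolated. Being bounded, it then fits into a disc of the
  family.\<close>

lemma regular_essentially_hyperbolic:
  assumes T: "clinear_op T" and F: "\<And>z. Re z = 0 \<Longrightarrow> fredholm (T - sc z)"
  shows "regular T"
proof -
  have F': "fredholm (sc (\<i> * of_real y) - T)" for y :: real
    using F[of "\<i> * of_real y"] fredholm_uminus[of "sc (\<i> * of_real y) - T"] by simp
  have im: "\<i> * of_real (Im z) = z" if "Re z = 0" for z using that by (simp add: complex_eq_iff)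
  have line: "z \<in> resolvent_set_mod compacts T" if "Re z = 0" for z
    using weyl_resolvent_set_mod[OF fredholm_line_weyl[OF T F', of "Im z"]] im[OF that] by simp
  let ?S = "spectrum_wrt J T \<inter> {z. Re z > 0}"
  have "closed ?S"
  proof -
    have "z \<in> ?S" if z: "z \<in> closure ?S" for z
    proof -
      have "closure ?S \<subseteq> spectrum_wrt J T \<inter> {z. Re z \<ge> 0}"
        by (intro closure_minimal closed_Int closed_spectrum closed_halfspace_Re_ge) auto
      then have zz: "z \<in> spectrum_wrt J T" "Re z \<ge> 0" using z by auto
      moreover have "Re z \<noteq> 0"
      proof
        assume R0: "Re z = 0"
        obtain e where e: "e > 0" "ball z e - {z} \<subseteq> - spectrum_wrt J T"
          using fredholm_line_isolated[OF T F', of "Im z"] im[OF R0] by auto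
        obtain w where w: "w \<in> ?S" "dist w z < e" using z e(1) unfolding closure_approachable by blast
        then have "w \<noteq> z" using R0 by auto
        then have "w \<in> - spectrum_wrt J T" using w(2) by (intro subsetD[OF e(2)]) (simp add: dist_commute)
        then show False using w(1) by blast
      qed
      ultimately show ?thesis by simp
    qed
    then show ?thesis by (metis closure_subset closure_eq subsetI subset_antisym)
  qed
  moreover have "bounded ?S" using spectrum_bounded[of T] by (rule bounded_subset) blast
  ultimately have "compact ?S" by (simp add: compact_eq_bounded_closed)
  then obtain \<rho> where "\<rho> > 1" "?S \<subseteq> hp_disc \<rho>" by (rule hp_disc_exhaust) auto
  then show ?thesis using T line unfolding regular_def by blast
qed

end

section \<open>Complexification\<close>

lemma complexify_apply: "complexify T p = (T (fst p), T (snd p))"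
  by (simp add: complexify.rep_eq)

lemma complexification_unit_apply: "complexification_unit p = (- snd p, fst p)"
  by (simp add: complexification_unit.rep_eq)

interpretation cx: complex_structure "complexification_unit :: ('a::banach \<times> 'a) \<Rightarrow>\<^sub>L ('a \<times> 'a)"
  by unfold_locales (simp add: complexification_unit_apply prod_eq_iff)

lemma complexify_diff: "complexify (S - T) = complexify S - complexify T"
  and complexify_compose: "complexify (S \<circ>\<^sub>L T) = complexify S \<circ>\<^sub>L complexify T"
  and complexify_id: "complexify id_blinfun = id_blinfun"
  by (rule blinfun_eqI; simp add: complexify_apply op_simps)+

lemma complexify_inject: "complexify S = complexify T \<longleftrightarrow> S = T"
proof
  assume eq: "complexify S = complexify T"
  show "S = T"
  proof (rule blinfun_eqI)
    fix x have "complexify S (x, 0) = complexify T (x, 0)" by (simp add: eq)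
    then show "S x = T x" by (simp add: complexify_apply)
  qed
qed simp

lemma norm_complexify_le: "norm (complexify T) \<le> norm T"
proof (rule norm_blinfun_bound)
  fix p
  have "(norm (T (fst p)))\<^sup>2 + (norm (T (snd p)))\<^sup>2 \<le> (norm T * norm (fst p))\<^sup>2 + (norm T * norm (snd p))\<^sup>2"
    by (intro add_mono power_mono norm_blinfun) auto
  also have "\<dots> = (norm T * norm p)\<^sup>2" by (simp add: norm_prod_def power_mult_distrib distrib_left)
  finally have "sqrt ((norm (T (fst p)))\<^sup>2 + (norm (T (snd p)))\<^sup>2) \<le> norm T * norm p"
    by (intro real_le_lsqrt) auto
  then show "norm (complexify T p) \<le> norm T * norm p" by (simp add: complexify_apply norm_prod_def)
qed simp

section \<open>Conjugation and real parts\<close>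

lift_definition pair_left :: "'a::real_normed_vector \<Rightarrow>\<^sub>L ('a \<times> 'a)" is "\<lambda>x. (x, 0)"
  by (intro bounded_linear_Pair bounded_linear_ident bounded_linear_zero)

lift_definition conjugation :: "('a::real_normed_vector \<times> 'a) \<Rightarrow>\<^sub>L ('a \<times> 'a)" is "\<lambda>p. (fst p, - snd p)"
  by (intro bounded_linear_Pair bounded_linear_minus bounded_linear_fst bounded_linear_snd)

text \<open>Defined for every operator on the product, so that compact corrections which are not
  complexifications can also be brought back to the real space.\<close>

definition real_part :: "(('a::real_normed_vector \<times> 'a) \<Rightarrow>\<^sub>L ('a \<times> 'a)) \<Rightarrow> 'a \<Rightarrow>\<^sub>L 'a" where
  "real_part X = fst_blinfun \<circ>\<^sub>L (X \<circ>\<^sub>L pair_left)"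

lemma real_part_apply: "real_part X x = fst (X (x, 0))"
  by (simp add: real_part_def pair_left.rep_eq)

lemma real_part_complexify: "real_part (complexify T) = T"
  by (rule blinfun_eqI) (simp add: real_part_apply complexify_apply)

lemma real_part_diff: "real_part (X - Y) = real_part X - real_part Y"
  by (rule blinfun_eqI) (simp add: real_part_apply op_simps)

lemma norm_real_part_le: "norm (real_part X) \<le> norm X"
proof (rule norm_blinfun_bound)
  fix x
  have "norm (fst (X (x, 0))) \<le> norm (X (x, 0))" by (metis norm_fst_le prod.collapse)
  also have "\<dots> \<le> norm X * norm (x, 0::'a)" by (rule norm_blinfun)
  finally show "norm (real_part X x) \<le> norm X * norm x" by (simp add: real_part_apply)
qed simp

lemma compact_operator_real_part: "compact_operator X \<Longrightarrow> compact_operator (real_part X)"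
  unfolding real_part_def by (intro compact_operator_compose_left compact_operator_compose_right)

lemma compact_operator_complexify: "compact_operator (complexify T) \<longleftrightarrow> compact_operator T"
proof
  assume "compact_operator T"
  then obtain K where K: "compact K" "T ` cball 0 1 \<subseteq> K" unfolding compact_operator_iff by blast
  have "complexify T ` cball 0 1 \<subseteq> K \<times> K"
  proof (rule image_subsetI)
    fix p :: "'a \<times> 'a" assume "p \<in> cball 0 1"
    then have "norm (fst p) \<le> 1" "norm (snd p) \<le> 1"
      using norm_fst_le[of "fst p" "snd p"] norm_snd_le[of "snd p" "fst p"] by simp_all
    then show "complexify T p \<in> K \<times> K" using K(2) by (auto simp: complexify_apply)
  qed
  then show "compact_operator (complexify T)" unfolding compact_operator_iff using compact_Times[OF K(1) K(1)] by blast
next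
  assume "compact_operator (complexify T)"
  from compact_operator_real_part[OF this] show "compact_operator T" by (simp add: real_part_complexify)
qed

lemma clinear_complexify: "cx.clinear_op (complexify T)"
  by (simp add: cx.clinear_op_def complexify_apply complexification_unit_apply blinfun.minus_right)

lemma conjugation_simps:
  "conjugation (conjugation p) = p" "conjugation (complexification_unit p) = - complexification_unit (conjugation p)"
  "conjugation (complexify T p) = complexify T (conjugation p)" "conjugation (cx.sc z p) = cx.sc (cnj z) (conjugation p)"
  by (simp_all add: conjugation.rep_eq complexification_unit_apply complexify_apply cx.sc_apply blinfun.minus_right)

text \<open>Commuting with conjugation keeps real vectors real; complex linearity then determines
  the operator on imaginary ones.\<close>

lemma commutes_complexify:
  assumes "cx.clinear_op P" and "\<And>p. P (conjugation p) = conjugation (P p)"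
  shows "complexify (real_part P) = P"
proof (rule blinfun_eqI)
  fix p :: "'a \<times> 'a"
  have left: "P (x, 0) = (real_part P x, 0)" for x
  proof -
    have "conjugation (P (x, 0)) = P (x, 0)" using assms(2)[of "(x, 0)"] by (simp add: conjugation.rep_eq)
    then have "- snd (P (x, 0)) = snd (P (x, 0))" by (simp add: conjugation.rep_eq prod_eq_iff)
    then have "2 *\<^sub>R snd (P (x, 0)) = 0" by (metis add.right_inverse scaleR_2)
    then show ?thesis by (simp add: real_part_apply prod_eq_iff)
  qed
  have right: "P (0, y) = (0, real_part P y)" for y
  proof -
    have "P (complexification_unit (y, 0)) = complexification_unit (P (y, 0))"
      using assms(1) by (simp add: cx.clinear_op_def)
    then show ?thesis by (simp add: complexification_unit_apply left)
  qed
  have "P p = P (fst p, 0) + P (0, snd p)" by (simp flip: blinfun.add_right)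
  then show "complexify (real_part P) p = P p" by (simp add: complexify_apply left right)
qed

text \<open>Conjugation sends the resolvent at \<open>z\<close> to the one at \<open>cnj z\<close>,
  and a circle with real centre to itself with reversed orientation. The sign from the orientation
  is cancelled by that of the conjugated factor \<open>1 / (2 * pi * \<i>)\<close>.\<close>

lemma riesz_complexify_conjugation:
  assumes r: "r > 0" "sphere (of_real \<rho>) r \<inter> spectrum_wrt complexification_unit (complexify T) = {}"
  shows "conjugation \<circ>\<^sub>L (cx.riesz (complexify T) (of_real \<rho>) r \<circ>\<^sub>L conjugation) = cx.riesz (complexify T) (of_real \<rho>) r"
proof (rule cx.eq_if_functionals)
  fix \<psi> :: "(('a \<times> 'a) \<Rightarrow>\<^sub>L ('a \<times> 'a)) \<Rightarrow> complex" assume \<psi>: "cx.functional \<psi>"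
  let ?J = "complexification_unit :: ('a \<times> 'a) \<Rightarrow>\<^sub>L ('a \<times> 'a)"
  let ?T = "complexify T" and ?c = "complex_of_real \<rho>"
  let ?R = "resolvent_wrt ?J ?T"
  let ?k = "1 / (2 * of_real pi * \<i>)"
  let ?g = "\<lambda>z. \<psi> (?R z)"
  \<comment> \<open>The outer \<open>cnj\<close> compensates for the antilinearity of conjugation,
    so \<open>?\<theta>\<close> is again a complex-linear functional and can be taken under the
    integral.\<close>
  let ?\<theta> = "\<lambda>X. cnj (\<psi> (conjugation \<circ>\<^sub>L (X \<circ>\<^sub>L conjugation)))"
  have bl: "bounded_linear \<psi>" and hom: "\<And>X. \<psi> (?J \<circ>\<^sub>L X) = \<i> * \<psi> X" using \<psi> by (auto simp: cx.functional_def)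
  have "bounded_linear ?\<theta>"
    by (rule bounded_linear_compose[OF bounded_linear_cnj bounded_linear_compose[OF bl
        bounded_linear_compose[OF bounded_bilinear.bounded_linear_right[OF bounded_bilinear_blinfun_compose]
          bounded_bilinear.bounded_linear_left[OF bounded_bilinear_blinfun_compose]]]])
  moreover have eq: "conjugation \<circ>\<^sub>L ((?J \<circ>\<^sub>L X) \<circ>\<^sub>L conjugation) = ?J \<circ>\<^sub>L (- (conjugation \<circ>\<^sub>L (X \<circ>\<^sub>L conjugation)))" for X
    by (rule blinfun_eqI) (simp add: conjugation_simps blinfun.minus_left blinfun.minus_right)
  ultimately have \<theta>: "cx.functional ?\<theta>"
    unfolding cx.functional_def eq hom cx.functional_uminus[OF \<psi>] by simp
  have res: "conjugation \<circ>\<^sub>L (?R z \<circ>\<^sub>L conjugation) = ?R (cnj z)" if "z \<notin> spectrum_wrt ?J ?T" for z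
  proof (rule cx.resolvent_wrt_eqI[symmetric], rule is_inverse_opI)
    fix p
    have *: "conjugation ((cx.sc z - ?T) q) = (cx.sc (cnj z) - ?T) (conjugation q)" for q
      by (simp add: blinfun.diff_left blinfun.diff_right conjugation_simps)
    have inv: "(cx.sc z - ?T) (?R z q) = q" "?R z ((cx.sc z - ?T) q) = q" for q
      using is_inverse_op_apply[OF cx.resolvent_inverse[OF that]] by auto
    show "(cx.sc (cnj z) - ?T) ((conjugation \<circ>\<^sub>L (?R z \<circ>\<^sub>L conjugation)) p) = p"
      using *[of "?R z (conjugation p)"] by (simp add: inv conjugation_simps)
    have "conjugation ((cx.sc (cnj z) - ?T) p) = (cx.sc z - ?T) (conjugation p)"
      using *[of "conjugation p"] conjugation_simps(1) by metis
    then show "(conjugation \<circ>\<^sub>L (?R z \<circ>\<^sub>L conjugation)) ((cx.sc (cnj z) - ?T) p) = p"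
      by (simp add: inv conjugation_simps)
  qed
  have cnjs: "cnj z \<in> sphere ?c r" if "z \<in> sphere ?c r" for z
  proof -
    have "cmod (?c - cnj z) = cmod (cnj (?c - z))" by simp
    then show ?thesis using that by (simp only: complex_mod_cnj mem_sphere dist_norm)
  qed
  have "contour_integral (circlepath ?c r) (\<lambda>z. ?\<theta> (?R z)) = contour_integral (circlepath ?c r) (cnj \<circ> ?g \<circ> cnj)"
  proof (rule contour_integral_cong[OF refl])
    fix z assume "z \<in> path_image (circlepath ?c r)"
    then have "z \<notin> spectrum_wrt ?J ?T" using r by auto
    then show "?\<theta> (?R z) = (cnj \<circ> ?g \<circ> cnj) z" by (simp add: res)
  qed
  also have "\<dots> = cnj (contour_integral (cnj \<circ> circlepath ?c r) ?g)"
    by (simp add: contour_integral_cnj[OF valid_path_circlepath])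
  \<comment> \<open>This is where the centre has to be real.\<close>
  also have "cnj \<circ> circlepath ?c r = reversepath (circlepath ?c r)"
  proof
    fix t
    have "exp (2 * of_real pi * \<i> * complex_of_real (1 - t)) = exp (2 * of_real pi * \<i>) * exp (- (2 * of_real pi * \<i> * complex_of_real t))"
    proof -
      have "2 * of_real pi * \<i> * complex_of_real (1 - t) = 2 * of_real pi * \<i> + - (2 * of_real pi * \<i> * complex_of_real t)"
        by (simp add: algebra_simps)
      then show ?thesis by (simp only: exp_add)
    qed
    also have "\<dots> = cnj (exp (2 * of_real pi * \<i> * complex_of_real t))" by (simp add: exp_cnj)
    finally show "(cnj \<circ> circlepath ?c r) t = reversepath (circlepath ?c r) t" by (simp add: circlepath reversepath_def)
  qed
  finally have "contour_integral (circlepath ?c r) (\<lambda>z. ?\<theta> (?R z)) = cnj (- contour_integral (circlepath ?c r) ?g)"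
    by (simp add: contour_integral_reversepath)
  then have "cnj (?\<theta> (cx.riesz ?T ?c r)) = cnj (?k * cnj (- contour_integral (circlepath ?c r) ?g))"
    using cx.functional_riesz[OF \<theta> _ r(2)] r(1) by simp
  also have "\<dots> = ?k * contour_integral (circlepath ?c r) ?g" by simp
  also have "\<dots> = \<psi> (cx.riesz ?T ?c r)" using cx.functional_riesz[OF \<psi> _ r(2)] r(1) by simp
  finally show "\<psi> (conjugation \<circ>\<^sub>L (cx.riesz ?T ?c r \<circ>\<^sub>L conjugation)) = \<psi> (cx.riesz ?T ?c r)" by simp
qed

lemma pos_proj_complexify:
  assumes "cx.regular (complexify T)"
  shows "complexify (real_part (cx.pos_proj (complexify T))) = cx.pos_proj (complexify T)"
proof (rule commutes_complexify[OF cx.clinear_pos_proj[OF assms]])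
  obtain \<rho> where \<rho>: "\<rho> > 1" "spectrum_wrt complexification_unit (complexify T) \<inter> {z. Re z > 0} \<subseteq> hp_disc \<rho>"
    using assms unfolding cx.regular_def by blast
  have "conjugation \<circ>\<^sub>L (cx.pos_proj (complexify T) \<circ>\<^sub>L conjugation) = cx.pos_proj (complexify T)"
    unfolding cx.pos_proj_riesz[OF clinear_complexify \<rho>(1) order_refl \<rho>(2)]
    by (rule riesz_complexify_conjugation[OF hp_radius_pos[OF \<rho>(1)] cx.hp_circle(1)[OF \<rho>(1) order_refl \<rho>(2)]])
  then have "conjugation (cx.pos_proj (complexify T) (conjugation p)) = cx.pos_proj (complexify T) p" for p
    by (metis blinfun_apply_blinfun_compose)
  then show "cx.pos_proj (complexify T) (conjugation p) = conjugation (cx.pos_proj (complexify T) p)" for p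
    by (metis conjugation_simps(1))
qed

section \<open>Positive projectors over both kinds of scalars\<close>

text \<open>The first alternative is met by the values of the path, the second by its
  limits.\<close>

definition admissible :: "('a::banach \<Rightarrow>\<^sub>L 'a) scalars \<Rightarrow> ('a \<Rightarrow>\<^sub>L 'a) \<Rightarrow> bool" where
  "admissible K T \<longleftrightarrow> T \<in> operators K \<and> (essentially_hyperbolic K T \<or> (\<forall>z\<in>spectrum K T. Re z \<noteq> 0))"

lemma regular_complexify: "admissible Real_Scalars T \<Longrightarrow> cx.regular (complexify T)"
  unfolding admissible_def
  using cx.regular_hyperbolic(1)[OF clinear_complexify, of T] cx.regular_essentially_hyperbolic[OF clinear_complexify, of T]
  by auto

text \<open>The description in the definition of the real projector has a solution by invariance
  under conjugation, and only one because \<open>complexify\<close> is injective.\<close>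

lemma pos_projector_Real:
  assumes "admissible Real_Scalars T"
  shows "complexify (pos_projector Real_Scalars T) = cx.pos_proj (complexify T)"
proof -
  have ex: "complexify (real_part (cx.pos_proj (complexify T))) = cx.pos_proj (complexify T)"
    by (rule pos_proj_complexify[OF regular_complexify[OF assms]])
  have "pos_projector Real_Scalars T = (THE P. complexify P = cx.pos_proj (complexify T))"
    by (simp add: pos_projector_def cx.pos_proj_def)
  also have "\<dots> = real_part (cx.pos_proj (complexify T))"
  proof (rule the_equality)
    show "P = real_part (cx.pos_proj (complexify T))" if "complexify P = cx.pos_proj (complexify T)" for P
      using that real_part_complexify[of P] by simp
  qed (rule ex)
  finally show ?thesis using ex by simp
qed

context complex_structure
begin

lemma regular_admissible: "admissible (Complex_Scalars J) T \<Longrightarrow> regular T"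
  unfolding admissible_def
  using regular_hyperbolic(1)[of T] regular_essentially_hyperbolic[of T] by (auto simp: clinear_op_def)

lemma pos_projector_Complex: "pos_projector (Complex_Scalars J) T = pos_proj T"
  by (simp add: pos_projector_def pos_proj_def)

lemma operators_Complex: "T \<in> operators (Complex_Scalars J) \<longleftrightarrow> clinear_op T"
  by (simp add: clinear_op_def)

end

lemma banach_over_complex_structure: "banach_over (Complex_Scalars J) \<Longrightarrow> complex_structure J"
  by unfold_locales simp

lemma pos_projector_operators:
  assumes "banach_over K" "admissible K T" shows "pos_projector K T \<in> operators K"
proof (cases K)
  case (Complex_Scalars J)
  interpret complex_structure J 
    by (rule banach_over_complex_structure) (use assms(1) in \<open>simp only: Complex_Scalars\<close>)
  show ?thesis unfolding Complex_Scalars operators_Complex pos_projector_Complex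
    using assms(2) unfolding Complex_Scalars by (intro clinear_pos_proj regular_admissible)
qed simp

lemma pos_projector_idempotent:
  assumes "banach_over K" "admissible K T"
  shows "pos_projector K T \<circ>\<^sub>L pos_projector K T = pos_projector K T"
proof (cases K)
  case Real_Scalars
  have a: "admissible Real_Scalars T" using assms(2) Real_Scalars by simp
  have "complexify (pos_projector K T \<circ>\<^sub>L pos_projector K T) = complexify (pos_projector K T)"
    unfolding Real_Scalars complexify_compose pos_projector_Real[OF a]
    by (rule cx.pos_proj_idempotent[OF regular_complexify[OF a]])
  then show ?thesis by (simp add: complexify_inject)
next
  case (Complex_Scalars J)
  interpret complex_structure J 
    by (rule banach_over_complex_structure) (use assms(1) in \<open>simp only: Complex_Scalars\<close>)
  show ?thesis unfolding Complex_Scalars pos_projector_Complex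
    using assms(2) unfolding Complex_Scalars by (intro pos_proj_idempotent regular_admissible)
qed

lemma pos_projector_commute_mod_compact:
  assumes "banach_over K" "admissible K T" "X \<in> operators K" "compact_operator (T \<circ>\<^sub>L X - X \<circ>\<^sub>L T)"
  shows "compact_operator (pos_projector K T \<circ>\<^sub>L X - X \<circ>\<^sub>L pos_projector K T)"
proof (cases K)
  case Real_Scalars
  have a: "admissible Real_Scalars T" using assms(2) Real_Scalars by simp
  have "complexify T \<circ>\<^sub>L complexify X - complexify X \<circ>\<^sub>L complexify T \<in> compacts"
    using assms(4) by (simp add: compact_operator_complexify flip: complexify_compose complexify_diff)
  from cx.pos_proj_commute_mod[OF regular_complexify[OF a] operator_ideal_compact clinear_complexify this]
  have "compact_operator (complexify (pos_projector K T \<circ>\<^sub>L X - X \<circ>\<^sub>L pos_projector K T))"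
    by (simp add: Real_Scalars complexify_compose complexify_diff pos_projector_Real[OF a])
  then show ?thesis by (simp add: compact_operator_complexify)
next
  case (Complex_Scalars J)
  interpret complex_structure J 
    by (rule banach_over_complex_structure) (use assms(1) in \<open>simp only: Complex_Scalars\<close>)
  have "regular T" using assms(2) unfolding Complex_Scalars by (rule regular_admissible)
  moreover have "clinear_op X" using assms(3) unfolding Complex_Scalars operators_Complex .
  ultimately have "pos_proj T \<circ>\<^sub>L X - X \<circ>\<^sub>L pos_proj T \<in> compacts"
    using assms(4) by (intro pos_proj_commute_mod operator_ideal_compact) auto
  then show ?thesis by (simp add: Complex_Scalars pos_projector_Complex)
qed

lemma pos_projector_essentially_continuous:
  assumes "banach_over K" "admissible K T" and \<eta>: "\<eta> > 0"
  shows "\<exists>e>0. \<forall>T'. admissible K T' \<and> norm (T' - T) < e \<longrightarrow>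
    (\<exists>C. compact_operator C \<and> norm (pos_projector K T' - pos_projector K T - C) < \<eta>)"
proof (cases K)
  case Real_Scalars
  have a: "admissible Real_Scalars T" using assms(2) Real_Scalars by simp
  obtain e where e: "e > 0" "\<And>T'. cx.regular T' \<Longrightarrow> norm (T' - complexify T) < e \<Longrightarrow>
      \<exists>C. compact_operator C \<and> norm (cx.pos_proj T' - cx.pos_proj (complexify T) - C) < \<eta>"
    using cx.pos_proj_essentially_continuous[OF regular_complexify[OF a] \<eta>] by blast
  have "\<exists>C. compact_operator C \<and> norm (pos_projector K T' - pos_projector K T - C) < \<eta>"
    if T': "admissible K T'" "norm (T' - T) < e" for T'
  proof -
    have a': "admissible Real_Scalars T'" using T'(1) Real_Scalars by simp
    have "norm (complexify T' - complexify T) < e"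
      using norm_complexify_le[of "T' - T"] T'(2) by (simp add: complexify_diff)
    from e(2)[OF regular_complexify[OF a'] this] obtain C where C: "compact_operator C"
      "norm (cx.pos_proj (complexify T') - cx.pos_proj (complexify T) - C) < \<eta>" by blast
    have "pos_projector K T' - pos_projector K T - real_part C
        = real_part (cx.pos_proj (complexify T') - cx.pos_proj (complexify T) - C)"
      unfolding Real_Scalars pos_projector_Real[OF a, symmetric] pos_projector_Real[OF a', symmetric]
      by (simp add: real_part_diff real_part_complexify)
    then have "norm (pos_projector K T' - pos_projector K T - real_part C) < \<eta>"
      using norm_real_part_le[of "cx.pos_proj (complexify T') - cx.pos_proj (complexify T) - C"] C(2) by simp
    then show ?thesis using compact_operator_real_part[OF C(1)] by blast
  qed
  then show ?thesis using e(1) by blast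
next
  case (Complex_Scalars J)
  interpret complex_structure J 
    by (rule banach_over_complex_structure) (use assms(1) in \<open>simp only: Complex_Scalars\<close>)
  have "regular T" using assms(2) unfolding Complex_Scalars by (rule regular_admissible)
  from pos_proj_essentially_continuous[OF this \<eta>] show ?thesis
    unfolding Complex_Scalars pos_projector_Complex using regular_admissible by blast
qed

lemma neg_projector_hyperbolic:
  assumes "banach_over K" "T \<in> operators K" and hyp: "\<forall>z\<in>spectrum K T. Re z \<noteq> 0"
  shows "neg_projector K T = id_blinfun - pos_projector K T"
proof (cases K)
  case Real_Scalars
  have a: "admissible Real_Scalars T" using assms(2) hyp Real_Scalars by (simp add: admissible_def)
  have "spectral_projector_wrt complexification_unit (complexify T) (spectrum_wrt complexification_unit (complexify T) \<inter> {z. Re z < 0})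
      = id_blinfun - cx.pos_proj (complexify T)"
    using hyp unfolding Real_Scalars by (intro cx.regular_hyperbolic(2) clinear_complexify) simp
  also have "\<dots> = complexify (id_blinfun - pos_projector Real_Scalars T)"
    by (simp add: complexify_diff complexify_id pos_projector_Real[OF a])
  finally have eq: "neg_projector K T = (THE P. complexify P = complexify (id_blinfun - pos_projector Real_Scalars T))"
    by (simp add: neg_projector_def Real_Scalars)
  show ?thesis unfolding eq complexify_inject by (simp add: Real_Scalars)
next
  case (Complex_Scalars J)
  interpret complex_structure J 
    by (rule banach_over_complex_structure) (use assms(1) in \<open>simp only: Complex_Scalars\<close>)
  have "clinear_op T" using assms(2) unfolding Complex_Scalars operators_Complex .
  then show ?thesis
    using regular_hyperbolic(2)[of T] hyp by (simp add: Complex_Scalars pos_projector_Complex neg_projector_def)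
qed

text \<open>Guarantees that norm limits of the path are linear over the same scalars.\<close>

lemma closed_operators:
  fixes K :: "('a::banach \<Rightarrow>\<^sub>L 'a) scalars"
  shows "closed (operators K)"
proof (cases K)
  case (Complex_Scalars J)
  have "operators K = (\<Inter>x. {T :: 'a \<Rightarrow>\<^sub>L 'a. T (J x) - J (T x) = 0})" by (auto simp: Complex_Scalars)
  moreover have "closed {T :: 'a \<Rightarrow>\<^sub>L 'a. T (J x) - J (T x) = 0}" for x
    by (intro closed_Collect_eq continuous_intros)
  ultimately show ?thesis by (simp add: closed_INT)
qed simp

lemma operators_compose: "S \<in> operators K \<Longrightarrow> T \<in> operators K \<Longrightarrow> S \<circ>\<^sub>L T \<in> operators K"
  and operators_add: "S \<in> operators K \<Longrightarrow> T \<in> operators K \<Longrightarrow> S + T \<in> operators K"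
  and operators_id_diff: "T \<in> operators K \<Longrightarrow> id_blinfun - T \<in> operators K"
  by (cases K; simp add: op_simps)+

section \<open>Essentially splitting paths\<close>

text \<open>An operator compatible with the splitting commutes with its projector, and conversely
  \<open>T\<close> differs from \<open>P T P + (I - P) T (I - P)\<close> only by products with the commutator of \<open>T\<close> and \<open>P\<close>.\<close>

lemma essential_splitting_iff:
  fixes P T :: "'a::banach \<Rightarrow>\<^sub>L 'a"
  assumes P: "P \<in> operators K" "P \<circ>\<^sub>L P = P" and T: "T \<in> operators K"
  shows "essential_splitting K T (range P) (range (id_blinfun - P)) \<longleftrightarrow> compact_operator (T \<circ>\<^sub>L P - P \<circ>\<^sub>L T)"
proof -
  have PP: "P (P x) = P x" for x using P(2) by (metis blinfun_apply_blinfun_compose)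
  have r1: "y \<in> range P \<longleftrightarrow> P y = y" for y using PP by (metis rangeE rangeI)
  have r2: "y \<in> range (id_blinfun - P) \<longleftrightarrow> P y = 0" for y
  proof
    assume "y \<in> range (id_blinfun - P)"
    then obtain x where "y = x - P x" by (auto simp: blinfun.diff_left)
    then show "P y = 0" by (simp add: blinfun.diff_right PP)
  next
    assume "P y = 0"
    then have "y = (id_blinfun - P) y" by (simp add: blinfun.diff_left)
    then show "y \<in> range (id_blinfun - P)" by (metis rangeI)
  qed
  have s1: "range P = {y. P y = y}" and s2: "range (id_blinfun - P) = {y. P y = 0}" using r1 r2 by blast+
  have sp: "splitting K (range P) (range (id_blinfun - P))"
    unfolding splitting_def s1 s2
  proof (intro conjI)
    have J: "P (J x) = J (P x)" if "K = Complex_Scalars J" for J x using P(1) that by simp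
    show "subspace_over K {y. P y = y}" "subspace_over K {y. P y = 0}"
      using J by (cases K; auto simp: subspace_def op_simps)+
    show "closed {y. P y = y}" "closed {y. P y = 0}" by (intro closed_Collect_eq continuous_intros)+
    show "{y. P y = y} \<inter> {y. P y = 0} = {0}" by (auto simp: blinfun.zero_right)
    show "\<forall>x. \<exists>u\<in>{y. P y = y}. \<exists>v\<in>{y. P y = 0}. x = u + v"
    proof
      fix x show "\<exists>u\<in>{y. P y = y}. \<exists>v\<in>{y. P y = 0}. x = u + v"
        by (rule bexI[of _ "P x"], rule bexI[of _ "x - P x"]) (simp_all add: PP blinfun.diff_right)
    qed
  qed
  show ?thesis
  proof
    assume "essential_splitting K T (range P) (range (id_blinfun - P))"
    then obtain T0 where T0: "compact_operator (T - T0)" "T0 ` range P \<subseteq> range P" "T0 ` range (id_blinfun - P) \<subseteq> range (id_blinfun - P)"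
      unfolding essential_splitting_def by blast
    have "T0 (P x) = P (T0 x)" for x
    proof -
      have "T0 (P x) \<in> range P" using T0(2) by blast
      then have a: "P (T0 (P x)) = T0 (P x)" by (simp only: r1)
      have "T0 ((id_blinfun - P) x) \<in> range (id_blinfun - P)" using T0(3) by blast
      then have "P (T0 ((id_blinfun - P) x)) = 0" by (simp only: r2)
      then show ?thesis using a by (simp add: blinfun.diff_left blinfun.diff_right)
    qed
    then have "T \<circ>\<^sub>L P - P \<circ>\<^sub>L T = (T - T0) \<circ>\<^sub>L P - P \<circ>\<^sub>L (T - T0)"
      by (intro blinfun_eqI) (simp add: op_simps)
    then show "compact_operator (T \<circ>\<^sub>L P - P \<circ>\<^sub>L T)"
      using T0(1) by (simp add: compact_operator_diff compact_operator_compose_left compact_operator_compose_right)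
  next
    assume c: "compact_operator (T \<circ>\<^sub>L P - P \<circ>\<^sub>L T)"
    define Q where "Q = id_blinfun - P"
    define T0 where "T0 = P \<circ>\<^sub>L (T \<circ>\<^sub>L P) + Q \<circ>\<^sub>L (T \<circ>\<^sub>L Q)"
    have "T0 \<in> operators K"
      unfolding T0_def Q_def by (intro operators_add operators_compose operators_id_diff P(1) T)
    moreover have "T - T0 = Q \<circ>\<^sub>L ((T \<circ>\<^sub>L P - P \<circ>\<^sub>L T) \<circ>\<^sub>L P) - P \<circ>\<^sub>L ((T \<circ>\<^sub>L P - P \<circ>\<^sub>L T) \<circ>\<^sub>L Q)"
      unfolding T0_def Q_def by (rule blinfun_eqI) (simp add: op_simps PP)
    then have "compact_operator (T - T0)"
      using c by (simp add: compact_operator_diff compact_operator_compose_left compact_operator_compose_right)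
    moreover have "T0 ` range P \<subseteq> range P" "T0 ` range (id_blinfun - P) \<subseteq> range (id_blinfun - P)"
      unfolding s1 s2 by (auto simp: T0_def Q_def op_simps PP)
    ultimately show "essential_splitting K T (range P) (range (id_blinfun - P))"
      unfolding essential_splitting_def using sp by blast
  qed
qed

text \<open>Modulo compact operators, the difference \<open>d\<close> of two commuting projectors satisfies \<open>d\<^sup>3 = d\<close>,
  and then \<open>d = 0\<close> as soon as its essential norm is less than \<open>1\<close>.\<close>

lemma projector_difference_cube:
  fixes P Q :: "'a::banach \<Rightarrow>\<^sub>L 'a"
  assumes P: "P \<circ>\<^sub>L P = P" and Q: "Q \<circ>\<^sub>L Q = Q" and c: "compact_operator (Q \<circ>\<^sub>L P - P \<circ>\<^sub>L Q)"
  shows "compact_operator ((Q - P) \<circ>\<^sub>L ((Q - P) \<circ>\<^sub>L (Q - P)) - (Q - P))"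
proof -
  have PP: "P (P x) = P x" and QQ: "Q (Q x) = Q x" for x using P Q by (metis blinfun_apply_blinfun_compose)+
  have "(Q - P) \<circ>\<^sub>L ((Q - P) \<circ>\<^sub>L (Q - P)) - (Q - P)
      = P \<circ>\<^sub>L (Q \<circ>\<^sub>L P - P \<circ>\<^sub>L Q) + Q \<circ>\<^sub>L (Q \<circ>\<^sub>L P - P \<circ>\<^sub>L Q) - (Q \<circ>\<^sub>L P - P \<circ>\<^sub>L Q)"
    by (rule blinfun_eqI) (simp add: op_simps PP QQ)
  then show ?thesis
    using c by (simp add: compact_operator_diff compact_operator_add compact_operator_compose_left)
qed

text \<open>\<open>D\<close> is replaced by its representative \<open>X = D - C\<close> of norm less
  than \<open>1\<close>, for which the cubic relation persists modulo compact operators. As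
  \<open>id - X\<^sup>2\<close> is invertible,
  \<open>X = - (X\<^sup>3 - X) (id - X\<^sup>2)\<inverse>\<close> is compact.\<close>

lemma compact_operator_essentially_small:
  fixes D :: "'a::banach \<Rightarrow>\<^sub>L 'a"
  assumes D: "compact_operator (D \<circ>\<^sub>L (D \<circ>\<^sub>L D) - D)" and C: "compact_operator C" and small: "norm (D - C) < 1"
  shows "compact_operator D"
proof -
  define X where "X = D - C"
  have "X \<circ>\<^sub>L (X \<circ>\<^sub>L X) - X = (D \<circ>\<^sub>L (D \<circ>\<^sub>L D) - D) + C - (C \<circ>\<^sub>L (D \<circ>\<^sub>L D) + X \<circ>\<^sub>L (C \<circ>\<^sub>L D) + X \<circ>\<^sub>L (X \<circ>\<^sub>L C))"
    unfolding X_def by (rule blinfun_eqI) (simp add: op_simps)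
  then have cX: "compact_operator (X \<circ>\<^sub>L (X \<circ>\<^sub>L X) - X)"
    using C D by (simp add: compact_operator_diff compact_operator_add compact_operator_compose_left compact_operator_compose_right)
  have "norm (X \<circ>\<^sub>L X) \<le> norm X * norm X" by (rule norm_blinfun_compose)
  also have "\<dots> < 1" using small mult_strict_mono[of "norm X" 1 "norm X" 1] by (simp add: X_def)
  finally obtain Y where Y: "is_inverse_op (id_blinfun - X \<circ>\<^sub>L X) Y" using neumann_inverse by blast
  have "X = - ((X \<circ>\<^sub>L (X \<circ>\<^sub>L X) - X) \<circ>\<^sub>L Y)"
  proof (rule blinfun_eqI)
    fix x
    have "(id_blinfun - X \<circ>\<^sub>L X) (Y x) = x" by (rule is_inverse_op_apply(1)[OF Y])
    then have "X x = X (Y x - X (X (Y x)))" by (simp add: blinfun.diff_left)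
    then show "X x = (- ((X \<circ>\<^sub>L (X \<circ>\<^sub>L X) - X) \<circ>\<^sub>L Y)) x" by (simp add: op_simps)
  qed
  then have "compact_operator X"
    using compact_operator_uminus[OF compact_operator_compose_right[OF cX, of Y]] by metis
  then show ?thesis using compact_operator_add[OF _ C, of X] by (simp add: X_def)
qed

text \<open>Compactness of \<open>D t\<close> is locally constant on \<open>S\<close>, because a
  change of essential norm less than \<open>1\<close> cannot alter it, and it holds near the limit.
  The filter \<open>F\<close> and the set \<open>S\<close> stand for either end of the line.\<close>

lemma pos_projector_half_line:
  fixes A :: "real \<Rightarrow> 'a::banach \<Rightarrow>\<^sub>L 'a"
  assumes K: "banach_over K" and adm: "\<And>t. admissible K (A t)" and cont: "continuous_on UNIV A"
    and L: "admissible K L" "(A \<longlongrightarrow> L) F" "F \<noteq> bot"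
    and S: "connected S" "\<forall>\<^sub>F t in F. t \<in> S"
    and comm: "\<And>t. t \<in> S \<Longrightarrow> compact_operator (A t \<circ>\<^sub>L pos_projector K L - pos_projector K L \<circ>\<^sub>L A t)"
    and t: "t \<in> S"
  shows "compact_operator (pos_projector K (A t) - pos_projector K L)"
proof -
  define D where "D = (\<lambda>t. pos_projector K (A t) - pos_projector K L)"
  have D3: "compact_operator (D s \<circ>\<^sub>L (D s \<circ>\<^sub>L D s) - D s)" if "s \<in> S" for s
    unfolding D_def
    by (intro projector_difference_cube pos_projector_idempotent K adm L(1)
        pos_projector_commute_mod_compact pos_projector_operators comm that)
  have "\<forall>a\<in>S. eventually (\<lambda>b. compact_operator (D a) = compact_operator (D b)) (at a within S)"
  proof
    fix a assume a: "a \<in> S"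
    obtain e where e: "e > 0" "\<And>T'. admissible K T' \<Longrightarrow> norm (T' - A a) < e \<Longrightarrow>
      \<exists>C. compact_operator C \<and> norm (pos_projector K T' - pos_projector K (A a) - C) < 1"
      using pos_projector_essentially_continuous[OF K adm[of a], of 1] by auto
    have "(A \<longlongrightarrow> A a) (at a within S)"
      using cont by (metis UNIV_I continuous_on_def subset_UNIV tendsto_within_subset)
    then have "\<forall>\<^sub>F b in at a within S. dist (A b) (A a) < e" using e(1) by (rule tendstoD)
    moreover have "\<forall>\<^sub>F b in at a within S. b \<in> S" by (simp add: eventually_at_filter)
    ultimately show "eventually (\<lambda>b. compact_operator (D a) = compact_operator (D b)) (at a within S)"
    proof eventually_elim
      case (elim b)
      then obtain C where C: "compact_operator C" "norm (pos_projector K (A b) - pos_projector K (A a) - C) < 1"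
        using e(2)[OF adm, of b] by (auto simp: dist_norm)
      have "norm (D b - (D a + C)) < 1" using C(2) by (simp add: D_def algebra_simps)
      then have "compact_operator (D b)" if "compact_operator (D a)"
        using compact_operator_essentially_small[OF D3[OF elim(2)] compact_operator_add[OF that C(1)]] by blast
      moreover have "D a - (D b - C) = - (pos_projector K (A b) - pos_projector K (A a) - C)" by (simp add: D_def)
      then have "norm (D a - (D b - C)) < 1" using C(2) by (simp only: norm_minus_cancel)
      then have "compact_operator (D a)" if "compact_operator (D b)"
        using compact_operator_essentially_small[OF D3[OF a] compact_operator_diff[OF that C(1)]] by blast
      ultimately show ?case by blast
    qed
  qed
  from connected_local_const[OF S(1) _ _ this]
  have const: "compact_operator (D a) = compact_operator (D b)" if "a \<in> S" "b \<in> S" for a b using that by blast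
  \<comment> \<open>Essential continuity at the limit \<open>L\<close> itself supplies a first
    parameter with compact difference.\<close>
  obtain e where e: "e > 0" "\<And>T'. admissible K T' \<Longrightarrow> norm (T' - L) < e \<Longrightarrow>
      \<exists>C. compact_operator C \<and> norm (pos_projector K T' - pos_projector K L - C) < 1"
    using pos_projector_essentially_continuous[OF K L(1), of 1] by auto
  have "\<forall>\<^sub>F s in F. s \<in> S \<and> dist (A s) L < e"
    using S(2) tendstoD[OF L(2) e(1)] by (rule eventually_conj)
  then obtain s where s: "s \<in> S" "norm (A s - L) < e"
    using eventually_happens'[OF L(3)] by (auto simp: dist_norm)
  from e(2)[OF adm s(2)] obtain C where "compact_operator C" "norm (D s - C) < 1" unfolding D_def by blast
  then have "compact_operator (D s)" by (rule compact_operator_essentially_small[OF D3[OF s(1)]])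
  then show ?thesis using const[OF s(1) t] unfolding D_def by blast
qed

text \<open>Through a parameter \<open>s\<close> near the limit, the difference is compact up to an
  arbitrarily small error, and compact operators are closed in norm.\<close>

lemma pos_projector_limit:
  fixes A :: "real \<Rightarrow> 'a::banach \<Rightarrow>\<^sub>L 'a"
  assumes K: "banach_over K" and adm: "\<And>t. admissible K (A t)"
    and L: "admissible K L" "(A \<longlongrightarrow> L) F" "F \<noteq> bot"
    and comp: "\<And>s t. compact_operator (pos_projector K (A t) - pos_projector K (A s))"
  shows "compact_operator (pos_projector K (A t) - pos_projector K L)"
proof (rule compact_operator_approx)
  fix e :: real assume e: "e > 0"
  obtain d where d: "d > 0" "\<And>T'. admissible K T' \<Longrightarrow> norm (T' - L) < d \<Longrightarrow>
      \<exists>C. compact_operator C \<and> norm (pos_projector K T' - pos_projector K L - C) < e"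
    using pos_projector_essentially_continuous[OF K L(1) e] by blast
  obtain s where s: "norm (A s - L) < d"
    using eventually_happens'[OF L(3) tendstoD[OF L(2) d(1)]] by (auto simp: dist_norm)
  from d(2)[OF adm s] obtain C where C: "compact_operator C" "norm (pos_projector K (A s) - pos_projector K L - C) < e" by blast
  have "pos_projector K (A t) - pos_projector K L - ((pos_projector K (A t) - pos_projector K (A s)) + C)
      = pos_projector K (A s) - pos_projector K L - C" by simp
  then have "norm (pos_projector K (A t) - pos_projector K L - ((pos_projector K (A t) - pos_projector K (A s)) + C)) \<le> e"
    using C(2) by (simp only: less_imp_le)
  then show "\<exists>S. compact_operator S \<and> norm (pos_projector K (A t) - pos_projector K L - S) \<le> e"
    using compact_operator_add[OF comp C(1)] by blast
qed

theorem lemma3p4: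
  fixes K :: "('a::banach \<Rightarrow>\<^sub>L 'a) scalars" and A :: "real \<Rightarrow> 'a \<Rightarrow>\<^sub>L 'a"
  assumes "banach_over K"
    and "asymptotically_hyperbolic K A"
    and "\<And>t. essentially_hyperbolic K (A t)"
  shows "essentially_splitting K A \<longleftrightarrow>
    (\<forall>s t. compact_operator (pos_projector K (A t) - pos_projector K (A s)))"
proof -
  note K = assms(1)
  have ops: "A t \<in> operators K" for t
    using assms(2) unfolding asymptotically_hyperbolic_def by auto
  have cont: "continuous_on UNIV A"
    using assms(2) unfolding asymptotically_hyperbolic_def by auto
  have adm: "admissible K (A t)" for t using ops assms(3) by (simp add: admissible_def)
  obtain L where L: "(A \<longlongrightarrow> L) at_top" "\<forall>z\<in>spectrum K L. Re z \<noteq> 0"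
    using assms(2) unfolding asymptotically_hyperbolic_def by blast
  obtain M where M: "(A \<longlongrightarrow> M) at_bot" "\<forall>z\<in>spectrum K M. Re z \<noteq> 0"
    using assms(2) unfolding asymptotically_hyperbolic_def by blast
  have Lop: "L \<in> operators K" by (rule Lim_in_closed_set[OF closed_operators _ _ L(1)]) (simp_all add: ops)
  have Mop: "M \<in> operators K" by (rule Lim_in_closed_set[OF closed_operators _ _ M(1)]) (simp_all add: ops)
  have Ladm: "admissible K L" and Madm: "admissible K M" using Lop Mop L(2) M(2) by (auto simp: admissible_def)
  have lims: "Lim at_top A = L" "Lim at_bot A = M" using L(1) M(1) by (auto intro: tendsto_Lim)
  define P where "P = pos_projector K L"
  define Q where "Q = pos_projector K M"
  have P: "P \<in> operators K" "P \<circ>\<^sub>L P = P"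
    unfolding P_def by (rule pos_projector_operators[OF K Ladm], rule pos_projector_idempotent[OF K Ladm])
  have Q: "Q \<in> operators K" "Q \<circ>\<^sub>L Q = Q"
    unfolding Q_def by (rule pos_projector_operators[OF K Madm], rule pos_projector_idempotent[OF K Madm])
  have spaces: "pos_space K L = range P" "neg_space K L = range (id_blinfun - P)"
    "pos_space K M = range Q" "neg_space K M = range (id_blinfun - Q)"
    unfolding pos_space_def neg_space_def P_def Q_def
    using neg_projector_hyperbolic[OF K Lop L(2)] neg_projector_hyperbolic[OF K Mop M(2)] by simp_all
  \<comment> \<open>The negative projectors at the hyperbolic limits are complements of the positive
    ones, so condition (i) becomes commutation with \<open>P\<close> or \<open>Q\<close> modulo
    compact operators.\<close>
  have splitting_iff: "essentially_splitting K A \<longleftrightarrow>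
      (\<forall>t>0. compact_operator (A t \<circ>\<^sub>L P - P \<circ>\<^sub>L A t)) \<and> (\<forall>t\<le>0. compact_operator (A t \<circ>\<^sub>L Q - Q \<circ>\<^sub>L A t)) \<and>
      compact_perturbation K (range (id_blinfun - Q)) (range (id_blinfun - P))"
    unfolding essentially_splitting_def lims spaces
    using assms(2) essential_splitting_iff[OF P ops] essential_splitting_iff[OF Q ops] by simp
  show ?thesis
  proof
    assume "essentially_splitting K A"
    then have cP: "\<And>t. t > 0 \<Longrightarrow> compact_operator (A t \<circ>\<^sub>L P - P \<circ>\<^sub>L A t)"
      and cQ: "\<And>t. t \<le> 0 \<Longrightarrow> compact_operator (A t \<circ>\<^sub>L Q - Q \<circ>\<^sub>L A t)"
      unfolding splitting_iff by blast+
    \<comment> \<open>The splitting at the right end is given for \<open>t > 0\<close> only. Norm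
      continuity and closedness of the compact operators extend it to \<open>t = 0\<close>, where
      the half-lines are joined.\<close>
    have cP0: "compact_operator (A t \<circ>\<^sub>L P - P \<circ>\<^sub>L A t)" if "t \<ge> 0" for t
    proof -
      have "continuous_on UNIV (\<lambda>t. A t \<circ>\<^sub>L P - P \<circ>\<^sub>L A t)"
        by (intro continuous_on_diff bounded_bilinear.continuous_on[OF bounded_bilinear_blinfun_compose] cont continuous_on_const)
      then have "closed ((\<lambda>t. A t \<circ>\<^sub>L P - P \<circ>\<^sub>L A t) -` compacts)"
        using operator_ideal_compact by (intro closed_vimage) (auto simp: operator_ideal_def)
      moreover have "{0<..} \<subseteq> (\<lambda>t. A t \<circ>\<^sub>L P - P \<circ>\<^sub>L A t) -` compacts" using cP by auto
      ultimately have "closure {0<..} \<subseteq> (\<lambda>t. A t \<circ>\<^sub>L P - P \<circ>\<^sub>L A t) -` compacts" by (intro closure_minimal)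
      then show ?thesis using that by (auto simp: closure_greaterThan)
    qed
    have right: "compact_operator (pos_projector K (A t) - P)" if "t \<ge> 0" for t
      unfolding P_def
      by (rule pos_projector_half_line[OF K adm cont Ladm L(1), where S="{0..}"])
        (use that cP0 in \<open>auto simp: P_def eventually_ge_at_top connected_Ici\<close>)
    have left: "compact_operator (pos_projector K (A t) - Q)" if "t \<le> 0" for t
      unfolding Q_def
      by (rule pos_projector_half_line[OF K adm cont Madm M(1), where S="{..0}"])
        (use that cQ in \<open>auto simp: Q_def eventually_le_at_bot connected_Iic\<close>)
    \<comment> \<open>Both limits are compared with the projector at \<open>t = 0\<close>.\<close>
    have QP: "compact_operator (Q - P)"
      using compact_operator_diff[OF right[of 0] left[of 0]] by simp
    have all: "compact_operator (pos_projector K (A t) - P)" for t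
    proof (cases "t \<ge> 0")
      case False
      then show ?thesis using compact_operator_add[OF left[of t] QP] by simp
    qed (rule right)
    show "\<forall>s t. compact_operator (pos_projector K (A t) - pos_projector K (A s))"
    proof (intro allI)
      fix s t show "compact_operator (pos_projector K (A t) - pos_projector K (A s))"
        using compact_operator_diff[OF all[of t] all[of s]] by simp
    qed
  next
    assume comp: "\<forall>s t. compact_operator (pos_projector K (A t) - pos_projector K (A s))"
    have cP: "compact_operator (pos_projector K (A t) - P)" for t
      unfolding P_def by (rule pos_projector_limit[OF K adm Ladm L(1)]) (use comp in auto)
    have cQ: "compact_operator (pos_projector K (A t) - Q)" for t
      unfolding Q_def by (rule pos_projector_limit[OF K adm Madm M(1)]) (use comp in auto)
    \<comment> \<open>\<open>A t\<close> commutes with its own positive projector, so its commutator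
      with \<open>R\<close> involves only the compact difference of the two.\<close>
    have commute: "compact_operator (A t \<circ>\<^sub>L R - R \<circ>\<^sub>L A t)" if "compact_operator (pos_projector K (A t) - R)" for R t
    proof -
      let ?R = "pos_projector K (A t)"
      have "compact_operator (?R \<circ>\<^sub>L A t - A t \<circ>\<^sub>L ?R)"
        by (rule pos_projector_commute_mod_compact[OF K adm ops]) (simp add: compact_operator_zero)
      moreover have "A t \<circ>\<^sub>L R - R \<circ>\<^sub>L A t = (?R - R) \<circ>\<^sub>L A t - A t \<circ>\<^sub>L (?R - R) - (?R \<circ>\<^sub>L A t - A t \<circ>\<^sub>L ?R)"
        by (rule blinfun_eqI) (simp add: op_simps)
      ultimately show ?thesis
        using that by (simp add: compact_operator_diff compact_operator_compose_left compact_operator_compose_right)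
    qed
    have QP: "compact_operator (Q - P)" using compact_operator_diff[OF cP[of 0] cQ[of 0]] by simp
    have "compact_perturbation K (range (id_blinfun - Q)) (range (id_blinfun - P))"
      unfolding compact_perturbation_def
    proof (intro exI conjI)
      have PP: "P (P x) = P x" and QQ: "Q (Q x) = Q x" for x using P(2) Q(2) by (metis blinfun_apply_blinfun_compose)+
      show "projector_onto K (range (id_blinfun - Q)) (id_blinfun - Q)" "projector_onto K (range (id_blinfun - P)) (id_blinfun - P)"
        unfolding projector_onto_def using P Q operators_id_diff
        by (auto intro!: blinfun_eqI simp: op_simps PP QQ)
      \<comment> \<open>Since \<open>P (id - P) = 0\<close>, the operator \<open>Q (id - P)\<close>
        can be rewritten with the compact difference \<open>Q - P\<close> as left factor, and
        likewise with the roles exchanged.\<close>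
      have "(id_blinfun - (id_blinfun - Q)) \<circ>\<^sub>L (id_blinfun - P) = (Q - P) \<circ>\<^sub>L (id_blinfun - P)"
        "(id_blinfun - (id_blinfun - P)) \<circ>\<^sub>L (id_blinfun - Q) = (P - Q) \<circ>\<^sub>L (id_blinfun - Q)"
        by (rule blinfun_eqI; simp add: op_simps PP QQ)+
      then show "compact_operator ((id_blinfun - (id_blinfun - Q)) \<circ>\<^sub>L (id_blinfun - P))"
        "compact_operator ((id_blinfun - (id_blinfun - P)) \<circ>\<^sub>L (id_blinfun - Q))"
        using QP compact_operator_minus_commute[of Q P] by (simp_all add: compact_operator_compose_right)
    qed
    then show "essentially_splitting K A" unfolding splitting_iff using commute cP cQ by blast
  qed
qed

end
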